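(* Let $n\ge 1$. (1) The monomials formed by the finite non-decreasing sequences (i.e. products $y_1y_2\cdots y_r$, $r\ge 0$, with $y_1\le y_2\le\cdots\le y_r$, repetitions allowed) of elements of $\mathcal{B}=\{e_{ij}\mid 1\le i<j\le n+1\}$ constitute a free basis of the $k$-module $U_q^{+}(sl_{n+1})$. (2) $(sl_{n+1}^{+})_q|_{t=0}=sl_{n+1}^{+}$, and $(sl_{n+1}^{+})_q$ is a deformation of $sl_{n+1}^{+}$ in the category of $T$-Lie algebras.
   Context: **$T$-Lie algebras.** Let $k$ be a commutative unitary ring, $\mathbb{N}=\{1,2,\ldots\}$, and let $L$ be a free $k$-module with a given totally ordered basis $\mathcal{B}$; $\otimes$ means $\otimes_k$. Let $L^{3}\subseteq L^{\otimes 3}$ be the $k$-span of the $x\otimes y\otimes z$ with $x<y<z$ in $\mathcal{B}$, and ${}^{3}L$ the $k$-span of those with $x>y>z$ in $\mathcal{B}$. $L$ together with $k$-linear maps $S,T,\langle,\rangle:L\otimes L\to L\otimes L$ (presymmetry, symmetry, pseudobracket) and $[,]:L\otimes L\to L$ (bracket) is a *$T$-Lie algebra with basis $\mathcal{B}$* if, with $S_{12}=S\otimes Id$, $S_{23}=Id\otimes S$: 1. (a) $S^2=Id$; (b) for all $x,y\in\mathcal{B}$, $S(x\otimes y)=q_{x,y}\,y\otimes x$ for some $q_{x,y}\in k$; (c) $S(Id\otimes[,])|_{L^3}=([,]\otimes Id)S_{23}S_{12}|_{L^3}$ and $S([,]\otimes Id)|_{L^3}=(Id\otimes[,])S_{12}S_{23}|_{L^3}$.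 2. There is a strict grading of $L$ relative to $[,]$, i.e. a decomposition $L=\bigoplus_{\eta\in\mathbb{N}}L_\eta$ into $k$-submodules with $[L_{\eta_1},L_{\eta_2}]\subseteq L_{\eta_1+\eta_2-1}$ for all $\eta_1,\eta_2\in\mathbb{N}$; and $\langle L_{\eta_1}\otimes L_{\eta_2}\rangle\subseteq\bigoplus_{\alpha+\beta\le\eta_1+\eta_2-1}L_\alpha\otimes L_\beta$ for all $\eta_1,\eta_2$. For $x\in L_\eta$ write $\eta(x)=\eta$. 3. $T=S+\langle,\rangle$. 4. $[,]T=-[,]$; $\langle,\rangle S=-\langle,\rangle$; $[,]\langle,\rangle=0$. 5. $[,]\big((Id\otimes[,])S_{12}S_{23}-([,]\otimes Id)S_{23}S_{12}+(Id\otimes[,])S_{23}S_{12}\big)|_{{}^{3}L}=0$. A morphism of $T$-Lie algebras is a $k$-linear map $f$ that is a morphism of graded algebras relative to the brackets and such that $f\otimes f$ commutes with the pseudobrackets and with the presymmetries. **$(sl_{n+1}^+)_q$.** Let $\mathbb{K}$ be a field, $q=\exp(t)\in\mathbb{K}[[t]]$, and now $k=\mathbb{K}[q,q^{-1}]$. $(sl_{n+1}^{+})_q$ is the free $k$-module with basis $\mathcal{B}=\{e_{ij}\mid 1\le i<j\le n+1\}$ (symbols for the matrix units), totally ordered by: $e_{ab}<e_{uv}$ iff $a+b<u+v$, or $a+b=u+v$ and $b<v$. Its structure is: - $S(e_{ab}\otimes e_{uv})=q^{c_{ab,uv}}e_{uv}\otimes e_{ab}$ for $e_{ab}<e_{uv}$,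 where $c_{ab,uv}\in\mathbb{Z}$ is given by $[e_{aa}-e_{bb},e_{uv}]=c_{ab,uv}e_{uv}$ (matrix commutator); $S(x\otimes x)=x\otimes x$ for $x\in\mathcal{B}$; for $e_{ab}>e_{uv}$, $S$ is determined by $S^2=Id$. - Bracket: $[x,y]_q=[x,y]$ (matrix commutator) if $x<y$ in $\mathcal{B}$; $[x,x]_q=0$; for $x<y$ with $S(x\otimes y)=q^{c}y\otimes x$, $[y,x]_q=-q^{-c}[x,y]_q$. - $\langle e_{ij},e_{uv}\rangle=(q-q^{-1})e_{iv}\otimes e_{uj}$ if $i<u<j<v$; $=(q^{-1}-q)e_{uj}\otimes e_{iv}$ if $u<i<v<j$; $=0$ otherwise. - $T=S+\langle,\rangle$; grading $\eta(e_{ij})=i(j-i)$. Here $|_{t=0}$ denotes specialization at $t=0$ (base change $k\to\mathbb{K}$, $q\mapsto 1$), and $sl_{n+1}^{+}$ is the classical Lie algebra of upper triangular $(n+1)\times(n+1)$ matrices over $\mathbb{K}$ with basis the matrix units $e_{ij}$, $i<j$, regarded as a $T$-Lie algebra with bracket the commutator, zero pseudobracket and $S=T$ the usual flip. "Deformation in the category of $T$-Lie algebras" means that $(sl_{n+1}^{+})_q$ is a $T$-Lie algebra over $k$ with this specialization. **$U_q^+(sl_{n+1})$** is the positive part of the Drinfeld–Jimbo quantum group of type $A_n$ over $k$: the $k$-subalgebra generated by $E_1,\ldots,E_n$ in the $\mathbb{K}(q)$-algebra with generators $E_1,\ldots,E_n$ and relations $E_iE_j=E_jE_i$ for $|i-j|>1$,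 $E_i^2E_j-(q+q^{-1})E_iE_jE_i+E_jE_i^2=0$ for $|i-j|=1$. In it, $e_{i,i+1}=E_i$ and recursively $e_{ij}=e_{i,j-1}e_{j-1,j}-q^{-1}e_{j-1,j}e_{i,j-1}$ for $j-i\ge 2$; these elements are totally ordered by: $e_{ab}<e_{uv}$ iff $a+b<u+v$, or $a+b=u+v$ and $b<v$.
   Formalization: The strict grading is read as [L_a,L_b] ⊆ ⊕_{c≤a+b-1} L_c: the printed [L_a,L_b] ⊆ L_{a+b-1} fails for n≥3 with η(e_ij)=i(j-i), since [e_12,e_24]=e_14 has degree 3, not 4. K has characteristic 0, as exp(t) requires. *)

theory Defs
  imports
    "HOL-Library.Poly_Mapping"
    "HOL-Computational_Algebra.Formal_Power_Series"
    "HOL-Computational_Algebra.Fraction_Field"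
    "HOL-Algebra.QuotRing"
    "HOL-Algebra.Generated_Rings"
    "HOL-Algebra.Module"
begin

section \<open>The ring $k = K[q, q^{-1}]$ with $q = \exp(t)$ in $K[[t]]$\<close>

text \<open>The series $\exp(t)$ only exists in characteristic 0, hence the sort of the field.\<close>

inductive_set laurent_q :: "'a::field_char_0 fps set" where
  const: "fps_const a \<in> laurent_q"
| q: "fps_exp 1 \<in> laurent_q"
| q_inv: "inverse (fps_exp 1) \<in> laurent_q"
| add: "f \<in> laurent_q \<Longrightarrow> g \<in> laurent_q \<Longrightarrow> f + g \<in> laurent_q"
| mult: "f \<in> laurent_q \<Longrightarrow> g \<in> laurent_q \<Longrightarrow> f * g \<in> laurent_q"

lemma laurent_q_0: "0 \<in> laurent_q"
  using laurent_q.const[of 0] by simp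

lemma laurent_q_1: "1 \<in> laurent_q"
  using laurent_q.const[of 1] by simp

lemma laurent_q_uminus: "f \<in> laurent_q \<Longrightarrow> - f \<in> laurent_q"
  using laurent_q.mult[OF laurent_q.const[of "- 1"], of f]
  by (simp flip: fps_const_neg)

lemma laurent_q_diff: "f \<in> laurent_q \<Longrightarrow> g \<in> laurent_q \<Longrightarrow> f - g \<in> laurent_q"
  using laurent_q.add[OF _ laurent_q_uminus, of f g] by simp

lemma laurent_q_power: "f \<in> laurent_q \<Longrightarrow> f ^ m \<in> laurent_q"
  by (induction m) (auto intro: laurent_q_1 laurent_q.mult)

lemma laurent_q_powi: "fps_exp 1 powi c \<in> laurent_q"
  by (auto simp: power_int_def intro: laurent_q_power laurent_q.intros)

typedef (overloaded) 'a klaurent = "laurent_q :: 'a::field_char_0 fps set"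
  using laurent_q_0 by blast

setup_lifting type_definition_klaurent

instantiation klaurent :: (field_char_0) idom
begin

lift_definition zero_klaurent :: "'a klaurent" is 0 by (rule laurent_q_0)
lift_definition one_klaurent :: "'a klaurent" is 1 by (rule laurent_q_1)
lift_definition plus_klaurent :: "'a klaurent \<Rightarrow> 'a klaurent \<Rightarrow> 'a klaurent" is "(+)"
  by (rule laurent_q.add)
lift_definition minus_klaurent :: "'a klaurent \<Rightarrow> 'a klaurent \<Rightarrow> 'a klaurent" is "(-)"
  by (rule laurent_q_diff)
lift_definition uminus_klaurent :: "'a klaurent \<Rightarrow> 'a klaurent" is uminus
  by (rule laurent_q_uminus)
lift_definition times_klaurent :: "'a klaurent \<Rightarrow> 'a klaurent \<Rightarrow> 'a klaurent" is "(*)"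
  by (rule laurent_q.mult)

instance
  by standard (transfer; simp add: algebra_simps)+

end

lift_definition qpow :: "int \<Rightarrow> 'a::field_char_0 klaurent" is "\<lambda>c. fps_exp 1 powi c"
  by (rule laurent_q_powi)

text \<open>Specialization at $t = 0$, i.e. the ring homomorphism $k \to K$ with $q \mapsto 1$.\<close>

lift_definition eval_t0 :: "'a::field_char_0 klaurent \<Rightarrow> 'a" is "\<lambda>f. fps_nth f 0" .


section \<open>Free modules and linear maps\<close>

text \<open>
  The free module with basis \<open>B\<close> is the set of finitely supported functions with support in \<open>B\<close>;
  its second and third tensor powers are the free modules on \<open>B \<times> B\<close> and \<open>B \<times> B \<times> B\<close>.
\<close>

definition scale :: "'k::comm_ring_1 \<Rightarrow> ('b \<Rightarrow>\<^sub>0 'k) \<Rightarrow> ('b \<Rightarrow>\<^sub>0 'k)" where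
  "scale c p = Poly_Mapping.map ((*) c) p"

lemma lookup_scale: "Poly_Mapping.lookup (scale c p) b = c * Poly_Mapping.lookup p b"
  by (simp add: scale_def Poly_Mapping.map.rep_eq when_def)

global_interpretation vec: Modules.module "scale :: 'k::comm_ring_1 \<Rightarrow> ('b \<Rightarrow>\<^sub>0 'k) \<Rightarrow> _"
  by standard (auto intro!: poly_mapping_eqI simp: lookup_scale lookup_add algebra_simps)

definition free_mod :: "'b set \<Rightarrow> ('b \<Rightarrow>\<^sub>0 'k::comm_ring_1) set" where
  "free_mod B = {p. Poly_Mapping.keys p \<subseteq> B}"

abbreviation bas :: "'b \<Rightarrow> ('b \<Rightarrow>\<^sub>0 'k::comm_ring_1)" where
  "bas b \<equiv> Poly_Mapping.single b 1"

text \<open>The linear map sending each basis element \<open>b \<in> B\<close> to \<open>f b\<close> (and those outside \<open>B\<close> to 0).\<close>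

definition lin_ext :: "'b set \<Rightarrow> ('b \<Rightarrow> ('c \<Rightarrow>\<^sub>0 'k)) \<Rightarrow> ('b \<Rightarrow>\<^sub>0 'k::comm_ring_1) \<Rightarrow> ('c \<Rightarrow>\<^sub>0 'k)" where
  "lin_ext B f p = (\<Sum>b \<in> Poly_Mapping.keys p \<inter> B. scale (Poly_Mapping.lookup p b) (f b))"

definition tens :: "('b \<Rightarrow>\<^sub>0 'k::comm_ring_1) \<Rightarrow> ('c \<Rightarrow>\<^sub>0 'k) \<Rightarrow> ('b \<times> 'c \<Rightarrow>\<^sub>0 'k)" where
  "tens p r = (\<Sum>x \<in> Poly_Mapping.keys p. \<Sum>y \<in> Poly_Mapping.keys r.
     Poly_Mapping.single (x, y) (Poly_Mapping.lookup p x * Poly_Mapping.lookup r y))"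

text \<open>\<open>f \<otimes> Id\<close> and \<open>Id \<otimes> f\<close> on the third tensor power, for \<open>f\<close> defined on the second one.\<close>

definition tens_Id :: "(('b \<times> 'b \<Rightarrow>\<^sub>0 'k::comm_ring_1) \<Rightarrow> ('c \<Rightarrow>\<^sub>0 'k)) \<Rightarrow>
    ('b \<times> 'b \<times> 'b \<Rightarrow>\<^sub>0 'k) \<Rightarrow> ('c \<times> 'b \<Rightarrow>\<^sub>0 'k)" where
  "tens_Id f = lin_ext UNIV (\<lambda>(x, y, z). tens (f (bas (x, y))) (bas z))"

definition Id_tens :: "(('b \<times> 'b \<Rightarrow>\<^sub>0 'k::comm_ring_1) \<Rightarrow> ('c \<Rightarrow>\<^sub>0 'k)) \<Rightarrow>
    ('b \<times> 'b \<times> 'b \<Rightarrow>\<^sub>0 'k) \<Rightarrow> ('b \<times> 'c \<Rightarrow>\<^sub>0 'k)" where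
  "Id_tens f = lin_ext UNIV (\<lambda>(x, y, z). tens (bas x) (f (bas (y, z))))"

definition tens_assoc :: "(('b \<times> 'b) \<times> 'b \<Rightarrow>\<^sub>0 'k::comm_ring_1) \<Rightarrow> ('b \<times> 'b \<times> 'b \<Rightarrow>\<^sub>0 'k)" where
  "tens_assoc = lin_ext UNIV (\<lambda>((x, y), z). bas (x, y, z))"


section \<open>T-Lie algebras\<close>

text \<open>
  \<open>Grade \<eta>\<close> is the homogeneous component of degree \<open>\<eta>\<close>; only indices \<open>\<eta> \<ge> 1\<close> are relevant.
  The maps are total functions on finitely supported functions on the whole type; only their values
  on the tensor powers of the free module on \<open>Basis\<close> matter.
\<close>

record (overloaded) ('b, 'k) t_lie =
  Basis :: "'b set"
  Less :: "('b \<times> 'b) set"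
  Presym :: "('b \<times> 'b \<Rightarrow>\<^sub>0 'k::comm_ring_1) \<Rightarrow> ('b \<times> 'b \<Rightarrow>\<^sub>0 'k)"
  Sym :: "('b \<times> 'b \<Rightarrow>\<^sub>0 'k) \<Rightarrow> ('b \<times> 'b \<Rightarrow>\<^sub>0 'k)"
  Pseudo :: "('b \<times> 'b \<Rightarrow>\<^sub>0 'k) \<Rightarrow> ('b \<times> 'b \<Rightarrow>\<^sub>0 'k)"
  Brack :: "('b \<times> 'b \<Rightarrow>\<^sub>0 'k) \<Rightarrow> ('b \<Rightarrow>\<^sub>0 'k)"
  Grade :: "nat \<Rightarrow> ('b \<Rightarrow>\<^sub>0 'k) set"

definition direct_decomposition ::
    "('b \<Rightarrow>\<^sub>0 'k::comm_ring_1) set \<Rightarrow> (nat \<Rightarrow> ('b \<Rightarrow>\<^sub>0 'k) set) \<Rightarrow> bool" where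
  "direct_decomposition M G \<longleftrightarrow>
     (\<forall>\<eta>\<ge>1. vec.subspace (G \<eta>) \<and> G \<eta> \<subseteq> M) \<and>
     (\<forall>x\<in>M. \<exists>!f. (\<forall>\<eta>\<ge>1. f \<eta> \<in> G \<eta>) \<and> f 0 = 0 \<and> finite {\<eta>. f \<eta> \<noteq> 0} \<and>
        x = (\<Sum>\<eta> | f \<eta> \<noteq> 0. f \<eta>))"

definition tensor_square :: "('b, 'k::comm_ring_1) t_lie \<Rightarrow> ('b \<times> 'b \<Rightarrow>\<^sub>0 'k) set" where
  "tensor_square L = free_mod (Basis L \<times> Basis L)"

definition S12 :: "('b, 'k::comm_ring_1) t_lie \<Rightarrow> ('b \<times> 'b \<times> 'b \<Rightarrow>\<^sub>0 'k) \<Rightarrow> ('b \<times> 'b \<times> 'b \<Rightarrow>\<^sub>0 'k)" where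
  "S12 L p = tens_assoc (tens_Id (Presym L) p)"

definition S23 :: "('b, 'k::comm_ring_1) t_lie \<Rightarrow> ('b \<times> 'b \<times> 'b \<Rightarrow>\<^sub>0 'k) \<Rightarrow> ('b \<times> 'b \<times> 'b \<Rightarrow>\<^sub>0 'k)" where
  "S23 L p = Id_tens (Presym L) p"

text \<open>$L^3$ and ${}^3L$, respectively.\<close>

definition increasing_cube :: "('b, 'k::comm_ring_1) t_lie \<Rightarrow> ('b \<times> 'b \<times> 'b \<Rightarrow>\<^sub>0 'k) set" where
  "increasing_cube L = vec.span {bas (x, y, z) |x y z.
     x \<in> Basis L \<and> y \<in> Basis L \<and> z \<in> Basis L \<and> (x, y) \<in> Less L \<and> (y, z) \<in> Less L}"

definition decreasing_cube :: "('b, 'k::comm_ring_1) t_lie \<Rightarrow> ('b \<times> 'b \<times> 'b \<Rightarrow>\<^sub>0 'k) set" where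
  "decreasing_cube L = vec.span {bas (x, y, z) |x y z.
     x \<in> Basis L \<and> y \<in> Basis L \<and> z \<in> Basis L \<and> (y, x) \<in> Less L \<and> (z, y) \<in> Less L}"

text \<open>
  The strict grading condition is read in filtered form:
  the bracket of components of degrees \<open>\<eta>1\<close>, \<open>\<eta>2\<close> lies in the sum of the components of degree
  at most \<open>\<eta>1 + \<eta>2 - 1\<close>, just as for the pseudobracket. With equality of degrees required, the
  grading \<open>\<eta>(e\<^sub>i\<^sub>j) = i (j - i)\<close> used below would not be admissible: the bracket of \<open>e\<^sub>1\<^sub>2\<close>
  (degree 1) and \<open>e\<^sub>2\<^sub>4\<close> (degree 4) is \<open>e\<^sub>1\<^sub>4\<close> (degree 3, not 4).
\<close>

locale t_lie_algebra =
  fixes L :: "('b, 'k::comm_ring_1) t_lie"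
  assumes order: "strict_linear_order_on (Basis L) (Less L)"
    and linear: "module_hom scale scale (Presym L)" "module_hom scale scale (Sym L)"
      "module_hom scale scale (Pseudo L)" "module_hom scale scale (Brack L)"
    and closed: "Presym L ` tensor_square L \<subseteq> tensor_square L"
      "Sym L ` tensor_square L \<subseteq> tensor_square L"
      "Pseudo L ` tensor_square L \<subseteq> tensor_square L"
      "Brack L ` tensor_square L \<subseteq> free_mod (Basis L)"
    and presym_involution: "p \<in> tensor_square L \<Longrightarrow> Presym L (Presym L p) = p"
    and presym_basis: "a \<in> Basis L \<Longrightarrow> b \<in> Basis L \<Longrightarrow>
      \<exists>c. Presym L (bas (a, b)) = scale c (bas (b, a))"
    and presym_brack: "w \<in> increasing_cube L \<Longrightarrow>
        Presym L (Id_tens (Brack L) w) = tens_Id (Brack L) (S23 L (S12 L w))"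
      "w \<in> increasing_cube L \<Longrightarrow>
        Presym L (tens_Id (Brack L) w) = Id_tens (Brack L) (S12 L (S23 L w))"
    and grading: "direct_decomposition (free_mod (Basis L)) (Grade L)"
    and grading_brack: "\<eta>1 \<ge> 1 \<Longrightarrow> \<eta>2 \<ge> 1 \<Longrightarrow> x \<in> Grade L \<eta>1 \<Longrightarrow> y \<in> Grade L \<eta>2 \<Longrightarrow>
      Brack L (tens x y) \<in> vec.span (\<Union>\<alpha>\<in>{1..\<eta>1 + \<eta>2 - 1}. Grade L \<alpha>)"
    and grading_pseudo: "\<eta>1 \<ge> 1 \<Longrightarrow> \<eta>2 \<ge> 1 \<Longrightarrow> x \<in> Grade L \<eta>1 \<Longrightarrow> y \<in> Grade L \<eta>2 \<Longrightarrow>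
      Pseudo L (tens x y) \<in> vec.span {tens u v |u v \<alpha> \<beta>. \<alpha> \<ge> 1 \<and> \<beta> \<ge> 1 \<and>
        \<alpha> + \<beta> \<le> \<eta>1 + \<eta>2 - 1 \<and> u \<in> Grade L \<alpha> \<and> v \<in> Grade L \<beta>}"
    and sym_eq: "p \<in> tensor_square L \<Longrightarrow> Sym L p = Presym L p + Pseudo L p"
    and brack_sym: "p \<in> tensor_square L \<Longrightarrow> Brack L (Sym L p) = - Brack L p"
    and pseudo_presym: "p \<in> tensor_square L \<Longrightarrow> Pseudo L (Presym L p) = - Pseudo L p"
    and brack_pseudo: "p \<in> tensor_square L \<Longrightarrow> Brack L (Pseudo L p) = 0"
    and jacobi: "w \<in> decreasing_cube L \<Longrightarrow>
      Brack L (Id_tens (Brack L) (S12 L (S23 L w)) - tens_Id (Brack L) (S23 L (S12 L w))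
        + Id_tens (Brack L) (S23 L (S12 L w))) = 0"

text \<open>
  Base change along a ring homomorphism \<open>\<phi>\<close>: the free module on \<open>Basis\<close> over the new ring, with the
  matrices of all structure maps mapped by \<open>\<phi>\<close>.
\<close>

definition base_change :: "('k \<Rightarrow> 'l) \<Rightarrow> ('b, 'k::comm_ring_1) t_lie \<Rightarrow> ('b, 'l::comm_ring_1) t_lie" where
  "base_change \<phi> L =
     (let BB = Basis L \<times> Basis L in
      \<lparr>Basis = Basis L, Less = Less L,
       Presym = lin_ext BB (\<lambda>b. Poly_Mapping.map \<phi> (Presym L (bas b))),
       Sym = lin_ext BB (\<lambda>b. Poly_Mapping.map \<phi> (Sym L (bas b))),
       Pseudo = lin_ext BB (\<lambda>b. Poly_Mapping.map \<phi> (Pseudo L (bas b))),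
       Brack = lin_ext BB (\<lambda>b. Poly_Mapping.map \<phi> (Brack L (bas b))),
       Grade = (\<lambda>\<eta>. vec.span (Poly_Mapping.map \<phi> ` Grade L \<eta>))\<rparr>)"

definition t_lie_deformation ::
    "('k \<Rightarrow> 'l) \<Rightarrow> ('b, 'k::comm_ring_1) t_lie \<Rightarrow> ('b, 'l::comm_ring_1) t_lie \<Rightarrow> bool" where
  "t_lie_deformation \<phi> L L0 \<longleftrightarrow> t_lie_algebra L \<and> t_lie_algebra L0 \<and> base_change \<phi> L = L0"


section \<open>$sl_{n+1}^+$ and $(sl_{n+1}^+)_q$\<close>

text \<open>
  The pair \<open>(i, j)\<close> stands for the matrix unit \<open>e\<^sub>i\<^sub>j\<close>, so that a finitely supported function on pairs
  is a matrix with finitely many nonzero entries.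
\<close>

definition units :: "nat \<Rightarrow> (nat \<times> nat) set" where
  "units n = {(i, j). 1 \<le> i \<and> i < j \<and> j \<le> n + 1}"

definition unit_less :: "nat \<times> nat \<Rightarrow> nat \<times> nat \<Rightarrow> bool" where
  "unit_less = (\<lambda>(a, b) (u, v). a + b < u + v \<or> a + b = u + v \<and> b < v)"

definition mat_mult ::
    "(nat \<times> nat \<Rightarrow>\<^sub>0 'k::comm_ring_1) \<Rightarrow> (nat \<times> nat \<Rightarrow>\<^sub>0 'k) \<Rightarrow> (nat \<times> nat \<Rightarrow>\<^sub>0 'k)" where
  "mat_mult A B = (\<Sum>(i, j) \<in> Poly_Mapping.keys A. \<Sum>(u, v) \<in> Poly_Mapping.keys B.
     if j = u then Poly_Mapping.single (i, v) (Poly_Mapping.lookup A (i, j) * Poly_Mapping.lookup B (u, v))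
     else 0)"

definition commutator ::
    "(nat \<times> nat \<Rightarrow>\<^sub>0 'k::comm_ring_1) \<Rightarrow> (nat \<times> nat \<Rightarrow>\<^sub>0 'k) \<Rightarrow> (nat \<times> nat \<Rightarrow>\<^sub>0 'k)" where
  "commutator A B = mat_mult A B - mat_mult B A"

definition unit_weight :: "nat \<times> nat \<Rightarrow> nat \<times> nat \<Rightarrow> int" where
  "unit_weight = (\<lambda>(a, b) y. THE c. commutator (bas (a, a) - bas (b, b)) (bas y) = scale c (bas y))"

definition unit_grade :: "nat \<Rightarrow> nat \<Rightarrow> (nat \<times> nat \<Rightarrow>\<^sub>0 'k::comm_ring_1) set" where
  "unit_grade n \<eta> = vec.span {bas (i, j) |i j. (i, j) \<in> units n \<and> i * (j - i) = \<eta>}"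

definition sl_plus :: "nat \<Rightarrow> (nat \<times> nat, 'k::comm_ring_1) t_lie" where
  "sl_plus n =
     (let BB = units n \<times> units n; flip = lin_ext BB (\<lambda>(x, y). bas (y, x)) in
      \<lparr>Basis = units n, Less = {(x, y). unit_less x y},
       Presym = flip, Sym = flip, Pseudo = (\<lambda>_. 0),
       Brack = lin_ext BB (\<lambda>(x, y). commutator (bas x) (bas y)),
       Grade = unit_grade n\<rparr>)"

text \<open>For \<open>x > y\<close> the value of the presymmetry at \<open>x \<otimes> y\<close> is the one forced by \<open>S\<^sup>2 = Id\<close>.\<close>

definition slq_presym :: "nat \<Rightarrow> ((nat \<times> nat) \<times> (nat \<times> nat) \<Rightarrow>\<^sub>0 'a::field_char_0 klaurent) \<Rightarrow> _" where
  "slq_presym n = lin_ext (units n \<times> units n) (\<lambda>(x, y).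
     if unit_less x y then scale (qpow (unit_weight x y)) (bas (y, x))
     else if x = y then bas (x, x)
     else scale (qpow (- unit_weight y x)) (bas (y, x)))"

definition slq_pseudo :: "nat \<Rightarrow> ((nat \<times> nat) \<times> (nat \<times> nat) \<Rightarrow>\<^sub>0 'a::field_char_0 klaurent) \<Rightarrow> _" where
  "slq_pseudo n = lin_ext (units n \<times> units n) (\<lambda>((i, j), (u, v)).
     if i < u \<and> u < j \<and> j < v then scale (qpow 1 - qpow (- 1)) (bas ((i, v), (u, j)))
     else if u < i \<and> i < v \<and> v < j then scale (qpow (- 1) - qpow 1) (bas ((u, j), (i, v)))
     else 0)"

definition slq_brack ::
    "nat \<Rightarrow> ((nat \<times> nat) \<times> (nat \<times> nat) \<Rightarrow>\<^sub>0 'a::field_char_0 klaurent) \<Rightarrow> (nat \<times> nat \<Rightarrow>\<^sub>0 'a klaurent)" where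
  "slq_brack n = lin_ext (units n \<times> units n) (\<lambda>(x, y).
     if unit_less x y then commutator (bas x) (bas y)
     else if x = y then 0
     else scale (- qpow (- unit_weight y x)) (commutator (bas y) (bas x)))"

definition sl_plus_q :: "nat \<Rightarrow> (nat \<times> nat, 'a::field_char_0 klaurent) t_lie" where
  "sl_plus_q n =
     \<lparr>Basis = units n, Less = {(x, y). unit_less x y},
      Presym = slq_presym n, Sym = (\<lambda>p. slq_presym n p + slq_pseudo n p), Pseudo = slq_pseudo n,
      Brack = slq_brack n, Grade = unit_grade n\<rparr>"


section \<open>The algebra $U_q^+(sl_{n+1})$\<close>

text \<open>
  Words over the generators form a monoid under concatenation, and finitely supported functions on a
  monoid form its monoid algebra; thus \<open>nat list \<Rightarrow>\<^sub>0 'f\<close> is the free associative algebra.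
\<close>

instantiation list :: (type) monoid_add
begin

definition zero_list :: "'a list" where "zero_list = []"
definition plus_list :: "'a list \<Rightarrow> 'a list \<Rightarrow> 'a list" where "plus_list = (@)"

instance
  by standard (simp_all add: zero_list_def plus_list_def)

end

definition free_algebra :: "nat \<Rightarrow> (nat list \<Rightarrow>\<^sub>0 'f::field) ring" where
  "free_algebra n = \<lparr>carrier = {p. \<forall>w \<in> Poly_Mapping.keys p. set w \<subseteq> {1..n}},
     mult = (*), one = 1, zero = 0, add = (+)\<rparr>"

abbreviation gen :: "nat \<Rightarrow> (nat list \<Rightarrow>\<^sub>0 'f::field)" where
  "gen i \<equiv> Poly_Mapping.single [i] 1"

abbreviation scal :: "'f::field \<Rightarrow> (nat list \<Rightarrow>\<^sub>0 'f)" where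
  "scal c \<equiv> Poly_Mapping.single [] c"

definition serre_relations :: "'f::field \<Rightarrow> nat \<Rightarrow> (nat list \<Rightarrow>\<^sub>0 'f) set" where
  "serre_relations q n =
     {gen i * gen j - gen j * gen i |i j. i \<in> {1..n} \<and> j \<in> {1..n} \<and> (i + 1 < j \<or> j + 1 < i)} \<union>
     {gen i * gen i * gen j - scal (q + inverse q) * gen i * gen j * gen i + gen j * gen i * gen i |i j.
        i \<in> {1..n} \<and> j \<in> {1..n} \<and> (j = i + 1 \<or> i = j + 1)}"

definition to_Kq :: "'a::field_char_0 klaurent \<Rightarrow> 'a klaurent fract" where
  "to_Kq c = Fraction_Field.Fract c 1"

definition serre_ideal :: "nat \<Rightarrow> (nat list \<Rightarrow>\<^sub>0 'a::field_char_0 klaurent fract) set" where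
  "serre_ideal n = genideal (free_algebra n) (serre_relations (to_Kq (qpow 1)) n)"

text \<open>The algebra with these generators and relations over $K(q)$, the fraction field of $k$.\<close>

definition U_Kq :: "nat \<Rightarrow> (nat list \<Rightarrow>\<^sub>0 'a::field_char_0 klaurent fract) set ring" where
  "U_Kq n = free_algebra n Quot serre_ideal n"

definition U_class :: "nat \<Rightarrow> (nat list \<Rightarrow>\<^sub>0 'a::field_char_0 klaurent fract) \<Rightarrow>
    (nat list \<Rightarrow>\<^sub>0 'a klaurent fract) set" where
  "U_class n p = serre_ideal n +>\<^bsub>free_algebra n\<^esub> p"

definition U_q_plus ::
    "nat \<Rightarrow> ('a::field_char_0 klaurent, (nat list \<Rightarrow>\<^sub>0 'a klaurent fract) set) module" where
  "U_q_plus n =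
     \<lparr>carrier = generate_ring (U_Kq n)
        (range (\<lambda>c. U_class n (scal (to_Kq c))) \<union> (\<lambda>i. U_class n (gen i)) ` {1..n}),
      mult = mult (U_Kq n), one = one (U_Kq n), zero = zero (U_Kq n), add = add (U_Kq n),
      smult = (\<lambda>c x. U_class n (scal (to_Kq c)) \<otimes>\<^bsub>U_Kq n\<^esub> x)\<rparr>"

text \<open>\<open>root_vec n i d\<close> is \<open>e\<^sub>i\<^sub>j\<close> with \<open>j = i + d\<close>; the value at \<open>d = 0\<close> is irrelevant.\<close>

fun root_vec :: "nat \<Rightarrow> nat \<Rightarrow> nat \<Rightarrow> (nat list \<Rightarrow>\<^sub>0 'a::field_char_0 klaurent fract) set" where
  "root_vec n i 0 = \<zero>\<^bsub>U_q_plus n\<^esub>"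
| "root_vec n i (Suc 0) = U_class n (gen i)"
| "root_vec n i (Suc (Suc d)) =
     (root_vec n i (Suc d) \<otimes>\<^bsub>U_q_plus n\<^esub> root_vec n (i + Suc d) (Suc 0))
     \<ominus>\<^bsub>U_q_plus n\<^esub>
     (qpow (- 1) \<odot>\<^bsub>U_q_plus n\<^esub> (root_vec n (i + Suc d) (Suc 0) \<otimes>\<^bsub>U_q_plus n\<^esub> root_vec n i (Suc d)))"

definition monomial :: "nat \<Rightarrow> (nat \<times> nat) list \<Rightarrow> (nat list \<Rightarrow>\<^sub>0 'a::field_char_0 klaurent fract) set" where
  "monomial n ys = foldr (\<lambda>(i, j) m. root_vec n i (j - i) \<otimes>\<^bsub>U_q_plus n\<^esub> m) ys \<one>\<^bsub>U_q_plus n\<^esub>"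

definition nondecreasing :: "nat \<Rightarrow> (nat \<times> nat) list set" where
  "nondecreasing n = {ys. set ys \<subseteq> units n \<and> sorted_wrt (\<lambda>x y. unit_less x y \<or> x = y) ys}"

definition free_module_basis ::
    "('k::comm_ring_1, 'm) module \<Rightarrow> 'i set \<Rightarrow> ('i \<Rightarrow> 'm) \<Rightarrow> bool" where
  "free_module_basis M I v \<longleftrightarrow> v ` I \<subseteq> carrier M \<and>
     (\<forall>x \<in> carrier M. \<exists>!c :: 'i \<Rightarrow>\<^sub>0 'k. Poly_Mapping.keys c \<subseteq> I \<and>
        x = (\<Oplus>\<^bsub>M\<^esub>i \<in> Poly_Mapping.keys c. Poly_Mapping.lookup c i \<odot>\<^bsub>M\<^esub> v i))"

end

theory Submission
  imports Defs
begin

text \<open>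
  The T-Lie axioms are linear, so they reduce to identities between matrix units, where the only
  point is that the weights are additive along nonzero brackets.

  For the basis theorem, the Serre relations imply the commutation relations
  $e_{ij} e_{jv} - q^{-1} e_{jv} e_{ij} = e_{iv}$, $e_{ij} e_{iv} = q e_{iv} e_{ij}$,
  $e_{ij} e_{uj} = q e_{uj} e_{ij}$ and $[e_{ij}, e_{uv}] = (q - q^{-1}) e_{iv} e_{uj}$ for
  $i < u < j < v$, while all other pairs commute. They straighten every product of root vectors with
  coefficients in $k$, by induction on the total degree $\sum i (j - i)$ and the number of inversions.
  For independence, the Feigin homomorphism $E_i \mapsto \sum_{j > i} Y_{ij}$ maps to a quantum torus,
  represented on the span of the monomials in the $Y_{ij}$. If $Y_{ij}$ has height $j$, the image of
  $e_{ij}$ has the single lowest term $Y_{ij} Y_{i+1,j} \cdots Y_{j-1,j}$ up to a nonzero scalar, so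
  different ordered monomials have different lowest terms.
\<close>

section \<open>Linear maps between free modules\<close>

text \<open>The module to be described is a k-form inside an algebra over K(q), and the two halves
  use different scalars. Spanning has to stay over k, so every relation used for straightening must
  have coefficients in k. The one place where a division seems unavoidable is the commutation of
  E_{i+1} with e_{i,i+3}: it emerges multiplied by q + q^-1, which is not a unit of k but can be
  cancelled because it is invertible in K(q). Independence is proved over K(q) and restricted to k,
  which embeds. Straightening alone cannot exclude that the Serre relations collapse the algebra, so
  a concrete module is required on which ordered monomials act independently. Commutative monomials
  suffice as its basis: a generator of the torus multiplies such a monomial up to a power of q, so
  lowest terms multiply like commutative monomials. The lowest term of e_{ij} occupies the rows i to
  j - 1, always with second index j; comparing the exponents of neighbouring rows therefore recovers
  the multiplicity of each root vector, and with it the ordered monomial.\<close>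

lemma module_hom_scaleI:
  assumes "\<And>x y. f (x + y) = f x + f y" "\<And>c x. f (scale c x) = scale c (f x)"
  shows "module_hom scale scale f"
  using assms by unfold_locales auto

lemma module_hom_compose:
  "module_hom scale scale f \<Longrightarrow> module_hom scale scale g \<Longrightarrow> module_hom scale scale (\<lambda>x. f (g x))"
  using module_hom_compose[of scale scale g scale f] by (simp add: o_def)

lemma module_hom_plus:
  assumes "module_hom scale scale f" "module_hom scale scale g"
  shows "module_hom scale scale (\<lambda>x. f x + g x)"
proof -
  interpret f: module_hom scale scale f by fact
  interpret g: module_hom scale scale g by fact
  show ?thesis
    by (rule module_hom_scaleI) (simp_all add: f.add g.add f.scale g.scale vec.scale_right_distrib)
qed

lemma module_hom_minus:
  assumes "module_hom scale scale f" "module_hom scale scale g"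
  shows "module_hom scale scale (\<lambda>x. f x - g x)"
proof -
  interpret f: module_hom scale scale f by fact
  interpret g: module_hom scale scale g by fact
  show ?thesis
    by (rule module_hom_scaleI) (simp_all add: f.add g.add f.scale g.scale vec.scale_right_diff_distrib)
qed

lemma module_hom_id: "module_hom scale scale (\<lambda>x. x)"
  by (rule module_hom_scaleI) auto

lemma module_hom_zero: "module_hom scale scale (\<lambda>_. 0)"
  by (rule module_hom_scaleI) auto

lemma module_hom_span_image:
  assumes f: "module_hom scale scale f" and S: "\<And>b. b \<in> S \<Longrightarrow> f b \<in> vec.span T" and x: "x \<in> vec.span S"
  shows "f x \<in> vec.span T"
proof -
  interpret f: module_hom scale scale f by fact
  from x show ?thesis
    by (induction rule: vec.span_induct_alt)
       (auto simp: f.add f.scale f.zero intro: vec.span_zero vec.span_add vec.span_scale S)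
qed

lemma module_hom_eq_span:
  assumes f: "module_hom scale scale f" and g: "module_hom scale scale g"
    and S: "\<And>b. b \<in> S \<Longrightarrow> f b = g b" and x: "x \<in> vec.span S"
  shows "f x = g x"
proof -
  interpret f: module_hom scale scale f by fact
  interpret g: module_hom scale scale g by fact
  from x show ?thesis
    by (induction rule: vec.span_induct_alt)
       (auto simp: f.add f.scale f.zero g.add g.scale g.zero S)
qed

lemma poly_mapping_sum_bas:
  "(\<Sum>b\<in>Poly_Mapping.keys p. scale (Poly_Mapping.lookup p b) (bas b)) = p"
proof (rule poly_mapping_eqI)
  fix k
  have "Poly_Mapping.lookup (\<Sum>b\<in>Poly_Mapping.keys p. scale (Poly_Mapping.lookup p b) (bas b)) k
      = (\<Sum>b\<in>Poly_Mapping.keys p. if b = k then Poly_Mapping.lookup p k else 0)"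
    unfolding lookup_sum by (rule sum.cong) (auto simp: lookup_scale lookup_single when_def)
  then show "Poly_Mapping.lookup (\<Sum>b\<in>Poly_Mapping.keys p. scale (Poly_Mapping.lookup p b) (bas b)) k
      = Poly_Mapping.lookup p k"
    by (simp add: in_keys_iff)
qed

lemma free_mod_eq_span: "free_mod B = vec.span (bas ` B)"
proof (intro equalityI subsetI)
  fix p assume "p \<in> free_mod B"
  then have "(\<Sum>b\<in>Poly_Mapping.keys p. scale (Poly_Mapping.lookup p b) (bas b)) \<in> vec.span (bas ` B)"
    by (intro vec.span_sum vec.span_scale vec.span_base) (auto simp: free_mod_def)
  then show "p \<in> vec.span (bas ` B)"
    by (simp add: poly_mapping_sum_bas)
next
  have "vec.subspace (free_mod B :: ('a \<Rightarrow>\<^sub>0 'b) set)"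
    unfolding vec.subspace_def free_mod_def
  proof (intro conjI ballI allI; clarsimp)
    fix x y :: "'a \<Rightarrow>\<^sub>0 'b" and b
    assume "Poly_Mapping.keys x \<subseteq> B" "Poly_Mapping.keys y \<subseteq> B" "b \<in> Poly_Mapping.keys (x + y)"
    then show "b \<in> B" using Poly_Mapping.keys_add[of x y] by blast
  next
    fix c and x :: "'a \<Rightarrow>\<^sub>0 'b" and b
    assume "Poly_Mapping.keys x \<subseteq> B" "b \<in> Poly_Mapping.keys (scale c x)"
    then show "b \<in> B" by (metis in_keys_iff lookup_scale mult_zero_right subsetD)
  qed
  moreover have "bas ` B \<subseteq> (free_mod B :: ('a \<Rightarrow>\<^sub>0 'b) set)"
    by (auto simp: free_mod_def)
  moreover fix p :: "'a \<Rightarrow>\<^sub>0 'b" assume "p \<in> vec.span (bas ` B)"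
  ultimately show "p \<in> free_mod B"
    using vec.span_minimal by blast
qed

text \<open>Additivity of \<open>lin_ext\<close> compares sums over different supports; a common
  finite superset makes them comparable.\<close>

lemma lin_ext_superset:
  assumes "finite S" "Poly_Mapping.keys p \<subseteq> S"
  shows "lin_ext B f p = (\<Sum>b\<in>S \<inter> B. scale (Poly_Mapping.lookup p b) (f b))"
  unfolding lin_ext_def using assms
  by (intro sum.mono_neutral_left) (auto simp: in_keys_iff)

lemma module_hom_lin_ext [intro, simp]:
  fixes f :: "'b \<Rightarrow> ('c \<Rightarrow>\<^sub>0 'k::comm_ring_1)"
  shows "module_hom scale scale (lin_ext B f)"
proof (rule module_hom_scaleI)
  fix p r :: "'b \<Rightarrow>\<^sub>0 'k"
  let ?S = "Poly_Mapping.keys p \<union> Poly_Mapping.keys r"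
  have "lin_ext B f (p + r) = (\<Sum>b\<in>?S \<inter> B. scale (Poly_Mapping.lookup (p + r) b) (f b))"
    using Poly_Mapping.keys_add[of p r] by (intro lin_ext_superset) auto
  also have "\<dots> = (\<Sum>b\<in>?S \<inter> B. scale (Poly_Mapping.lookup p b) (f b))
      + (\<Sum>b\<in>?S \<inter> B. scale (Poly_Mapping.lookup r b) (f b))"
    by (simp add: lookup_add vec.scale_left_distrib sum.distrib)
  also have "\<dots> = lin_ext B f p + lin_ext B f r"
    by (simp add: lin_ext_superset[of ?S])
  finally show "lin_ext B f (p + r) = lin_ext B f p + lin_ext B f r" .
next
  fix c p
  have "lin_ext B f (scale c p) = (\<Sum>b\<in>Poly_Mapping.keys p \<inter> B. scale (Poly_Mapping.lookup (scale c p) b) (f b))"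
    by (intro lin_ext_superset) (auto simp: in_keys_iff lookup_scale)
  also have "\<dots> = scale c (lin_ext B f p)"
    by (simp add: lin_ext_def lookup_scale vec.scale_sum_right)
  finally show "lin_ext B f (scale c p) = scale c (lin_ext B f p)" .
qed

lemmas lin_ext_add = module_hom.add[OF module_hom_lin_ext]
  and lin_ext_scale = module_hom.scale[OF module_hom_lin_ext]
  and lin_ext_zero = module_hom.zero[OF module_hom_lin_ext]
  and lin_ext_diff = module_hom.diff[OF module_hom_lin_ext]

lemma lin_ext_bas: "lin_ext B f (bas b) = (if b \<in> B then f b else 0)"
  by (simp add: lin_ext_def)

lemma lin_ext_cong: "(\<And>b. b \<in> B \<Longrightarrow> f b = g b) \<Longrightarrow> lin_ext B f = lin_ext B g"
  by (simp add: lin_ext_def fun_eq_iff)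

lemma lookup_lin_ext_bas:
  "Poly_Mapping.lookup (lin_ext B bas p) b = (if b \<in> B then Poly_Mapping.lookup p b else 0)"
proof -
  have "Poly_Mapping.lookup (lin_ext B bas p) b
      = (\<Sum>b'\<in>Poly_Mapping.keys p \<inter> B. if b' = b then Poly_Mapping.lookup p b else 0)"
    unfolding lin_ext_def lookup_sum
    by (rule sum.cong) (auto simp: lookup_scale lookup_single when_def)
  then show ?thesis
    by (simp add: in_keys_iff)
qed

lemma lookup_tens:
  "Poly_Mapping.lookup (tens p r) (x, y) = Poly_Mapping.lookup p x * Poly_Mapping.lookup r y"
proof -
  have "Poly_Mapping.lookup (tens p r) (x, y) =
      (\<Sum>x'\<in>Poly_Mapping.keys p. \<Sum>y'\<in>Poly_Mapping.keys r.
        if y' = y then (if x' = x then Poly_Mapping.lookup p x * Poly_Mapping.lookup r y else 0) else 0)"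
    unfolding tens_def lookup_sum
    by (intro sum.cong refl) (auto simp: lookup_single when_def)
  also have "\<dots> = Poly_Mapping.lookup p x * Poly_Mapping.lookup r y"
    by (cases "Poly_Mapping.lookup r y = 0"; cases "Poly_Mapping.lookup p x = 0") (simp_all add: in_keys_iff)
  finally show ?thesis .
qed

lemma tens_add_left: "tens (p + p') r = tens p r + tens p' r"
  by (rule poly_mapping_eqI) (auto simp: lookup_tens lookup_add algebra_simps)

lemma tens_add_right: "tens p (r + r') = tens p r + tens p r'"
  by (rule poly_mapping_eqI) (auto simp: lookup_tens lookup_add algebra_simps)

lemma tens_scale_left: "tens (scale c p) r = scale c (tens p r)"
  by (rule poly_mapping_eqI) (auto simp: lookup_tens lookup_scale algebra_simps)

lemma tens_scale_right: "tens p (scale c r) = scale c (tens p r)"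
  by (rule poly_mapping_eqI) (auto simp: lookup_tens lookup_scale algebra_simps)

lemma tens_zero [simp]: "tens 0 r = 0" "tens p 0 = 0"
  by (simp_all add: tens_def)

lemma tens_bas: "tens (bas x) (bas y) = bas (x, y)"
  by (rule poly_mapping_eqI) (auto simp: lookup_tens lookup_single when_def split: if_splits)

text \<open>Bilinearity reduces the two grading axioms, which speak of arbitrary homogeneous
  elements, to pairs of matrix units.\<close>

lemma tens_span_image:
  assumes f: "module_hom scale scale f"
    and S: "\<And>a b. a \<in> S \<Longrightarrow> b \<in> S' \<Longrightarrow> f (tens a b) \<in> vec.span T"
    and x: "x \<in> vec.span S" and y: "y \<in> vec.span S'"
  shows "f (tens x y) \<in> vec.span T"
proof (rule module_hom_span_image[OF _ _ x])
  show "module_hom scale scale (\<lambda>x. f (tens x y))"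
    by (intro module_hom_compose[OF f] module_hom_scaleI tens_add_left tens_scale_left)
  fix a assume a: "a \<in> S"
  show "f (tens a y) \<in> vec.span T"
  proof (rule module_hom_span_image[OF _ _ y])
    show "module_hom scale scale (\<lambda>y. f (tens a y))"
      by (intro module_hom_compose[OF f] module_hom_scaleI tens_add_right tens_scale_right)
  qed (rule S[OF a])
qed

lemma map_single: "\<phi> 0 = 0 \<Longrightarrow> Poly_Mapping.map \<phi> (Poly_Mapping.single k v) = Poly_Mapping.single k (\<phi> v)"
  by (rule poly_mapping_eqI) (auto simp: Poly_Mapping.map.rep_eq lookup_single when_def)

lemma direct_decomposition_free_mod:
  assumes "\<And>b. b \<in> B \<Longrightarrow> g b \<ge> (1::nat)"
  shows "direct_decomposition (free_mod B) (\<lambda>\<eta>. free_mod {b \<in> B. g b = \<eta>})"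
  unfolding direct_decomposition_def
proof (intro conjI ballI allI impI)
  fix \<eta> show "vec.subspace (free_mod {b \<in> B. g b = \<eta>})"
    unfolding free_mod_eq_span by (rule vec.subspace_span)
  show "free_mod {b \<in> B. g b = \<eta>} \<subseteq> free_mod B"
    by (auto simp: free_mod_def)
next
  fix x :: "'a \<Rightarrow>\<^sub>0 'b" assume x: "x \<in> free_mod B"
  define h where "h \<eta> = lin_ext {b. b \<in> B \<and> g b = \<eta>} bas x" for \<eta>
  have lh: "Poly_Mapping.lookup (h \<eta>) b = (if b \<in> B \<and> g b = \<eta> then Poly_Mapping.lookup x b else 0)" for \<eta> b
    by (simp add: h_def lookup_lin_ext_bas)
  have fin: "{\<eta>. h \<eta> \<noteq> 0} \<subseteq> g ` Poly_Mapping.keys x"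
    by (auto simp: poly_mapping_eq_iff fun_eq_iff lh in_keys_iff split: if_splits)
  show "\<exists>!f. (\<forall>\<eta>\<ge>1. f \<eta> \<in> free_mod {b \<in> B. g b = \<eta>}) \<and> f 0 = 0 \<and> finite {\<eta>. f \<eta> \<noteq> 0} \<and>
        x = (\<Sum>\<eta> | f \<eta> \<noteq> 0. f \<eta>)"
  proof (intro ex1I[of _ h] conjI allI impI)
    show "h \<eta> \<in> free_mod {b \<in> B. g b = \<eta>}" for \<eta>
      by (auto simp: free_mod_def in_keys_iff lh split: if_splits)
    \<comment> \<open>The index 0 lies outside the grading, and no basis element has degree
      0.\<close>
    show "h 0 = 0"
    proof (rule poly_mapping_eqI)
      fix b show "Poly_Mapping.lookup (h 0) b = Poly_Mapping.lookup 0 b"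
        using assms[of b] by (auto simp: lh)
    qed
    show finh: "finite {\<eta>. h \<eta> \<noteq> 0}"
      by (rule finite_subset[OF fin]) simp
    show "x = (\<Sum>\<eta> | h \<eta> \<noteq> 0. h \<eta>)"
    proof (rule poly_mapping_eqI)
      fix b
      have "(\<Sum>\<eta> | h \<eta> \<noteq> 0. Poly_Mapping.lookup (h \<eta>) b) = (\<Sum>\<eta>\<in>{\<eta>. h \<eta> \<noteq> 0} \<inter> {g b}. Poly_Mapping.lookup (h \<eta>) b)"
        using finh by (intro sum.mono_neutral_right) (auto simp: lh)
      also have "\<dots> = Poly_Mapping.lookup (h (g b)) b"
        by (cases "h (g b) = 0") auto
      also have "\<dots> = Poly_Mapping.lookup x b"
        using x by (auto simp: lh free_mod_def in_keys_iff)
      finally show "Poly_Mapping.lookup x b = Poly_Mapping.lookup (\<Sum>\<eta> | h \<eta> \<noteq> 0. h \<eta>) b"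
        by (simp add: lookup_sum)
    qed
  next
    fix f assume f: "(\<forall>\<eta>\<ge>1. f \<eta> \<in> free_mod {b \<in> B. g b = \<eta>}) \<and> f 0 = 0 \<and> finite {\<eta>. f \<eta> \<noteq> 0} \<and>
        x = (\<Sum>\<eta> | f \<eta> \<noteq> 0. f \<eta>)"
    have z: "Poly_Mapping.lookup (f \<eta>) b = 0" if "\<not> (b \<in> B \<and> g b = \<eta>)" for \<eta> b
      using f that by (cases "\<eta> = 0") (auto simp: free_mod_def in_keys_iff subset_iff Suc_le_eq)
    have "Poly_Mapping.lookup x b = Poly_Mapping.lookup (f (g b)) b" for b
    proof -
      have "Poly_Mapping.lookup x b = (\<Sum>\<eta> | f \<eta> \<noteq> 0. Poly_Mapping.lookup (f \<eta>) b)"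
        using f by (metis lookup_sum)
      also have "\<dots> = (\<Sum>\<eta>\<in>{\<eta>. f \<eta> \<noteq> 0} \<inter> {g b}. Poly_Mapping.lookup (f \<eta>) b)"
        using f by (intro sum.mono_neutral_right ballI z) auto
      also have "\<dots> = Poly_Mapping.lookup (f (g b)) b"
        by (cases "f (g b) = 0") auto
      finally show ?thesis .
    qed
    then show "f = h"
      by (auto simp: fun_eq_iff z lh intro!: poly_mapping_eqI)
  qed
qed

section \<open>The T-Lie algebra $(sl_{n+1}^+)_q$\<close>

lemma lin_ext_zero_fun: "lin_ext B (\<lambda>_. 0) = (\<lambda>_. 0)"
  by (simp add: lin_ext_def fun_eq_iff)

lemma mat_mult_bas:
  "mat_mult (bas (a, b)) (bas (u, v)) = (if b = u then bas (a, v) else 0)"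
  by (simp add: mat_mult_def)

lemma commutator_bas:
  "commutator (bas (a, b)) (bas (u, v)) = (if b = u then bas (a, v) else 0) - (if v = a then bas (u, b) else 0)"
  by (simp add: commutator_def mat_mult_bas)

definition ind :: "bool \<Rightarrow> int" where "ind P = (if P then 1 else 0)"

text \<open>The inner product of the roots \<epsilon>_a - \<epsilon>_b and \<epsilon>_u -
  \<epsilon>_v of type A; hence it is additive when a root is written as a sum of two roots.\<close>

definition weight :: "nat \<times> nat \<Rightarrow> nat \<times> nat \<Rightarrow> int" where
  "weight x y = ind (fst x = fst y) - ind (fst x = snd y) - ind (snd x = fst y) + ind (snd x = snd y)"

text \<open>\<open>unit_weight\<close> is a definite description over the integers, so besides the
  eigenvalue its uniqueness is required; the coefficient at (u, v) gives it.\<close>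

lemma unit_weight_eq:
  assumes "a \<noteq> b" "u \<noteq> v"
  shows "unit_weight (a, b) (u, v) = weight (a, b) (u, v)"
proof -
  let ?H = "bas (a, a) - bas (b, b) :: nat \<times> nat \<Rightarrow>\<^sub>0 int"
  have keys: "Poly_Mapping.keys ?H = {(a, a), (b, b)}"
    using assms by (auto simp: in_keys_iff lookup_minus lookup_single when_def split: if_splits)
  have "commutator ?H (bas (u, v)) = scale (weight (a, b) (u, v)) (bas (u, v))"
    unfolding commutator_def mat_mult_def keys using assms
    by (auto intro!: poly_mapping_eqI
        simp: weight_def ind_def lookup_minus lookup_add lookup_scale lookup_single when_def)
  moreover have "c = d" if "scale c (bas (u, v)) = scale d (bas (u, v) :: nat \<times> nat \<Rightarrow>\<^sub>0 int)" for c d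
    using arg_cong[OF that, of "\<lambda>p. Poly_Mapping.lookup p (u, v)"] by (simp add: lookup_scale)
  ultimately show ?thesis
    unfolding unit_weight_def by (auto intro!: the_equality)
qed

lemma unit_less_irrefl: "\<not> unit_less x x"
  by (cases x) (simp add: unit_less_def)

lemma unit_less_trans: "unit_less x y \<Longrightarrow> unit_less y z \<Longrightarrow> unit_less x z"
  by (cases x; cases y; cases z) (auto simp: unit_less_def)

lemma unit_less_linear: "unit_less x y \<or> x = y \<or> unit_less y x"
  by (cases x; cases y) (auto simp: unit_less_def)

lemma unit_less_asym: "unit_less x y \<Longrightarrow> \<not> unit_less y x"
  using unit_less_trans unit_less_irrefl by blast

text \<open>The difference of the two degree sums is (b - a)(c - b), hence at least 1; this is the
  -1 in the strict grading.\<close>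

lemma degree_brack_less:
  fixes a b c :: nat
  assumes "a < b" "b < c"
  shows "a * (c - a) + 1 \<le> a * (b - a) + b * (c - b)"
proof -
  obtain d e where "b = a + Suc d" "c = b + Suc e"
    using assms by (metis less_iff_Suc_add add_Suc_right)
  then show ?thesis by (simp add: algebra_simps)
qed

text \<open>Here the degrees differ by (u - i)(v - j).\<close>

lemma degree_pseudo_less:
  fixes i u j v :: nat
  assumes "i < u" "u < j" "j < v"
  shows "i * (v - i) + u * (j - u) + 1 \<le> i * (j - i) + u * (v - u)"
proof -
  obtain d e f where "u = i + Suc d" "j = u + Suc e" "v = j + Suc f"
    using assms by (metis less_iff_Suc_add add_Suc_right)
  then show ?thesis by (simp add: algebra_simps)
qed

text \<open>
  \<open>qp c\<close> plays the role of $q^c$. The instance \<open>qp = qpow\<close> gives $(sl_{n+1}^+)_q$ and the constant \<open>1\<close>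
  gives $sl_{n+1}^+$, so the axioms of a T-Lie algebra are checked only once.
\<close>

locale exponential =
  fixes qp :: "int \<Rightarrow> 'k::comm_ring_1"
  assumes qp_0: "qp 0 = 1" and qp_add: "qp (a + b) = qp a * qp b"
begin

definition presym_coeff :: "nat \<times> nat \<Rightarrow> nat \<times> nat \<Rightarrow> 'k" where
  "presym_coeff x y = (if unit_less x y then qp (weight x y) else if x = y then 1 else qp (- weight y x))"

definition pseudo_unit :: "nat \<times> nat \<Rightarrow> nat \<times> nat \<Rightarrow> ((nat \<times> nat) \<times> (nat \<times> nat) \<Rightarrow>\<^sub>0 'k)" where
  "pseudo_unit = (\<lambda>(i, j) (u, v).
     if i < u \<and> u < j \<and> j < v then scale (qp 1 - qp (- 1)) (bas ((i, v), (u, j)))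
     else if u < i \<and> i < v \<and> v < j then scale (qp (- 1) - qp 1) (bas ((u, j), (i, v)))
     else 0)"

text \<open>
  No case distinction on the order is needed: $e_{uv} < e_{ij}$ have a nonzero commutator only for
  $v = i$, and then the weight is $-1$, whence the coefficient $-q$ of $[e_{ij}, e_{uv}]_q$.
\<close>

definition brack_unit :: "nat \<times> nat \<Rightarrow> nat \<times> nat \<Rightarrow> (nat \<times> nat \<Rightarrow>\<^sub>0 'k)" where
  "brack_unit = (\<lambda>(i, j) (u, v).
     if j = u then bas (i, v) else if v = i then scale (- qp 1) (bas (u, j)) else 0)"

definition sl_plus_exp :: "nat \<Rightarrow> (nat \<times> nat, 'k) t_lie" where
  "sl_plus_exp n =
    (let BB = units n \<times> units n;
         presym = lin_ext BB (\<lambda>(x, y). scale (presym_coeff x y) (bas (y, x)));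
         pseudo = lin_ext BB (\<lambda>(x, y). pseudo_unit x y) in
     \<lparr>Basis = units n, Less = {(x, y). unit_less x y},
      Presym = presym, Sym = (\<lambda>p. presym p + pseudo p), Pseudo = pseudo,
      Brack = lin_ext BB (\<lambda>(x, y). brack_unit x y), Grade = unit_grade n\<rparr>)"

lemma qp_minus: "qp a * qp (- a) = 1" "qp (- a) * qp a = 1"
  by (simp_all add: qp_0 flip: qp_add)

lemma presym_coeff_inverse: "presym_coeff x y * presym_coeff y x = 1"
  using unit_less_linear[of x y] unit_less_asym[of x y]
  by (auto simp: presym_coeff_def qp_minus unit_less_irrefl)

lemma unit_grade_eq: "unit_grade n \<eta> = free_mod {b \<in> units n. fst b * (snd b - fst b) = \<eta>}"
  unfolding unit_grade_def free_mod_eq_span by (rule arg_cong[where f = vec.span]) (auto, blast)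

context
  fixes n :: nat
begin

abbreviation (input) "L \<equiv> sl_plus_exp n"

lemma sl_plus_exp_simps:
  "Basis L = units n" "Less L = {(x, y). unit_less x y}"
  "Sym L = (\<lambda>p. Presym L p + Pseudo L p)" "Grade L = unit_grade n"
  by (simp_all add: sl_plus_exp_def Let_def)

lemma sl_plus_exp_hom:
  "module_hom scale scale (Presym L)" "module_hom scale scale (Pseudo L)" "module_hom scale scale (Brack L)"
  "module_hom scale scale (Sym L)"
  by (simp_all add: sl_plus_exp_def Let_def module_hom_plus)

lemma sl_plus_exp_bas:
  assumes "x \<in> units n" "y \<in> units n"
  shows "Presym L (bas (x, y)) = scale (presym_coeff x y) (bas (y, x))"
    "Pseudo L (bas (x, y)) = pseudo_unit x y"
    "Brack L (bas (x, y)) = brack_unit x y"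
  using assms by (simp_all add: sl_plus_exp_def Let_def lin_ext_bas)

lemma tens_hom:
  "module_hom scale scale (tens_Id f)" "module_hom scale scale (Id_tens f)"
  by (simp_all add: tens_Id_def Id_tens_def)

lemma tens_Id_bas:
  "tens_Id f (bas (x, y, z)) = tens (f (bas (x, y))) (bas z)"
  "Id_tens f (bas (x, y, z)) = tens (bas x) (f (bas (y, z)))"
  by (simp_all add: tens_Id_def Id_tens_def lin_ext_bas)

lemma S_hom: "module_hom scale scale (S12 L)" "module_hom scale scale (S23 L)"
  unfolding S12_def[abs_def] S23_def[abs_def] tens_assoc_def
  by (rule module_hom_compose[OF module_hom_lin_ext tens_hom(1)] tens_hom(2))+

lemma S_bas:
  assumes "x \<in> units n" "y \<in> units n" "z \<in> units n"
  shows "S12 L (bas (x, y, z)) = scale (presym_coeff x y) (bas (y, x, z))"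
    "S23 L (bas (x, y, z)) = scale (presym_coeff y z) (bas (x, z, y))"
  using assms
  by (simp_all add: S12_def S23_def tens_assoc_def tens_Id_bas sl_plus_exp_bas tens_scale_left tens_scale_right
      lin_ext_scale lin_ext_bas tens_bas)

text \<open>If e_ab and e_bc compose, then a + b < b + c, so composition always goes upwards in the
  order; for x < y the reversed composition is impossible.\<close>

lemma brack_unit_less:
  assumes "x \<in> units n" "y \<in> units n" "unit_less x y"
  shows "brack_unit x y = (if snd x = fst y then bas (fst x, snd y) else 0)"
  using assms by (auto simp: brack_unit_def units_def unit_less_def split: prod.splits)

lemma brack_unit_greater:
  assumes "x \<in> units n" "y \<in> units n" "unit_less y x"
  shows "brack_unit x y = (if snd y = fst x then scale (- qp 1) (bas (fst y, snd x)) else 0)"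
  using assms by (auto simp: brack_unit_def units_def unit_less_def split: prod.splits)

lemma bas_in_span: "b \<in> B \<Longrightarrow> bas b \<in> vec.span (bas ` B)"
  by (intro vec.span_base imageI)

lemma brack_unit_in_free_mod:
  assumes "x \<in> units n" "y \<in> units n"
  shows "brack_unit x y \<in> vec.span (bas ` units n)"
  using assms by (auto simp: brack_unit_def units_def vec.span_zero intro!: vec.span_neg vec.span_scale bas_in_span)

lemma pseudo_unit_in_free_mod:
  assumes "x \<in> units n" "y \<in> units n"
  shows "pseudo_unit x y \<in> vec.span (bas ` (units n \<times> units n))"
  using assms by (auto simp: pseudo_unit_def units_def vec.span_zero intro!: vec.span_neg vec.span_scale bas_in_span)

lemma weight_add_right:
  "a < b \<Longrightarrow> b < c \<Longrightarrow> weight x (a, c) = weight x (a, b) + weight x (b, c)"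
  by (auto simp: weight_def)

lemma weight_add_left:
  "a < b \<Longrightarrow> b < c \<Longrightarrow> weight (a, c) x = weight (a, b) x + weight (b, c) x"
  by (auto simp: weight_def ind_def)

lemma tensor_square_span: "tensor_square L = vec.span (bas ` (units n \<times> units n))"
  by (simp add: tensor_square_def sl_plus_exp_simps free_mod_eq_span)

text \<open>The order is convex along brackets: the index sum a + c of e_ac = [e_ab, e_bc] lies
  strictly between a + b and b + c. Hence x < y < z gives x < [y, z], both sides stay in the first
  branch of \<open>presym_coeff\<close>, and additivity of \<open>weight\<close> matches the
  exponents. The left version uses [x, y] < z.\<close>

lemma presym_brack_right:
  assumes w: "w \<in> increasing_cube L"
  shows "Presym L (Id_tens (Brack L) w) = tens_Id (Brack L) (S23 L (S12 L w))"
proof (rule module_hom_eq_span[OF _ _ _ w[unfolded increasing_cube_def]])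
  show "module_hom scale scale (\<lambda>w. Presym L (Id_tens (Brack L) w))"
    "module_hom scale scale (\<lambda>w. tens_Id (Brack L) (S23 L (S12 L w)))"
    by (rule module_hom_compose[OF sl_plus_exp_hom(1) tens_hom(2)]
        module_hom_compose[OF tens_hom(1) module_hom_compose[OF S_hom(2) S_hom(1)]])+
next
  fix b :: "(nat \<times> nat) \<times> (nat \<times> nat) \<times> nat \<times> nat \<Rightarrow>\<^sub>0 'k"
  assume "b \<in> {bas (x, y, z) |x y z. x \<in> Basis L \<and> y \<in> Basis L \<and> z \<in> Basis L \<and> (x, y) \<in> Less L \<and> (y, z) \<in> Less L}"
  then obtain x y z where b: "b = bas (x, y, z)" and u: "x \<in> units n" "y \<in> units n" "z \<in> units n"
    and l: "unit_less x y" "unit_less y z"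
    by (auto simp: sl_plus_exp_simps)
  note l' = unit_less_trans[OF l]
  have "snd y = fst z \<Longrightarrow> unit_less x (fst y, snd z) \<and> (fst y, snd z) \<in> units n \<and>
      weight x (fst y, snd z) = weight x y + weight x z"
    using u l weight_add_right[of "fst y" "snd y" "snd z" x] by (cases x; cases y; cases z) (auto simp: units_def unit_less_def)
  then show "Presym L (Id_tens (Brack L) b) = tens_Id (Brack L) (S23 L (S12 L b))"
    using u l l'
    by (auto simp: b tens_Id_bas sl_plus_exp_bas S_bas brack_unit_less tens_bas presym_coeff_def qp_add mult.commute
        module_hom.scale[OF S_hom(2)] module_hom.scale[OF tens_hom(1)] module_hom.zero[OF sl_plus_exp_hom(1)])
qed

lemma presym_brack_left:
  assumes w: "w \<in> increasing_cube L"
  shows "Presym L (tens_Id (Brack L) w) = Id_tens (Brack L) (S12 L (S23 L w))"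
proof (rule module_hom_eq_span[OF _ _ _ w[unfolded increasing_cube_def]])
  show "module_hom scale scale (\<lambda>w. Presym L (tens_Id (Brack L) w))"
    "module_hom scale scale (\<lambda>w. Id_tens (Brack L) (S12 L (S23 L w)))"
    by (rule module_hom_compose[OF sl_plus_exp_hom(1) tens_hom(1)]
        module_hom_compose[OF tens_hom(2) module_hom_compose[OF S_hom(1) S_hom(2)]])+
next
  fix b :: "(nat \<times> nat) \<times> (nat \<times> nat) \<times> nat \<times> nat \<Rightarrow>\<^sub>0 'k"
  assume "b \<in> {bas (x, y, z) |x y z. x \<in> Basis L \<and> y \<in> Basis L \<and> z \<in> Basis L \<and> (x, y) \<in> Less L \<and> (y, z) \<in> Less L}"
  then obtain x y z where b: "b = bas (x, y, z)" and u: "x \<in> units n" "y \<in> units n" "z \<in> units n"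
    and l: "unit_less x y" "unit_less y z"
    by (auto simp: sl_plus_exp_simps)
  note l' = unit_less_trans[OF l]
  have "snd x = fst y \<Longrightarrow> unit_less (fst x, snd y) z \<and> (fst x, snd y) \<in> units n \<and>
      weight (fst x, snd y) z = weight x z + weight y z"
    using u l weight_add_left[of "fst x" "snd x" "snd y" z] by (cases x; cases y; cases z) (auto simp: units_def unit_less_def)
  then show "Presym L (tens_Id (Brack L) b) = Id_tens (Brack L) (S12 L (S23 L b))"
    using u l l'
    by (auto simp: b tens_Id_bas sl_plus_exp_bas S_bas brack_unit_less tens_bas presym_coeff_def qp_add mult.commute
        module_hom.scale[OF S_hom(1)] module_hom.scale[OF tens_hom(2)] module_hom.zero[OF sl_plus_exp_hom(1)])
qed

text \<open>Composable units have weight -1. The resulting power of q cancels the factor -q to -1,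
  or supplies the missing q, depending on which of x and y is smaller.\<close>

lemma brack_unit_swap:
  assumes "x \<in> units n" "y \<in> units n"
  shows "scale (presym_coeff x y) (brack_unit y x) = - brack_unit x y"
proof -
  obtain i j u v where [simp]: "x = (i, j)" "y = (u, v)" by (cases x; cases y)
  have lt: "i < j" "u < v" using assms by (auto simp: units_def)
  consider "j = u" | "v = i" | "j \<noteq> u" "v \<noteq> i" by blast
  then show ?thesis
  proof cases
    case 1
    then have "unit_less x y" "weight x y = - 1" using lt by (auto simp: unit_less_def weight_def ind_def)
    with 1 lt qp_minus(2)[of 1] show ?thesis by (simp add: brack_unit_def presym_coeff_def)
  next
    case 2
    then have "unit_less y x" "weight y x = - 1" using lt by (auto simp: unit_less_def weight_def ind_def)
    with 2 lt qp_minus(2)[of 1] unit_less_asym[of y x] show ?thesis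
      by (auto simp: brack_unit_def presym_coeff_def)
  next
    case 3
    then show ?thesis by (simp add: brack_unit_def)
  qed
qed

text \<open>Crossing units belong to orthogonal roots, of weight 0, so the presymmetry merely flips
  them and the opposite signs in \<open>pseudo_unit\<close> do the rest.\<close>

lemma pseudo_unit_swap:
  assumes "x \<in> units n" "y \<in> units n"
  shows "scale (presym_coeff x y) (pseudo_unit y x) = - pseudo_unit x y"
proof -
  obtain i j u v where [simp]: "x = (i, j)" "y = (u, v)" by (cases x; cases y)
  have lt: "i < j" "u < v" using assms by (auto simp: units_def)
  consider "i < u \<and> u < j \<and> j < v" | "u < i \<and> i < v \<and> v < j" | "pseudo_unit y x = 0" "pseudo_unit x y = 0"
    by (cases "i < u \<and> u < j \<and> j < v"; cases "u < i \<and> i < v \<and> v < j") (simp_all add: pseudo_unit_def)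
  then show ?thesis
  proof cases
    case 1
    then have "unit_less x y" "weight x y = 0" using lt by (auto simp: unit_less_def weight_def ind_def)
    with 1 lt show ?thesis
      by (auto simp: pseudo_unit_def presym_coeff_def qp_0 simp flip: vec.scale_minus_left)
  next
    case 2
    then have "unit_less y x" "weight y x = 0" using lt by (auto simp: unit_less_def weight_def ind_def)
    with 2 lt unit_less_asym[of y x] show ?thesis
      by (auto simp: pseudo_unit_def presym_coeff_def qp_0 simp flip: vec.scale_minus_left)
  qed simp
qed

text \<open>The nested units e_iv and e_uj of the pseudobracket do not compose in either
  order.\<close>

lemma brack_pseudo_unit:
  assumes "x \<in> units n" "y \<in> units n"
  shows "Brack L (pseudo_unit x y) = 0"
  using assms
  by (auto simp: pseudo_unit_def units_def module_hom.scale[OF sl_plus_exp_hom(3)]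
      module_hom.zero[OF sl_plus_exp_hom(3)] sl_plus_exp_bas brack_unit_def split: prod.splits)

text \<open>For x > y > z the order leaves no room for the third double bracket, and the first two
  differ from zero only on a chain of composable units z, y, x, where they agree by
  associativity.\<close>

lemma brack_jacobi:
  assumes w: "w \<in> decreasing_cube L"
  shows "Brack L (Id_tens (Brack L) (S12 L (S23 L w)) - tens_Id (Brack L) (S23 L (S12 L w))
        + Id_tens (Brack L) (S23 L (S12 L w))) = 0"
proof (rule module_hom_eq_span[OF _ module_hom_zero _ w[unfolded decreasing_cube_def]])
  show "module_hom scale scale (\<lambda>w. Brack L (Id_tens (Brack L) (S12 L (S23 L w)) - tens_Id (Brack L) (S23 L (S12 L w))
        + Id_tens (Brack L) (S23 L (S12 L w))))"
    by (intro module_hom_compose[OF sl_plus_exp_hom(3)] module_hom_minus module_hom_plus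
          module_hom_compose[OF tens_hom(1) module_hom_compose[OF S_hom(2) S_hom(1)]]
          module_hom_compose[OF tens_hom(2) module_hom_compose[OF S_hom(2) S_hom(1)]]
          module_hom_compose[OF tens_hom(2) module_hom_compose[OF S_hom(1) S_hom(2)]])
next
  fix b :: "(nat \<times> nat) \<times> (nat \<times> nat) \<times> nat \<times> nat \<Rightarrow>\<^sub>0 'k"
  assume "b \<in> {bas (x, y, z) |x y z. x \<in> Basis L \<and> y \<in> Basis L \<and> z \<in> Basis L \<and> (y, x) \<in> Less L \<and> (z, y) \<in> Less L}"
  then obtain x y z where b: "b = bas (x, y, z)" and u: "x \<in> units n" "y \<in> units n" "z \<in> units n"
    and l: "unit_less y x" "unit_less z y"
    by (auto simp: sl_plus_exp_simps)
  note l' = unit_less_trans[OF l(2) l(1)]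
  note S = module_hom.scale[OF S_hom(1)] module_hom.scale[OF S_hom(2)]
    module_hom.scale[OF tens_hom(1)] module_hom.scale[OF tens_hom(2)] module_hom.scale[OF sl_plus_exp_hom(3)]
    module_hom.zero[OF sl_plus_exp_hom(3)]
  have 1: "Brack L (Id_tens (Brack L) (S12 L (S23 L b))) =
      scale (presym_coeff y z * presym_coeff x z) (Brack L (tens (bas z) (brack_unit x y)))"
    "Brack L (tens_Id (Brack L) (S23 L (S12 L b))) =
      scale (presym_coeff x y * presym_coeff x z) (Brack L (tens (brack_unit y z) (bas x)))"
    "Brack L (Id_tens (Brack L) (S23 L (S12 L b))) =
      scale (presym_coeff x y * presym_coeff x z) (Brack L (tens (bas y) (brack_unit z x)))"
    using u by (simp_all add: b S tens_Id_bas S_bas sl_plus_exp_bas)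
  obtain a1 a2 where x: "x = (a1, a2)" by (cases x)
  obtain b1 b2 where y: "y = (b1, b2)" by (cases y)
  obtain c1 c2 where z: "z = (c1, c2)" by (cases z)
  have lt: "a1 < a2" "b1 < b2" "c1 < c2" using u by (auto simp: units_def x y z)
  \<comment> \<open>A nonzero value requires that z composes with x, and that y precedes z or
    follows x in a composition; then y < z or x < y, against the order.\<close>
  have 3: "Brack L (tens (bas y) (brack_unit z x)) = 0"
  proof (cases "c2 = a1")
    case True
    have "(c1, a2) \<in> units n" "b2 \<noteq> c1" "b1 \<noteq> a2" using u l lt True by (auto simp: units_def x y z unit_less_def)
    then have "Brack L (bas ((b1, b2), (c1, a2))) = 0"
      using u lt by (simp add: sl_plus_exp_bas(3) y brack_unit_def)
    then show ?thesis using True unfolding brack_unit_less[OF u(3,1) l'] by (simp add: x y z tens_bas)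
  next
    case False
    then show ?thesis unfolding brack_unit_less[OF u(3,1) l'] by (simp add: x z S)
  qed
  \<comment> \<open>Outside a chain c2 = b1, b2 = a1 both double brackets vanish. On a chain both
    inner brackets carry the factor -q, and the presymmetry contributes q for the pair (y, z) as
    well as for (x, y).\<close>
  have 2: "scale (presym_coeff y z * presym_coeff x z) (Brack L (tens (bas z) (brack_unit x y)))
    = scale (presym_coeff x y * presym_coeff x z) (Brack L (tens (brack_unit y z) (bas x)))"
  proof (cases "c2 = b1 \<and> b2 = a1")
    case True
    then have u': "(b1, a2) \<in> units n" "(c1, b2) \<in> units n" using u by (auto simp: units_def x y z)
    have less: "unit_less z (b1, a2)" "unit_less (c1, b2) x"
      using True lt by (auto simp: unit_less_def x z)
    have "Brack L (bas (z, (b1, a2))) = bas (c1, a2)" "Brack L (bas ((c1, b2), x)) = bas (c1, a2)"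
      using u u' less True by (simp_all add: sl_plus_exp_bas brack_unit_less x z)
    moreover have "presym_coeff y z = qp 1" "presym_coeff x y = qp 1"
      using True lt l unit_less_asym by (auto simp: presym_coeff_def x y z weight_def ind_def unit_less_def)
    ultimately show ?thesis
      using u l True by (simp add: brack_unit_greater x y z tens_scale_left tens_scale_right tens_bas S
           del: vec.scale_minus_left)
  next
    case False
    have "Brack L (tens (bas z) (brack_unit x y)) = 0"
    proof (cases "b2 = a1")
      case True
      then have "(b1, a2) \<in> units n" "c2 \<noteq> b1" "a2 \<noteq> c1" using u l False lt by (auto simp: units_def x y z unit_less_def)
      then have "Brack L (bas (z, (b1, a2))) = 0"
        using u lt by (simp add: sl_plus_exp_bas(3) z brack_unit_def)
      then show ?thesis using True u l by (simp add: brack_unit_greater x y z tens_scale_right tens_bas S del: vec.scale_minus_left)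
    qed (use u l in \<open>simp add: brack_unit_greater x y z S\<close>)
    moreover have "Brack L (tens (brack_unit y z) (bas x)) = 0"
    proof (cases "c2 = b1")
      case True
      then have "(c1, b2) \<in> units n" "b2 \<noteq> a1" "a2 \<noteq> c1" using u l False lt by (auto simp: units_def x y z unit_less_def)
      then have "Brack L (bas ((c1, b2), x)) = 0"
        using u lt by (simp add: sl_plus_exp_bas(3) x brack_unit_def)
      then show ?thesis using True u l by (simp add: brack_unit_greater x y z tens_scale_left tens_bas S del: vec.scale_minus_left)
    qed (use u l in \<open>simp add: brack_unit_greater x y z S\<close>)
    ultimately show ?thesis by simp
  qed
  show "Brack L (Id_tens (Brack L) (S12 L (S23 L b)) - tens_Id (Brack L) (S23 L (S12 L b))
        + Id_tens (Brack L) (S23 L (S12 L b))) = 0"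
    unfolding module_hom.add[OF sl_plus_exp_hom(3)] module_hom.diff[OF sl_plus_exp_hom(3)] 1 2 3 by simp
qed

lemma bas_in_unit_grade: "(i, j) \<in> units n \<Longrightarrow> bas (i, j) \<in> unit_grade n (i * (j - i))"
  unfolding unit_grade_def by (rule vec.span_base) blast

lemma graded_brack:
  assumes x: "x \<in> Grade L \<eta>1" and y: "y \<in> Grade L \<eta>2"
  shows "Brack L (tens x y) \<in> vec.span (\<Union>\<alpha>\<in>{1..\<eta>1 + \<eta>2 - 1}. Grade L \<alpha>)"
proof (rule tens_span_image[OF sl_plus_exp_hom(3) _ x[unfolded sl_plus_exp_simps unit_grade_def] y[unfolded sl_plus_exp_simps unit_grade_def]])
  fix p r :: "nat \<times> nat \<Rightarrow>\<^sub>0 'k"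
  assume "p \<in> {bas (i, j) |i j. (i, j) \<in> units n \<and> i * (j - i) = \<eta>1}"
    and "r \<in> {bas (i, j) |i j. (i, j) \<in> units n \<and> i * (j - i) = \<eta>2}"
  then obtain i j u v where pr: "p = bas (i, j)" "r = bas (u, v)" and u: "(i, j) \<in> units n" "(u, v) \<in> units n"
    and \<eta>: "\<eta>1 = i * (j - i)" "\<eta>2 = u * (v - u)"
    by blast
  \<comment> \<open>Only the sum \<eta>1 + \<eta>2 is mentioned, so that this serves both orders of
    composition.\<close>
  have *: "bas (a, c) \<in> vec.span (\<Union>\<alpha>\<in>{1..\<eta>1 + \<eta>2 - 1}. Grade L \<alpha>)"
    if "1 \<le> a" "a < b" "b < c" "c \<le> n + 1" "\<eta>1 + \<eta>2 = a * (b - a) + b * (c - b)" for a b c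
  proof (rule vec.span_base, rule UN_I)
    show "a * (c - a) \<in> {1..\<eta>1 + \<eta>2 - 1}" using degree_brack_less[of a b c] that by auto
    show "bas (a, c) \<in> Grade L (a * (c - a))"
      unfolding sl_plus_exp_simps using that by (intro bas_in_unit_grade) (auto simp: units_def)
  qed
  consider "j = u" | "j \<noteq> u" "v = i" | "j \<noteq> u" "v \<noteq> i" by blast
  then have "brack_unit (i, j) (u, v) \<in> vec.span (\<Union>\<alpha>\<in>{1..\<eta>1 + \<eta>2 - 1}. Grade L \<alpha>)"
  proof cases
    case 1
    then show ?thesis using *[of i j v] u by (simp add: brack_unit_def units_def \<eta>)
  next
    case 2
    then have "bas (u, j) \<in> vec.span (\<Union>\<alpha>\<in>{1..\<eta>1 + \<eta>2 - 1}. Grade L \<alpha>)"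
      using *[of u v j] u by (simp add: units_def \<eta>)
    from vec.span_scale[OF this, of "- qp 1"] show ?thesis using 2 by (simp add: brack_unit_def)
  next
    case 3
    then show ?thesis by (simp add: brack_unit_def vec.span_zero)
  qed
  then show "Brack L (tens p r) \<in> vec.span (\<Union>\<alpha>\<in>{1..\<eta>1 + \<eta>2 - 1}. Grade L \<alpha>)"
    using u by (simp add: pr tens_bas sl_plus_exp_bas)
qed

lemma graded_pseudo:
  assumes x: "x \<in> Grade L \<eta>1" and y: "y \<in> Grade L \<eta>2"
  shows "Pseudo L (tens x y) \<in> vec.span {tens u v |u v \<alpha> \<beta>. \<alpha> \<ge> 1 \<and> \<beta> \<ge> 1 \<and>
        \<alpha> + \<beta> \<le> \<eta>1 + \<eta>2 - 1 \<and> u \<in> Grade L \<alpha> \<and> v \<in> Grade L \<beta>}"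
    (is "_ \<in> vec.span ?T")
proof (rule tens_span_image[OF sl_plus_exp_hom(2) _ x[unfolded sl_plus_exp_simps unit_grade_def] y[unfolded sl_plus_exp_simps unit_grade_def]])
  fix p r :: "nat \<times> nat \<Rightarrow>\<^sub>0 'k"
  assume "p \<in> {bas (i, j) |i j. (i, j) \<in> units n \<and> i * (j - i) = \<eta>1}"
    and "r \<in> {bas (i, j) |i j. (i, j) \<in> units n \<and> i * (j - i) = \<eta>2}"
  then obtain i j u v where pr: "p = bas (i, j)" "r = bas (u, v)" and u: "(i, j) \<in> units n" "(u, v) \<in> units n"
    and \<eta>: "\<eta>1 = i * (j - i)" "\<eta>2 = u * (v - u)"
    by blast
  have *: "bas ((a, d), (b, c)) \<in> vec.span ?T"
    if "1 \<le> a" "a < b" "b < c" "c < d" "d \<le> n + 1" "\<eta>1 + \<eta>2 = a * (c - a) + b * (d - b)" for a b c d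
  proof -
    have "bas (a, d) \<in> Grade L (a * (d - a))" "bas (b, c) \<in> Grade L (b * (c - b))"
      unfolding sl_plus_exp_simps using that by (auto intro!: bas_in_unit_grade simp: units_def)
    moreover have "1 \<le> a * (d - a)" "1 \<le> b * (c - b)" using that by auto
    moreover have "a * (d - a) + b * (c - b) \<le> \<eta>1 + \<eta>2 - 1"
      using degree_pseudo_less[of a b c d] that by linarith
    ultimately have "tens (bas (a, d)) (bas (b, c)) \<in> ?T" by blast
    then show ?thesis unfolding tens_bas by (rule vec.span_base)
  qed
  have "pseudo_unit (i, j) (u, v) \<in> vec.span ?T"
    using u *[of i u j v] *[of u i v j] unfolding pseudo_unit_def
    by (auto simp: units_def \<eta> add.commute vec.span_zero intro: vec.span_scale)
  then show "Pseudo L (tens p r) \<in> vec.span ?T"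
    using u by (simp add: pr tens_bas sl_plus_exp_bas)
qed

theorem t_lie_algebra_sl_plus_exp: "t_lie_algebra L"
proof (rule t_lie_algebra.intro)
  show "strict_linear_order_on (Basis L) (Less L)"
    unfolding strict_linear_order_on_def trans_def irrefl_def total_on_def sl_plus_exp_simps
    using unit_less_trans unit_less_irrefl unit_less_linear by blast
  show "module_hom scale scale (Presym L)" "module_hom scale scale (Sym L)"
      "module_hom scale scale (Pseudo L)" "module_hom scale scale (Brack L)"
    by (rule sl_plus_exp_hom)+
  show presym: "Presym L ` tensor_square L \<subseteq> tensor_square L"
    unfolding tensor_square_span
    by (rule image_subsetI, rule module_hom_span_image[OF sl_plus_exp_hom(1)])
       (auto simp: sl_plus_exp_bas intro!: vec.span_scale bas_in_span)
  show pseudo: "Pseudo L ` tensor_square L \<subseteq> tensor_square L"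
    unfolding tensor_square_span
    by (rule image_subsetI, rule module_hom_span_image[OF sl_plus_exp_hom(2)])
       (auto simp: sl_plus_exp_bas pseudo_unit_in_free_mod)
  show "Sym L ` tensor_square L \<subseteq> tensor_square L"
    using presym pseudo unfolding tensor_square_span sl_plus_exp_simps by (auto intro!: vec.span_add)
  show "Brack L ` tensor_square L \<subseteq> free_mod (Basis L)"
    unfolding tensor_square_span sl_plus_exp_simps free_mod_eq_span
    by (rule image_subsetI, rule module_hom_span_image[OF sl_plus_exp_hom(3)])
       (auto simp: sl_plus_exp_bas brack_unit_in_free_mod)
  show "\<exists>c. Presym L (bas (a, b)) = scale c (bas (b, a))" if "a \<in> Basis L" "b \<in> Basis L" for a b
    using that by (auto simp: sl_plus_exp_simps sl_plus_exp_bas)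
  show "direct_decomposition (free_mod (Basis L)) (Grade L)"
    unfolding sl_plus_exp_simps unit_grade_eq[abs_def]
    by (rule direct_decomposition_free_mod) (auto simp: units_def)
  note S = module_hom.scale[OF sl_plus_exp_hom(1)] module_hom.scale[OF sl_plus_exp_hom(2)] module_hom.scale[OF sl_plus_exp_hom(3)]
  fix p assume "p \<in> tensor_square L"
  then have p: "p \<in> vec.span (bas ` (units n \<times> units n))" by (simp add: tensor_square_span)
  show "Presym L (Presym L p) = p"
    by (rule module_hom_eq_span[OF _ _ _ p, of "\<lambda>p. Presym L (Presym L p)" "\<lambda>p. p"])
       (auto intro: module_hom_compose[OF sl_plus_exp_hom(1) sl_plus_exp_hom(1)] module_hom_id simp: sl_plus_exp_bas S presym_coeff_inverse)
  show "Sym L p = Presym L p + Pseudo L p"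
    by (simp add: sl_plus_exp_simps)
  have bp: "Brack L (Pseudo L p) = 0"
    by (rule module_hom_eq_span[OF _ _ _ p, of "\<lambda>p. Brack L (Pseudo L p)" "\<lambda>p. 0"])
       (auto intro: module_hom_compose[OF sl_plus_exp_hom(3) sl_plus_exp_hom(2)] module_hom_zero simp: sl_plus_exp_bas brack_pseudo_unit)
  then show "Brack L (Pseudo L p) = 0" .
  have "Brack L (Presym L p) = 0 - Brack L p"
    by (rule module_hom_eq_span[OF _ _ _ p, of "\<lambda>p. Brack L (Presym L p)" "\<lambda>p. 0 - Brack L p"])
       (auto intro: module_hom_compose[OF sl_plus_exp_hom(3) sl_plus_exp_hom(1)] sl_plus_exp_hom module_hom_minus[OF module_hom_zero, simplified]
         simp: S sl_plus_exp_bas brack_unit_swap)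
  with bp show "Brack L (Sym L p) = - Brack L p"
    by (simp add: sl_plus_exp_simps module_hom.add[OF sl_plus_exp_hom(3)])
  have "Pseudo L (Presym L p) = 0 - Pseudo L p"
    by (rule module_hom_eq_span[OF _ _ _ p, of "\<lambda>p. Pseudo L (Presym L p)" "\<lambda>p. 0 - Pseudo L p"])
       (auto intro: module_hom_compose[OF sl_plus_exp_hom(2) sl_plus_exp_hom(1)] sl_plus_exp_hom module_hom_minus[OF module_hom_zero, simplified]
         simp: S sl_plus_exp_bas pseudo_unit_swap)
  then show "Pseudo L (Presym L p) = - Pseudo L p" by simp
qed (intro presym_brack_left presym_brack_right brack_jacobi graded_brack graded_pseudo; assumption)+

end

end

section \<open>The two instances and the specialization at t = 0\<close>

lemma fps_exp_powi: "fps_exp 1 powi c = fps_exp (of_int c :: 'a::field_char_0)"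
  by (simp add: power_int_def fps_exp_power_mult flip: fps_exp_neg)

lemma exponential_qpow: "exponential (qpow :: int \<Rightarrow> 'a::field_char_0 klaurent)"
proof
  show "qpow 0 = (1 :: 'a klaurent)" by transfer simp
  show "qpow (a + b) = (qpow a * qpow b :: 'a klaurent)" for a b
    by transfer (simp add: fps_exp_powi fps_exp_add_mult)
qed

lemma exponential_one: "exponential (\<lambda>_. 1)"
  by unfold_locales simp_all

lemma eval_t0_simps [simp]:
  "eval_t0 0 = 0" "eval_t0 1 = 1" "eval_t0 (a + b) = eval_t0 a + eval_t0 b"
  "eval_t0 (a * b) = eval_t0 a * eval_t0 b" "eval_t0 (- a) = - eval_t0 a" "eval_t0 (a - b) = eval_t0 a - eval_t0 b"
  by (transfer; simp)+

lemma eval_t0_qpow [simp]: "eval_t0 (qpow c) = 1"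
  by transfer (simp add: fps_exp_powi)

lemma units_lt: "(i, j) \<in> units n \<Longrightarrow> i < j"
  by (simp add: units_def)

lemma weight_units: "x \<in> units n \<Longrightarrow> y \<in> units n \<Longrightarrow> unit_weight x y = weight x y"
  using unit_weight_eq[of "fst x" "snd x" "fst y" "snd y"] units_lt[of "fst x" "snd x" n] units_lt[of "fst y" "snd y" n]
  by auto

lemma sl_plus_q_eq: "(sl_plus_q n :: (nat \<times> nat, 'a::field_char_0 klaurent) t_lie) = exponential.sl_plus_exp qpow n"
proof -
  interpret exponential "qpow :: int \<Rightarrow> 'a klaurent" by (rule exponential_qpow)
  have 1: "slq_presym n = lin_ext (units n \<times> units n) (\<lambda>(x, y). scale (presym_coeff x y) (bas (y, x)) :: _ \<Rightarrow>\<^sub>0 'a klaurent)"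
    unfolding slq_presym_def by (rule lin_ext_cong) (auto simp: presym_coeff_def weight_units)
  have 2: "slq_pseudo n = lin_ext (units n \<times> units n) (\<lambda>(x, y). pseudo_unit x y :: _ \<Rightarrow>\<^sub>0 'a klaurent)"
    unfolding slq_pseudo_def by (rule lin_ext_cong) (auto simp: pseudo_unit_def)
  have 3: "slq_brack n = lin_ext (units n \<times> units n) (\<lambda>(x, y). brack_unit x y :: _ \<Rightarrow>\<^sub>0 'a klaurent)"
    unfolding slq_brack_def
  proof (rule lin_ext_cong, clarify)
    fix i j u v assume m: "(i, j) \<in> units n" "(u, v) \<in> units n"
    then have lt: "i < j" "u < v" by (auto simp: units_def)
    have w: "weight (u, v) (i, j) = - 1" if "v = i" using that lt by (simp add: weight_def ind_def)
    consider "unit_less (i, j) (u, v)" | "(i, j) = (u, v)" | "unit_less (u, v) (i, j)" using unit_less_linear by blast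
    then show "(if unit_less (i, j) (u, v) then commutator (bas (i, j)) (bas (u, v))
          else if (i, j) = (u, v) then 0
          else scale (- qpow (- unit_weight (u, v) (i, j))) (commutator (bas (u, v)) (bas (i, j)))) =
         (brack_unit (i, j) (u, v) :: _ \<Rightarrow>\<^sub>0 'a klaurent)"
    proof cases
      case 1
      then have "v \<noteq> i" using lt by (auto simp: unit_less_def)
      with 1 show ?thesis by (simp add: commutator_bas brack_unit_def)
    next
      case 2
      with lt show ?thesis by (auto simp: unit_less_irrefl brack_unit_def)
    next
      case 3
      then have "j \<noteq> u" "(i, j) \<noteq> (u, v)" using lt by (auto simp: unit_less_def)
      with 3 m show ?thesis using unit_less_asym[OF 3] w
        by (auto simp: weight_units commutator_bas brack_unit_def)
    qed
  qed
  show ?thesis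
    by (simp add: sl_plus_q_def sl_plus_exp_def Let_def 1 2 3)
qed

text \<open>At q = 1 the coefficients of the presymmetry become 1, the factor q - q^-1 of the
  pseudobracket vanishes, and -q becomes the sign of the commutator.\<close>

lemma sl_plus_eq: "(sl_plus n :: (nat \<times> nat, 'k::comm_ring_1) t_lie) = exponential.sl_plus_exp (\<lambda>_. 1) n"
proof -
  interpret exponential "\<lambda>_. 1 :: 'k" by (rule exponential_one)
  have 1: "(\<lambda>(x, y). bas (y, x)) = (\<lambda>(x, y). scale (presym_coeff x y) (bas (y, x)) :: _ \<Rightarrow>\<^sub>0 'k)"
  proof -
    have "presym_coeff x y = 1" for x y by (simp add: presym_coeff_def)
    then show ?thesis by simp
  qed
  have 2: "(\<lambda>(x, y). pseudo_unit x y) = (\<lambda>_. 0)"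
    by (auto simp: pseudo_unit_def fun_eq_iff)
  have 3: "lin_ext (units n \<times> units n) (\<lambda>(x, y). commutator (bas x) (bas y)) = lin_ext (units n \<times> units n) (\<lambda>(x, y). brack_unit x y)"
    by (rule lin_ext_cong) (auto simp: units_def commutator_bas brack_unit_def)
  show ?thesis
    by (simp add: sl_plus_def sl_plus_exp_def 1 2 3 lin_ext_zero_fun Let_def)
qed

lemma map_zero: "Poly_Mapping.map \<phi> 0 = 0"
  by (rule poly_mapping_eqI) (simp add: Poly_Mapping.map.rep_eq)

lemma map_add: "(\<And>a b. \<phi> (a + b) = \<phi> a + \<phi> b) \<Longrightarrow> \<phi> 0 = 0 \<Longrightarrow>
    Poly_Mapping.map \<phi> (p + r) = Poly_Mapping.map \<phi> p + Poly_Mapping.map \<phi> r"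
  by (rule poly_mapping_eqI) (simp add: Poly_Mapping.map.rep_eq lookup_add when_def in_keys_iff, metis)

lemma map_scale: "(\<And>a b. \<phi> (a * b) = \<phi> a * \<phi> b) \<Longrightarrow> \<phi> 0 = 0 \<Longrightarrow>
    Poly_Mapping.map \<phi> (scale c p) = scale (\<phi> c) (Poly_Mapping.map \<phi> p)"
  by (rule poly_mapping_eqI) (simp add: Poly_Mapping.map.rep_eq lookup_scale when_def in_keys_iff, metis)

lemma span_map_unit_grade:
  "vec.span (Poly_Mapping.map eval_t0 ` (unit_grade n \<eta> :: (_ \<Rightarrow>\<^sub>0 'a::field_char_0 klaurent) set)) = unit_grade n \<eta>"
proof
  show "vec.span (Poly_Mapping.map eval_t0 ` (unit_grade n \<eta> :: (_ \<Rightarrow>\<^sub>0 'a klaurent) set)) \<subseteq> unit_grade n \<eta>"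
  proof (rule vec.span_minimal)
    show "vec.subspace (unit_grade n \<eta> :: (_ \<Rightarrow>\<^sub>0 'a) set)" unfolding unit_grade_def by (rule vec.subspace_span)
    show "Poly_Mapping.map eval_t0 ` (unit_grade n \<eta> :: (_ \<Rightarrow>\<^sub>0 'a klaurent) set) \<subseteq> unit_grade n \<eta>"
      unfolding exponential.unit_grade_eq[OF exponential_one] exponential.unit_grade_eq[OF exponential_qpow] free_mod_def
      by (auto simp: in_keys_iff Poly_Mapping.map.rep_eq when_def subset_iff split: if_splits)
  qed
  have "{bas (i, j) |i j. (i, j) \<in> units n \<and> i * (j - i) = \<eta>} \<subseteq> Poly_Mapping.map eval_t0 ` (unit_grade n \<eta> :: (_ \<Rightarrow>\<^sub>0 'a klaurent) set)"
  proof clarify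
    fix i j assume "(i, j) \<in> units n" "\<eta> = i * (j - i)"
    then have "bas (i, j) \<in> (unit_grade n \<eta> :: (_ \<Rightarrow>\<^sub>0 'a klaurent) set)"
      using exponential.bas_in_unit_grade[OF exponential_qpow] by blast
    moreover have "bas (i, j) = Poly_Mapping.map eval_t0 (bas (i, j) :: _ \<Rightarrow>\<^sub>0 'a klaurent)"
      by (simp add: map_single)
    ultimately show "bas (i, j) \<in> Poly_Mapping.map eval_t0 ` (unit_grade n (i * (j - i)) :: (_ \<Rightarrow>\<^sub>0 'a klaurent) set)"
      using \<open>\<eta> = _\<close> by blast
  qed
  then show "unit_grade n \<eta> \<subseteq> vec.span (Poly_Mapping.map eval_t0 ` (unit_grade n \<eta> :: (_ \<Rightarrow>\<^sub>0 'a klaurent) set))"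
    by (subst unit_grade_def) (rule vec.span_mono)
qed

theorem base_change_sl_plus_q:
  "base_change eval_t0 (sl_plus_q n :: (nat \<times> nat, 'a::field_char_0 klaurent) t_lie) = sl_plus n"
proof -
  interpret q: exponential "qpow :: int \<Rightarrow> 'a klaurent" by (rule exponential_qpow)
  interpret one: exponential "\<lambda>_. 1 :: 'a" by (rule exponential_one)
  let ?BB = "units n \<times> units n"
  have presym: "eval_t0 (q.presym_coeff x y) = one.presym_coeff x y" for x y
    by (simp add: q.presym_coeff_def one.presym_coeff_def)
  have pseudo: "Poly_Mapping.map eval_t0 (q.pseudo_unit x y) = one.pseudo_unit x y" for x y
    by (simp add: q.pseudo_unit_def one.pseudo_unit_def map_scale map_single map_zero split: prod.split)
  have brack: "Poly_Mapping.map eval_t0 (q.brack_unit x y) = one.brack_unit x y" for x y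
    by (simp add: q.brack_unit_def one.brack_unit_def map_scale map_single map_zero del: vec.scale_minus_left split: prod.split)
  have 1: "lin_ext ?BB (\<lambda>b. Poly_Mapping.map eval_t0 (Presym (q.sl_plus_exp n) (bas b))) = Presym (one.sl_plus_exp n)"
    by (subst one.sl_plus_exp_def, simp add: Let_def, rule lin_ext_cong)
       (auto simp: q.sl_plus_exp_bas map_scale map_single presym)
  have 2: "lin_ext ?BB (\<lambda>b. Poly_Mapping.map eval_t0 (Pseudo (q.sl_plus_exp n) (bas b))) = Pseudo (one.sl_plus_exp n)"
    by (subst one.sl_plus_exp_def, simp add: Let_def, rule lin_ext_cong)
       (auto simp: q.sl_plus_exp_bas pseudo)
  have 3: "lin_ext ?BB (\<lambda>b. Poly_Mapping.map eval_t0 (Brack (q.sl_plus_exp n) (bas b))) = Brack (one.sl_plus_exp n)"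
    by (subst one.sl_plus_exp_def, simp add: Let_def, rule lin_ext_cong)
       (auto simp: q.sl_plus_exp_bas brack)
  \<comment> \<open>\<open>Sym\<close> is a pointwise sum and not a \<open>lin_ext\<close>, so it is
    split into the two maps already treated.\<close>
  have 4: "lin_ext ?BB (\<lambda>b. Poly_Mapping.map eval_t0 (Sym (q.sl_plus_exp n) (bas b))) = Sym (one.sl_plus_exp n)"
  proof -
    have "lin_ext ?BB (\<lambda>b. Poly_Mapping.map eval_t0 (Sym (q.sl_plus_exp n) (bas b)))
      = (\<lambda>p. lin_ext ?BB (\<lambda>b. Poly_Mapping.map eval_t0 (Presym (q.sl_plus_exp n) (bas b))) p +
          lin_ext ?BB (\<lambda>b. Poly_Mapping.map eval_t0 (Pseudo (q.sl_plus_exp n) (bas b))) p)"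
      by (simp add: q.sl_plus_exp_simps map_add lin_ext_def fun_eq_iff vec.scale_right_distrib sum.distrib)
    then show ?thesis by (simp add: 1 2 one.sl_plus_exp_simps)
  qed
  have "base_change eval_t0 (q.sl_plus_exp n) = one.sl_plus_exp n"
    unfolding base_change_def Let_def q.sl_plus_exp_simps(1) 1 2 3 4
    by (rule t_lie.equality) (simp_all add: q.sl_plus_exp_simps one.sl_plus_exp_simps span_map_unit_grade)
  then show ?thesis by (simp add: sl_plus_q_eq sl_plus_eq)
qed

theorem t_lie_deformation_sl_plus_q:
  "t_lie_deformation eval_t0 (sl_plus_q n :: (nat \<times> nat, 'a::field_char_0 klaurent) t_lie) (sl_plus n)"
  unfolding t_lie_deformation_def
  using base_change_sl_plus_q exponential.t_lie_algebra_sl_plus_exp[OF exponential_qpow]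
    exponential.t_lie_algebra_sl_plus_exp[OF exponential_one]
  by (auto simp: sl_plus_q_eq sl_plus_eq)

section \<open>Commutation relations of root vectors\<close>

text \<open>
  Regularity of $q + q^{-1}$ is what makes $E_{i+1}$ commute with $e_{i,i+3}$.
\<close>

locale serre_algebra = Modules.module s
  for s :: "'k::comm_ring_1 \<Rightarrow> 'r::{ring, monoid_mult} \<Rightarrow> 'r" +
  fixes q qi :: 'k and E :: "nat \<Rightarrow> 'r"
  assumes q_qi: "q * qi = 1"
    and scale_mult_left: "s c x * y = s c (x * y)"
    and scale_mult_right: "x * s c y = s c (x * y)"
    and cancel_q_plus_qi: "s (q + qi) x = 0 \<Longrightarrow> x = 0"
    and serre_far: "i + 1 < j \<Longrightarrow> E i * E j = E j * E i"
    and serre_near: "j = i + 1 \<or> i = j + 1 \<Longrightarrow>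
      E i * E i * E j - s (q + qi) (E i * E j * E i) + E j * E i * E i = 0"
begin

lemma qi_q: "qi * q = 1"
  using q_qi by (simp add: mult.commute)

lemma q_cancel: "q * (qi * x) = x" "qi * (q * x) = x"
  using q_qi qi_q by (simp_all flip: mult.assoc)

lemmas scalar_simps = scale_mult_left scale_mult_right scale_right_distrib scale_right_diff_distrib
  left_diff_distrib right_diff_distrib distrib_left distrib_right mult.assoc q_qi qi_q q_cancel

definition qcomm :: "'k \<Rightarrow> 'r \<Rightarrow> 'r \<Rightarrow> bool" where
  "qcomm c x y \<longleftrightarrow> x * y = s c (y * x)"

definition qbr :: "'r \<Rightarrow> 'r \<Rightarrow> 'r" where
  "qbr x y = x * y - s qi (y * x)"

lemma qcomm_mult_assoc: "qcomm c x y \<Longrightarrow> x * (y * z) = s c (y * (x * z))"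
  unfolding qcomm_def by (metis mult.assoc scale_mult_left)

lemma qcomm_1_sym: "qcomm 1 x y \<Longrightarrow> qcomm 1 y x"
  by (simp add: qcomm_def)

text \<open>Passing x through either monomial, a b or b a, of the q-commutator costs the same factor
  c d.\<close>

lemma qcomm_qbr_right:
  assumes "qcomm c x a" "qcomm d x b"
  shows "qcomm (c * d) x (qbr a b)"
  unfolding qcomm_def qbr_def
  by (simp add: scalar_simps qcomm_mult_assoc[OF assms(1)] qcomm_mult_assoc[OF assms(2)]
      assms[unfolded qcomm_def] mult.left_commute mult.commute)

lemma qcomm_qbr_left:
  assumes "qcomm c a x" "qcomm d b x"
  shows "qcomm (c * d) (qbr a b) x"
  unfolding qcomm_def qbr_def
  by (simp add: scalar_simps qcomm_mult_assoc[OF assms(1)] qcomm_mult_assoc[OF assms(2)]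
      assms[unfolded qcomm_def] mult.left_commute mult.commute)

text \<open>Both sides expand to the same four monomials once c is moved past a.\<close>

lemma qbr_assoc:
  assumes "qcomm 1 a c"
  shows "qbr (qbr a b) c = qbr a (qbr b c)"
  using qcomm_mult_assoc[OF assms] qcomm_mult_assoc[OF qcomm_1_sym[OF assms]] assms
  by (simp add: qbr_def scalar_simps qcomm_def)

text \<open>Substituting a b = q b a in the monomials a b d and d b a regroups the commutator into
  q-commutators of a and d. If b commutes with \<open>qbr a d\<close>, the right side collapses to a
  multiple by q - q^-1.\<close>

lemma qbr_cross_left:
  assumes "qcomm q a b"
  shows "a * qbr b d - qbr b d * a = s q (b * qbr a d) - s qi (qbr a d * b)"
  using qcomm_mult_assoc[OF assms] assms
  by (simp add: qbr_def scalar_simps qcomm_def)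

lemma qbr_cross_right:
  assumes "qcomm q b f"
  shows "qbr p b * f - f * qbr p b = s q (qbr p f * b) - s qi (b * qbr p f)"
  using qcomm_mult_assoc[OF assms] assms
  by (simp add: qbr_def scalar_simps qcomm_def)

fun rvec :: "nat \<Rightarrow> nat \<Rightarrow> 'r" where
  "rvec i 0 = 0"
| "rvec i (Suc 0) = E i"
| "rvec i (Suc (Suc d)) = qbr (rvec i (Suc d)) (E (i + Suc d))"

definition e :: "nat \<Rightarrow> nat \<Rightarrow> 'r" where "e i j = rvec i (j - i)"

lemma e_Suc: "e i (Suc i) = E i"
  by (simp add: e_def)

lemma e_step: "i < j \<Longrightarrow> e i (Suc j) = qbr (e i j) (E j)"
  by (auto simp: e_def Suc_diff_le dest!: less_imp_Suc_add)

lemma E_far: "i + 1 < j \<or> j + 1 < i \<Longrightarrow> qcomm 1 (E i) (E j)"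
  using serre_far[of i j] serre_far[of j i] by (auto simp: qcomm_def)

lemma E_e_far:
  assumes "i < j" "j < k \<or> k + 1 < i"
  shows "qcomm 1 (E k) (e i j)"
  using assms(1,2)
proof (induction j)
  case (Suc j)
  show ?case
  proof (cases "i = j")
    case True
    then show ?thesis using Suc.prems by (auto simp: e_Suc intro!: E_far)
  next
    case False
    then have ij: "i < j" using Suc.prems by simp
    have "qcomm 1 (E k) (e i j)" using Suc.prems ij by (intro Suc.IH) auto
    moreover have "qcomm 1 (E k) (E j)" using Suc.prems ij by (intro E_far) auto
    ultimately show ?thesis using qcomm_qbr_right[of 1 "E k" "e i j" 1 "E j"] by (simp add: e_step[OF ij])
  qed
qed simp

text \<open>The q-commutator is associative for commuting outer factors, so a root vector can be cut
  at every intermediate index and not only before its last letter. All later relations exploit this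
  freedom.\<close>

lemma qbr_e:
  assumes "i < j" "j < v"
  shows "qbr (e i j) (e j v) = e i v"
  using assms(2)
proof (induction v)
  case (Suc v)
  show ?case
  proof (cases "j = v")
    case True
    then show ?thesis using e_step[OF assms(1)] by (simp add: e_Suc)
  next
    case False
    then have jv: "j < v" using Suc.prems by simp
    have "qcomm 1 (e i j) (E v)" using assms(1) jv by (intro qcomm_1_sym[OF E_e_far]) auto
    then show ?thesis using Suc.IH[OF jv] jv assms(1) by (simp add: e_step qbr_assoc[symmetric])
  qed
qed simp

lemma qcomm_1_e:
  assumes "u < v" "\<And>m. u \<le> m \<Longrightarrow> m < v \<Longrightarrow> qcomm 1 x (E m)"
  shows "qcomm 1 x (e u v)"
  using assms
proof (induction v)
  case (Suc v)
  show ?case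
  proof (cases "u = v")
    case False
    then have "u < v" using Suc.prems by simp
    then show ?thesis using Suc qcomm_qbr_right[of 1 x "e u v" 1 "E v"] by (simp add: e_step)
  qed (use Suc.prems in \<open>simp add: e_Suc\<close>)
qed simp

lemma e_far:
  assumes "i < j" "j < u" "u < v"
  shows "qcomm 1 (e i j) (e u v)"
  using assms by (intro qcomm_1_e qcomm_1_sym[OF E_e_far]) auto

text \<open>Expanded, this is the cubic Serre relation itself; the relation with the two letters
  exchanged gives \<open>e_E_base\<close>.\<close>

lemma E_e_base: "qcomm q (E i) (e i (i + 2))"
  using serre_near[of "i + 1" i]
  by (simp add: e_step e_Suc qcomm_def qbr_def scalar_simps scale_left_distrib) (simp add: algebra_simps)

lemma e_E_base: "qcomm q (e i (i + 2)) (E (i + 1))"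
  using serre_near[of i "i + 1"]
  by (simp add: e_step e_Suc qcomm_def qbr_def scalar_simps scale_left_distrib) (simp add: algebra_simps)

text \<open>Cutting off e_{i+2,v}, with which E_i commutes, leaves the factor q of the base
  case.\<close>

lemma E_e_start:
  assumes "i + 1 < v"
  shows "qcomm q (E i) (e i v)"
proof (cases "v = i + 2")
  case False
  then have "i + 2 < v" using assms by simp
  then show ?thesis
    using qcomm_qbr_right[OF E_e_base E_e_far[of "i + 2" v i]] by (simp add: qbr_e)
qed (simp add: E_e_base[simplified])

lemma e_E_end:
  assumes "u + 1 < v"
  shows "qcomm q (e u v) (E (v - 1))"
proof (cases "v = u + 2")
  case True
  then show ?thesis using e_E_base[of u] by simp
next
  case False
  define w where "w = v - 2"
  then have w: "u < w" "v = w + 2" using assms False by auto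
  show ?thesis
    using qcomm_qbr_left[OF qcomm_1_sym[OF E_e_far[of u w "w + 1"]] e_E_base[of w]] w by (simp add: qbr_e)
qed

text \<open>
  Expanding $[e_{i,i+2}, e_{i+1,i+3}]$ through the left and through the right factor gives two
  expressions whose difference is $(q + q^{-1}) [E_{i+1}, e_{i,i+3}]$.
\<close>

lemma E_e_middle_base: "qcomm 1 (E (i + 1)) (e i (i + 3))"
proof -
  let ?a = "e i (i + 2)" and ?b = "E (i + 1)" and ?d = "E (i + 2)" and ?c = "e i (i + 3)" and ?f = "e (i + 1) (i + 3)"
  have 1: "qbr ?a ?d = ?c" "qbr ?b ?d = ?f" "qbr (E i) ?b = ?a" "qbr (E i) ?f = ?c"
    using qbr_e[of i "i + 2" "i + 3"] qbr_e[of "i + 1" "i + 2" "i + 3"] qbr_e[of i "i + 1" "i + 2"] qbr_e[of i "i + 1" "i + 3"]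
      e_Suc[of i] e_Suc[of "i + 1"] e_Suc[of "i + 2"] by (simp_all add: eval_nat_numeral)
  have "s q (?b * ?c) - s qi (?c * ?b) = s q (?c * ?b) - s qi (?b * ?c)"
    using qbr_cross_left[OF e_E_base[of i], of ?d] qbr_cross_right[OF E_e_start[of "i + 1" "i + 3"], of "E i"]
    unfolding 1 by simp
  then have "s (q + qi) (?b * ?c - ?c * ?b) = 0"
    by (simp add: scale_left_distrib scale_right_diff_distrib algebra_simps)
  from cancel_q_plus_qi[OF this] show ?thesis
    by (simp add: qcomm_def)
qed

text \<open>The base case is the shortest interval with m strictly inside. Attaching e_{i,m-1} on
  the left and e_{m+2,j} on the right preserves commutation, as E_m is far from both.\<close>

lemma E_e_middle:
  assumes "i < m" "m + 1 < j"
  shows "qcomm 1 (E m) (e i j)"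
proof -
  define l where "l = m - 1"
  then have m: "m = l + 1" "i \<le> l" using assms by auto
  have base: "qcomm 1 (E m) (e l (m + 2))"
    using E_e_middle_base[of l] m by (simp add: eval_nat_numeral)
  have left: "qcomm 1 (E m) (e i (m + 2))"
  proof (cases "i = l")
    case False
    then have il: "i < l" using m by simp
    have "qcomm 1 (E m) (e i l)" using il m by (intro E_e_far) auto
    from qcomm_qbr_right[OF this base] show ?thesis using il m by (simp add: qbr_e)
  qed (use base in simp)
  show ?thesis
  proof (cases "j = m + 2")
    case False
    then have mj: "m + 2 < j" using assms by simp
    have "qcomm 1 (E m) (e (m + 2) j)" using mj by (intro E_e_far) auto
    from qcomm_qbr_right[OF left this] show ?thesis using mj assms by (simp add: qbr_e)
  qed (use left in simp)
qed

lemma e_nested: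
  assumes "i < u" "u < v" "v < j"
  shows "qcomm 1 (e i j) (e u v)"
  using assms by (intro qcomm_1_e qcomm_1_sym[OF E_e_middle]) auto

text \<open>E_i contributes the factor q; the rest e_{i+1,j} of e_ij is nested strictly inside e_iv
  and commutes with it.\<close>

lemma e_same_start:
  assumes "i < j" "j < v"
  shows "qcomm q (e i j) (e i v)"
proof (cases "j = i + 1")
  case False
  then have ij: "i + 1 < j" using assms by simp
  have "qcomm q (qbr (E i) (e (i + 1) j)) (e i v)"
    using qcomm_qbr_left[OF E_e_start[of i v] qcomm_1_sym[OF e_nested[of i "i + 1" j v]]] ij assms by simp
  then show ?thesis using qbr_e[of i "i + 1" j] ij by (simp add: e_Suc)
qed (use assms E_e_start[of i v] in \<open>simp add: e_Suc\<close>)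

lemma e_same_end:
  assumes "i < u" "u < j"
  shows "qcomm q (e i j) (e u j)"
proof (cases "j = u + 1")
  case False
  define l where "l = j - 1"
  then have l: "j = l + 1" "u < l" using assms False by auto
  have "qcomm q (e i j) (qbr (e u l) (E l))"
    using qcomm_qbr_right[OF e_nested[of i u l j] e_E_end[of i j]] l assms by simp
  then show ?thesis using qbr_e[of u l j] l by (simp add: e_Suc)
qed (use assms e_E_end[of i j] in \<open>simp add: e_Suc\<close>)

text \<open>With e_uv written as the q-commutator of e_uj and e_jv, \<open>qbr_cross_left\<close>
  applies; its two terms merge because the nested vectors e_iv and e_uj commute.\<close>

lemma e_crossing:
  assumes "i < u" "u < j" "j < v"
  shows "e i j * e u v - e u v * e i j = s (q - qi) (e i v * e u j)"
proof -
  have "e i v * e u j = e u j * e i v"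
    using e_nested[of i u j v] assms by (simp add: qcomm_def)
  then show ?thesis
    using qbr_cross_left[OF e_same_end[OF assms(1,2)], of "e j v"] assms
    by (simp add: qbr_e scale_left_diff_distrib)
qed

end

section \<open>Straightening\<close>

text \<open>
  The grading $\eta$ makes straightening terminate: all correction terms of a transposition have a
  smaller total degree, by the strictness of the grading.
\<close>

definition degree :: "nat \<times> nat \<Rightarrow> nat" where
  "degree = (\<lambda>(i, j). i * (j - i))"

fun inversions :: "(nat \<times> nat) list \<Rightarrow> nat" where
  "inversions [] = 0"
| "inversions (x # xs) = length (filter (\<lambda>y. unit_less y x) xs) + inversions xs"

lemma inversions_swap:
  "unit_less x y \<Longrightarrow> inversions (xs @ x # y # zs) < inversions (xs @ y # x # zs)"
  by (induction xs) (auto dest: unit_less_asym)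

lemma descent_if_not_sorted:
  assumes "\<not> sorted_wrt (\<lambda>x y. unit_less x y \<or> x = y) ys"
  shows "\<exists>xs x y zs. ys = xs @ y # x # zs \<and> unit_less x y"
  using assms
proof (induction ys)
  case (Cons a ys)
  show ?case
  proof (cases "sorted_wrt (\<lambda>x y. unit_less x y \<or> x = y) ys")
    case False
    then obtain xs x y zs where "ys = xs @ y # x # zs" "unit_less x y" using Cons.IH by blast
    then have "a # ys = (a # xs) @ y # x # zs \<and> unit_less x y" by simp
    then show ?thesis by blast
  next
    case True
    then obtain b zs where b: "ys = b # zs" using Cons.prems by (cases ys) auto
    have "unit_less b a"
    proof (rule ccontr)
      assume "\<not> unit_less b a"
      then have "unit_less a b \<or> a = b" using unit_less_linear by blast
      then have "sorted_wrt (\<lambda>x y. unit_less x y \<or> x = y) (a # ys)"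
        using True unfolding b by (auto dest: unit_less_trans)
      then show False using Cons.prems by blast
    qed
    then have "a # ys = [] @ a # b # zs \<and> unit_less b a" by (simp add: b)
    then show ?thesis by blast
  qed
qed simp

context serre_algebra
begin

abbreviation eprod :: "(nat \<times> nat) list \<Rightarrow> 'r" where
  "eprod ys \<equiv> prod_list (map (\<lambda>(i, j). e i j) ys)"

lemma span_mult:
  assumes "t \<in> span T"
  shows "a * t * b \<in> span ((\<lambda>x. a * x * b) ` T)"
  using assms
proof (induction rule: span_induct_alt)
  case (step c x y)
  have "a * (s c x + y) * b = s c (a * x * b) + a * y * b"
    by (simp add: distrib_left distrib_right scale_mult_left scale_mult_right)
  then show ?case using step by (auto intro: span_add span_scale span_base)
qed (simp add: span_zero)

text \<open>Two intervals with x < y are in one of seven relative positions, each governed by one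
  commutation relation. Only adjacent and crossing intervals leave a correction, whose degree drops
  by \<open>degree_brack_less\<close> or \<open>degree_pseudo_less\<close>.\<close>

lemma straighten:
  assumes x: "x \<in> units n" and y: "y \<in> units n" and less: "unit_less x y"
  shows "\<exists>c t. eprod [y, x] = s c (eprod [x, y]) + t \<and>
    t \<in> span (eprod ` {zs. set zs \<subseteq> units n \<and> sum_list (map degree zs) < degree x + degree y})"
    (is "\<exists>c t. _ \<and> t \<in> span ?T")
proof -
  obtain i j where x': "x = (i, j)" by (cases x)
  obtain u v where y': "y = (u, v)" by (cases y)
  have ij: "1 \<le> i" "i < j" "j \<le> n + 1" and uv: "1 \<le> u" "u < v" "v \<le> n + 1"
    using x y by (auto simp: x' y' units_def)
  have scaled: ?thesis if "e u v * e i j = s c (e i j * e u v)" for c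
    using that by (intro exI[of _ c] exI[of _ 0]) (simp add: x' y' span_zero)
  have rev: "e u v * e i j = s qi (e i j * e u v)" if "qcomm q (e i j) (e u v)"
    using that qi_q by (simp add: qcomm_def)
  \<comment> \<open>\<open>unit_less\<close> compares the midpoints of the intervals, the shorter
    interval coming first in a tie; this rules out the remaining positions.\<close>
  consider "j < u" | "j = u" | "i < u" "u < j" "v < j" | "i < u" "u < j" "v = j" | "i < u" "u < j" "j < v"
    | "i = u" "j < v" | "u < i" "j < v"
    using less ij uv unfolding x' y' unit_less_def prod.case by linarith
  then show ?thesis
  proof cases
    case 1
    then show ?thesis using e_far[of i j u v] scaled[of 1] ij uv by (simp add: qcomm_def)
  next
    case 2
    have "eprod [(i, v)] \<in> ?T"
      using 2 ij uv degree_brack_less[of i j v] by (intro imageI) (auto simp: units_def degree_def x' y')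
    then have "s (- q) (eprod [(i, v)]) \<in> span ?T" by (intro span_scale span_base)
    moreover have "eprod [y, x] = s q (eprod [x, y]) + s (- q) (eprod [(i, v)])"
      using qbr_e[of i j v] 2 ij uv by (simp add: qbr_def x' y' scalar_simps flip: qbr_e[of i j v])
    ultimately show ?thesis by blast
  next
    case 3
    then show ?thesis using e_nested[of i u v j] scaled[of 1] ij uv by (simp add: qcomm_def)
  next
    case 4
    then show ?thesis using e_same_end[of i u j] scaled[OF rev] ij uv by simp
  next
    case 5
    have "eprod [(i, v), (u, j)] \<in> ?T"
      using 5 ij uv degree_pseudo_less[of i u j v] by (intro imageI) (auto simp: units_def degree_def x' y')
    then have "s (qi - q) (eprod [(i, v), (u, j)]) \<in> span ?T" by (intro span_scale span_base)
    moreover have "eprod [y, x] = s 1 (eprod [x, y]) + s (qi - q) (eprod [(i, v), (u, j)])"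
      using e_crossing[of i u j v] 5 by (simp add: x' y' scale_left_diff_distrib algebra_simps)
    ultimately show ?thesis by blast
  next
    case 6
    then show ?thesis using e_same_start[of i j v] scaled[OF rev] ij uv by simp
  next
    case 7
    then show ?thesis using qcomm_1_sym[OF e_nested[of u i j v]] scaled[of 1] ij uv by (simp add: qcomm_def)
  qed
qed

theorem eprod_in_span:
  assumes "set ys \<subseteq> units n"
  shows "eprod ys \<in> span (eprod ` nondecreasing n)"
  using assms
proof (induction "(sum_list (map degree ys), inversions ys)" arbitrary: ys
    rule: wf_induct_rule[OF wf_lex_prod[OF wf_less_than wf_less_than]])
  case (1 ys)
  have IH: "eprod zs \<in> span (eprod ` nondecreasing n)" if "set zs \<subseteq> units n"
    "sum_list (map degree zs) < sum_list (map degree ys) \<or>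
     sum_list (map degree zs) = sum_list (map degree ys) \<and> inversions zs < inversions ys" for zs
    using 1(1)[OF _ that(1)] that(2) by auto
  show ?case
  proof (cases "ys \<in> nondecreasing n")
    case True
    then show ?thesis by (intro span_base imageI)
  next
    case False
    then obtain xs x y zs where ys: "ys = xs @ y # x # zs" and less: "unit_less x y"
      using descent_if_not_sorted[of ys] 1(2) by (auto simp: nondecreasing_def)
    have u: "x \<in> units n" "y \<in> units n" "set xs \<subseteq> units n" "set zs \<subseteq> units n" using 1(2) by (auto simp: ys)
    obtain c t where ct: "eprod [y, x] = s c (eprod [x, y]) + t"
      and t: "t \<in> span (eprod ` {zs. set zs \<subseteq> units n \<and> sum_list (map degree zs) < degree x + degree y})"
      using straighten[OF u(1,2) less] by blast
    have "eprod ys = eprod xs * eprod [y, x] * eprod zs"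
      by (simp add: ys mult.assoc)
    also have "\<dots> = s c (eprod (xs @ x # y # zs)) + eprod xs * t * eprod zs"
      unfolding ct by (simp add: distrib_left distrib_right scale_mult_left scale_mult_right mult.assoc)
    also have "\<dots> \<in> span (eprod ` nondecreasing n)"
    proof (intro span_add span_scale IH)
      show "set (xs @ x # y # zs) \<subseteq> units n" using u by auto
      show "sum_list (map degree (xs @ x # y # zs)) < sum_list (map degree ys) \<or>
        sum_list (map degree (xs @ x # y # zs)) = sum_list (map degree ys) \<and> inversions (xs @ x # y # zs) < inversions ys"
        using inversions_swap[OF less] by (simp add: ys)
      \<comment> \<open>The degree is additive over words, so its drop survives multiplication by
        the outer factors.\<close>
      have "(\<lambda>m. eprod xs * m * eprod zs) ` eprod ` {zs. set zs \<subseteq> units n \<and> sum_list (map degree zs) < degree x + degree y}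
        \<subseteq> span (eprod ` nondecreasing n)"
      proof clarify
        fix ws assume ws: "set ws \<subseteq> units n" "sum_list (map degree ws) < degree x + degree y"
        have "eprod (xs @ ws @ zs) \<in> span (eprod ` nondecreasing n)"
          using ws u by (intro IH) (auto simp: ys)
        then show "eprod xs * eprod ws * eprod zs \<in> span (eprod ` nondecreasing n)" by (simp add: mult.assoc)
      qed
      then show "eprod xs * t * eprod zs \<in> span (eprod ` nondecreasing n)"
        using span_mult[OF t, of "eprod xs" "eprod zs"] span_minimal[OF _ subspace_span] by blast
    qed
    finally show ?thesis .
  qed
qed

end

section \<open>The Serre quotient as a type\<close>

lemma poly_mapping_single_induct [case_names zero single add]:
  assumes "P 0" "\<And>k v. P (Poly_Mapping.single k v)" "\<And>p r. P p \<Longrightarrow> P r \<Longrightarrow> P (p + r)"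
  shows "P (p :: 'b \<Rightarrow>\<^sub>0 'k::comm_ring_1)"
proof -
  have "P (\<Sum>b\<in>S. scale (Poly_Mapping.lookup p b) (bas b))" if "finite S" for S
    using that
  proof (induction S)
    case (insert b S)
    have "scale (Poly_Mapping.lookup p b) (bas b) = Poly_Mapping.single b (Poly_Mapping.lookup p b)"
      by (rule poly_mapping_eqI) (auto simp: lookup_scale lookup_single when_def)
    then show ?case using insert assms by simp
  qed (use assms in simp)
  then show ?thesis using poly_mapping_sum_bas[of p] by (metis finite_keys)
qed

text \<open>
  A type cannot depend on \<open>n\<close>, so the relations are imposed on all letters. The projection
  \<open>in_range n\<close>, which kills the letters outside \<open>{1..n}\<close>, then carries congruences back to
  \<open>serre_ideal n\<close>.
\<close>

definition serre_gens :: "(nat list \<Rightarrow>\<^sub>0 'a::field_char_0 klaurent fract) set" where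
  "serre_gens = {gen i * gen j - gen j * gen i |i j. i + 1 < j \<or> j + 1 < i} \<union>
     {gen i * gen i * gen j - scal (to_Kq (qpow 1) + inverse (to_Kq (qpow 1))) * gen i * gen j * gen i + gen j * gen i * gen i |i j.
        j = i + 1 \<or> i = j + 1}"

text \<open>The factors a and b absorb scalars and signs, so closure under sums suffices for a
  two-sided ideal.\<close>

inductive_set serre_all :: "(nat list \<Rightarrow>\<^sub>0 'a::field_char_0 klaurent fract) set" where
  zero: "0 \<in> serre_all"
| add: "p \<in> serre_all \<Longrightarrow> r \<in> serre_all \<Longrightarrow> p + r \<in> serre_all"
| gens: "x \<in> serre_gens \<Longrightarrow> a * x * b \<in> serre_all"

lemma serre_all_mult: "p \<in> serre_all \<Longrightarrow> a * p * b \<in> serre_all"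
proof (induction rule: serre_all.induct)
  case (gens x c d)
  have "a * (c * x * d) * b = (a * c) * x * (d * b)" by (simp add: mult.assoc)
  then show ?case using serre_all.gens[OF gens] by metis
qed (auto simp: distrib_left distrib_right intro: serre_all.intros)

lemma serre_all_uminus: "p \<in> serre_all \<Longrightarrow> - p \<in> serre_all"
  using serre_all_mult[of p "- 1" 1] by simp

lemma serre_all_diff: "p \<in> serre_all \<Longrightarrow> r \<in> serre_all \<Longrightarrow> p - r \<in> serre_all"
  using serre_all.add[of p "- r"] serre_all_uminus[of r] by simp

\<comment> \<open>As a type of class \<open>ring\<close> the quotient can interpret
  \<open>serre_algebra\<close>, whose calculus rests on type classes.\<close>
quotient_type (overloaded) 'a serre_quot = "nat list \<Rightarrow>\<^sub>0 'a::field_char_0 klaurent fract" / "\<lambda>p r. p - r \<in> serre_all"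
proof (rule equivpI)
  show "reflp (\<lambda>p r. p - r \<in> (serre_all :: (nat list \<Rightarrow>\<^sub>0 'a klaurent fract) set))"
    by (rule reflpI) (simp add: serre_all.zero)
  show "symp (\<lambda>p r. p - r \<in> (serre_all :: (nat list \<Rightarrow>\<^sub>0 'a klaurent fract) set))"
    by (rule sympI) (metis minus_diff_eq serre_all_uminus)
  show "transp (\<lambda>p r. p - r \<in> (serre_all :: (nat list \<Rightarrow>\<^sub>0 'a klaurent fract) set))"
  proof (rule transpI)
    fix x y z :: "nat list \<Rightarrow>\<^sub>0 'a klaurent fract"
    assume "x - y \<in> serre_all" "y - z \<in> serre_all"
    from serre_all.add[OF this] show "x - z \<in> serre_all" by simp
  qed
qed

instantiation serre_quot :: (field_char_0) "{ring, monoid_mult}"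
begin

lift_definition zero_serre_quot :: "'a serre_quot" is 0 .
lift_definition one_serre_quot :: "'a serre_quot" is 1 .
lift_definition plus_serre_quot :: "'a serre_quot \<Rightarrow> 'a serre_quot \<Rightarrow> 'a serre_quot" is "(+)"
  by (simp add: add_diff_add serre_all.add)
lift_definition minus_serre_quot :: "'a serre_quot \<Rightarrow> 'a serre_quot \<Rightarrow> 'a serre_quot" is "(-)"
proof -
  fix a b c d :: "nat list \<Rightarrow>\<^sub>0 'a klaurent fract"
  assume "a - b \<in> serre_all" "c - d \<in> serre_all"
  from serre_all_diff[OF this] show "a - c - (b - d) \<in> serre_all" by (simp add: algebra_simps)
qed
lift_definition uminus_serre_quot :: "'a serre_quot \<Rightarrow> 'a serre_quot" is uminus
proof -
  fix a b :: "nat list \<Rightarrow>\<^sub>0 'a klaurent fract"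
  assume "a - b \<in> serre_all"
  from serre_all_uminus[OF this] show "- a - - b \<in> serre_all" by (simp add: algebra_simps)
qed
lift_definition times_serre_quot :: "'a serre_quot \<Rightarrow> 'a serre_quot \<Rightarrow> 'a serre_quot" is "(*)"
proof -
  fix a b c d :: "nat list \<Rightarrow>\<^sub>0 'a klaurent fract"
  assume "a - b \<in> serre_all" "c - d \<in> serre_all"
  then have "1 * (a - b) * c + b * (c - d) * 1 \<in> serre_all"
    by (intro serre_all.add serre_all_mult)
  then show "a * c - b * d \<in> serre_all" by (simp add: algebra_simps)
qed

instance
  by standard (transfer; simp add: serre_all.zero algebra_simps)+

end

lemma single_Nil_one: "Poly_Mapping.single [] 1 = (1 :: nat list \<Rightarrow>\<^sub>0 'f::field)"
  by (simp add: zero_list_def[symmetric])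

lemma scal_mult: "scal c * scal d = (scal (c * d) :: nat list \<Rightarrow>\<^sub>0 'f::field)"
  by (simp add: Poly_Mapping.mult_single plus_list_def)

lemma scal_add: "scal (c + d) = (scal c + scal d :: nat list \<Rightarrow>\<^sub>0 'f::field)"
  by (simp add: single_add)

lemma scal_commute: "p * scal c = scal c * (p :: nat list \<Rightarrow>\<^sub>0 'f::field)"
proof (induction p rule: poly_mapping_single_induct)
  case (single w v)
  then show ?case by (simp add: Poly_Mapping.mult_single plus_list_def mult.commute)
qed (simp_all add: distrib_left distrib_right)

lemma scal_left_commute: "p * (scal c * r) = scal c * (p * r :: nat list \<Rightarrow>\<^sub>0 'f::field)"
  by (metis mult.assoc scal_commute)

lemma to_Kq_simps [simp]:
  "to_Kq 0 = 0" "to_Kq 1 = 1" "to_Kq (a + b) = to_Kq a + to_Kq b" "to_Kq (a * b) = to_Kq a * to_Kq b"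
  "to_Kq (- a) = - to_Kq a" "to_Kq (a - b) = to_Kq a - to_Kq b"
  by (simp_all add: to_Kq_def Zero_fract_def One_fract_def)

lemma to_Kq_inj: "to_Kq a = to_Kq b \<longleftrightarrow> a = b"
  by (simp add: to_Kq_def eq_fract)

lemma qpow_mult: "qpow a * qpow b = qpow (a + b)"
  using exponential.qp_add[OF exponential_qpow] by metis

lemma qpow_0: "qpow 0 = 1"
  by (rule exponential.qp_0[OF exponential_qpow])

lemma to_Kq_qpow_minus: "to_Kq (qpow (- c)) = inverse (to_Kq (qpow c))"
proof (rule inverse_unique[symmetric])
  show "to_Kq (qpow c) * to_Kq (qpow (- c)) = 1"
    by (simp add: qpow_mult qpow_0 flip: to_Kq_simps(4))
qed

text \<open>The scalars are restricted to k although the ring is an algebra over K(q): spans for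
  this action are k-spans, as the k-form demands.\<close>

lift_definition serre_scale :: "'a::field_char_0 klaurent \<Rightarrow> 'a serre_quot \<Rightarrow> 'a serre_quot" is
  "\<lambda>c p. scal (to_Kq c) * p"
proof -
  fix c and p r :: "nat list \<Rightarrow>\<^sub>0 'a klaurent fract"
  assume "p - r \<in> serre_all"
  from serre_all_mult[OF this, of "scal (to_Kq c)" 1]
  show "scal (to_Kq c) * p - scal (to_Kq c) * r \<in> serre_all" by (simp add: algebra_simps)
qed

lift_definition serre_gen :: "nat \<Rightarrow> 'a::field_char_0 serre_quot" is "gen" .

text \<open>At t = 0 the value is 2, which is nonzero in characteristic 0.\<close>

lemma q_plus_qi_nonzero: "(qpow 1 + qpow (- 1) :: 'a::field_char_0 klaurent) \<noteq> 0"
proof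
  assume "(qpow 1 + qpow (- 1) :: 'a klaurent) = 0"
  then have "eval_t0 (qpow 1 + qpow (- 1) :: 'a klaurent) = 0" by simp
  then show False by simp
qed

global_interpretation serre: serre_algebra serre_scale "qpow 1" "qpow (- 1)" "serre_gen :: nat \<Rightarrow> 'a::field_char_0 serre_quot"
proof
  fix c d :: "'a klaurent" and x y :: "'a serre_quot"
  show "serre_scale c (x + y) = serre_scale c x + serre_scale c y"
    by transfer (simp add: algebra_simps serre_all.zero)
  show "serre_scale (c + d) x = serre_scale c x + serre_scale d x"
    by transfer (simp add: algebra_simps scal_add serre_all.zero)
  show "serre_scale c (serre_scale d x) = serre_scale (c * d) x"
    by transfer (simp add: scal_mult serre_all.zero flip: mult.assoc)
  show "serre_scale 1 x = x"
    by transfer (simp add: single_Nil_one serre_all.zero)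
  show "qpow 1 * qpow (- 1) = (1 :: 'a klaurent)" by (simp add: qpow_mult qpow_0)
  show "serre_scale c x * y = serre_scale c (x * y)"
    by transfer (simp add: mult.assoc serre_all.zero)
  show "x * serre_scale c y = serre_scale c (x * y)"
    by transfer (simp add: scal_left_commute serre_all.zero)
  \<comment> \<open>The inverse of q + q^-1 exists in K(q), so multiplication by it happens in the
    free algebra over K(q) and not through \<open>serre_scale\<close>.\<close>
  show "x = 0" if "serre_scale (qpow 1 + qpow (- 1)) x = 0"
    using that
  proof (induction x rule: serre_quot.abs_induct)
    fix x :: "nat list \<Rightarrow>\<^sub>0 'a klaurent fract"
    let ?c = "to_Kq (qpow 1 + qpow (- 1) :: 'a klaurent)"
    assume "serre_scale (qpow 1 + qpow (- 1)) (abs_serre_quot x) = 0"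
    then have "scal ?c * x \<in> serre_all"
      by (simp add: serre_scale.abs_eq zero_serre_quot_def serre_quot.abs_eq_iff del: to_Kq_simps)
    from serre_all_mult[OF this, of "scal (inverse ?c)" 1]
    have "scal (inverse ?c) * scal ?c * x \<in> serre_all" by (simp add: mult.assoc)
    moreover have "?c \<noteq> 0" using to_Kq_inj[of "qpow 1 + qpow (- 1) :: 'a klaurent" 0] q_plus_qi_nonzero[where 'a = 'a]
      unfolding to_Kq_simps(1) by blast
    ultimately show "abs_serre_quot x = 0"
      by (simp add: scal_mult single_Nil_one zero_serre_quot_def serre_quot.abs_eq_iff del: to_Kq_simps)
  qed
next
  fix i j :: nat
  show "serre_gen i * serre_gen j = (serre_gen j * serre_gen i :: 'a serre_quot)" if "i + 1 < j"
    using that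
  proof transfer
    fix i j :: nat assume "i + 1 < j"
    then have "1 * (gen i * gen j - gen j * gen i) * 1 \<in> (serre_all :: (nat list \<Rightarrow>\<^sub>0 'a klaurent fract) set)"
      by (intro serre_all.gens) (auto simp: serre_gens_def)
    then show "gen i * gen j - gen j * gen i \<in> (serre_all :: (nat list \<Rightarrow>\<^sub>0 'a klaurent fract) set)" by simp
  qed
  show "serre_gen i * serre_gen i * serre_gen j - serre_scale (qpow 1 + qpow (- 1)) (serre_gen i * serre_gen j * serre_gen i)
      + serre_gen j * serre_gen i * serre_gen i = (0 :: 'a serre_quot)" if "j = i + 1 \<or> i = j + 1"
  proof -
    have "1 * (gen i * gen i * gen j - scal (to_Kq (qpow 1) + inverse (to_Kq (qpow 1))) * gen i * gen j * gen i + gen j * gen i * gen i) * 1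
       \<in> (serre_all :: (nat list \<Rightarrow>\<^sub>0 'a klaurent fract) set)"
      using that by (intro serre_all.gens) (unfold serre_gens_def, blast)
    then show ?thesis
      by (simp add: to_Kq_qpow_minus mult.assoc serre_gen.abs_eq times_serre_quot.abs_eq serre_scale.abs_eq minus_serre_quot.abs_eq
           plus_serre_quot.abs_eq zero_serre_quot_def serre_quot.abs_eq_iff)
  qed
qed

section \<open>Return to the letters 1 to n\<close>

definition in_range :: "nat \<Rightarrow> (nat list \<Rightarrow>\<^sub>0 'f::field) \<Rightarrow> (nat list \<Rightarrow>\<^sub>0 'f)" where
  "in_range n = lin_ext {w. set w \<subseteq> {1..n}} bas"

lemma in_range_add: "in_range n (p + r) = in_range n p + in_range n r"
  and in_range_zero [simp]: "in_range n 0 = 0"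
  and in_range_diff: "in_range n (p - r) = in_range n p - in_range n r"
  by (simp_all add: in_range_def lin_ext_add lin_ext_zero lin_ext_diff)

lemma in_range_single:
  "in_range n (Poly_Mapping.single w c) = (if set w \<subseteq> {1..n} then Poly_Mapping.single w c else 0)"
  by (rule poly_mapping_eqI) (auto simp: in_range_def lookup_lin_ext_bas lookup_single when_def)

lemma in_range_mult: "in_range n (p * r) = in_range n p * in_range n r"
proof (induction p rule: poly_mapping_single_induct)
  case (single w c)
  show ?case
  proof (induction r rule: poly_mapping_single_induct)
    case (single w' c')
    then show ?case by (auto simp: in_range_single Poly_Mapping.mult_single plus_list_def)
  qed (simp_all add: distrib_left in_range_add)
qed (simp_all add: distrib_right in_range_add)

lemma in_range_carrier: "in_range n p \<in> carrier (free_algebra n)"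
  by (force simp: free_algebra_def in_range_def in_keys_iff lookup_lin_ext_bas split: if_splits)

lemma in_range_one [simp]: "in_range n 1 = 1"
  using in_range_single[of n "[]" 1] by (simp add: single_Nil_one)

lemma in_range_id: "p \<in> carrier (free_algebra n) \<Longrightarrow> in_range n p = p"
  by (rule poly_mapping_eqI) (force simp: free_algebra_def in_range_def in_keys_iff lookup_lin_ext_bas)

lemma free_algebra_simps [simp]:
  "x \<otimes>\<^bsub>free_algebra n\<^esub> y = x * y" "x \<oplus>\<^bsub>free_algebra n\<^esub> y = x + y"
  "\<one>\<^bsub>free_algebra n\<^esub> = 1" "\<zero>\<^bsub>free_algebra n\<^esub> = 0"
  by (simp_all add: free_algebra_def)

lemma carrier_iff: "p \<in> carrier (free_algebra n) \<longleftrightarrow> in_range n p = p"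
  using in_range_id in_range_carrier by metis

lemma ring_free_algebra: "ring (free_algebra n)"
proof (rule ringI)
  show "abelian_group (free_algebra n)"
  proof (rule abelian_groupI)
    fix x assume "x \<in> carrier (free_algebra n)"
    then have "in_range n (- x) = - x"
      using in_range_diff[of n 0 x] by (simp add: carrier_iff)
    then show "\<exists>y\<in>carrier (free_algebra n). y \<oplus>\<^bsub>free_algebra n\<^esub> x = \<zero>\<^bsub>free_algebra n\<^esub>"
      by (intro bexI[of _ "- x"]) (simp_all add: carrier_iff)
  qed (simp_all add: carrier_iff in_range_add algebra_simps)
  show "Group.monoid (free_algebra n)"
    by (rule monoidI) (simp_all add: carrier_iff in_range_mult mult.assoc)
qed (simp_all add: algebra_simps)

lemma a_inv_free_algebra:
  assumes "x \<in> carrier (free_algebra n)"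
  shows "\<ominus>\<^bsub>free_algebra n\<^esub> x = - x"
proof -
  interpret ring "free_algebra n" by (rule ring_free_algebra)
  have "- x \<in> carrier (free_algebra n)"
    using in_range_diff[of n 0 x] assms by (simp add: carrier_iff)
  then show ?thesis using assms by (intro minus_equality) simp_all
qed

lemma serre_relations_carrier: "serre_relations q n \<subseteq> carrier (free_algebra n)"
  by (auto simp: serre_relations_def carrier_iff in_range_diff in_range_add in_range_mult in_range_single)

lemma ideal_serre_ideal: "ideal (serre_ideal n) (free_algebra n)"
  unfolding serre_ideal_def by (rule ring.genideal_ideal[OF ring_free_algebra serre_relations_carrier])

lemma serre_relations_subset: "serre_relations (to_Kq (qpow 1)) n \<subseteq> serre_ideal n"
  unfolding serre_ideal_def by (rule ring.genideal_self[OF ring_free_algebra serre_relations_carrier])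

text \<open>Every monomial of a relation contains both of its letters. So the projection either
  fixes the relation, which is then one for rank n, or kills it entirely.\<close>

lemma serre_all_in_range:
  assumes "p \<in> serre_all"
  shows "in_range n p \<in> serre_ideal n"
proof -
  interpret ideal "serre_ideal n" "free_algebra n :: (nat list \<Rightarrow>\<^sub>0 'a klaurent fract) ring" by (rule ideal_serre_ideal)
  from assms show ?thesis
  proof (induction rule: serre_all.induct)
    case zero
    then show ?case using additive_subgroup.zero_closed[OF additive_subgroup_axioms] by simp
  next
    case (add p r)
    then show ?case using additive_subgroup.a_closed[OF additive_subgroup_axioms] by (simp add: in_range_add)
  next
    case (gens x a b)
    have "in_range n x \<in> insert 0 (serre_relations (to_Kq (qpow 1)) n)"
      using gens unfolding serre_gens_def
    proof (elim UnE CollectE exE conjE)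
      fix i j assume x: "x = gen i * gen j - gen j * gen i" and ij: "i + 1 < j \<or> j + 1 < i"
      show ?thesis
      proof (cases "i \<in> {1..n} \<and> j \<in> {1..n}")
        case True
        then have "x \<in> serre_relations (to_Kq (qpow 1)) n" unfolding x serre_relations_def using ij by blast
        moreover have "in_range n x = x"
          using True unfolding x in_range_diff in_range_mult in_range_single by simp
        ultimately show ?thesis by simp
      next
        case False
        then have "in_range n x = 0" unfolding x in_range_diff in_range_mult in_range_single by auto
        then show ?thesis by simp
      qed
    next
      fix i j assume x: "x = gen i * gen i * gen j - scal (to_Kq (qpow 1) + inverse (to_Kq (qpow 1))) * gen i * gen j * gen i
        + gen j * gen i * gen i" and ij: "j = i + 1 \<or> i = j + 1"
      show ?thesis
      proof (cases "i \<in> {1..n} \<and> j \<in> {1..n}")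
        case True
        then have "x \<in> serre_relations (to_Kq (qpow 1)) n" unfolding x serre_relations_def using ij by blast
        moreover have "in_range n x = x"
          using True unfolding x in_range_diff in_range_add in_range_mult in_range_single by simp
        ultimately show ?thesis by simp
      next
        case False
        then have "in_range n x = 0" unfolding x in_range_diff in_range_add in_range_mult in_range_single by auto
        then show ?thesis by simp
      qed
    qed
    then have "in_range n x \<in> serre_ideal n"
      using serre_relations_subset additive_subgroup.zero_closed[OF additive_subgroup_axioms] by auto
    then have "in_range n a \<otimes>\<^bsub>free_algebra n\<^esub> in_range n x \<otimes>\<^bsub>free_algebra n\<^esub> in_range n b \<in> serre_ideal n"
      by (intro I_l_closed I_r_closed in_range_carrier)
    then show ?case by (simp add: in_range_mult)
  qed
qed

lemma abs_eq_imp_serre_ideal: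
  assumes "abs_serre_quot p = abs_serre_quot r" "p \<in> carrier (free_algebra n)" "r \<in> carrier (free_algebra n)"
  shows "p - r \<in> serre_ideal n"
  using serre_all_in_range[of "p - r" n] assms
  by (simp add: serre_quot.abs_eq_iff in_range_diff carrier_iff)

section \<open>Independence through the quantum torus\<close>

lemma module_hom_eqI:
  assumes "module_hom scale scale f" "module_hom scale scale g" "\<And>b. f (bas b) = g (bas b)"
  shows "f x = g x"
proof -
  have "x \<in> vec.span (bas ` UNIV)"
    by (simp add: free_mod_def flip: free_mod_eq_span)
  then show ?thesis by (rule module_hom_eq_span[OF assms(1,2), rotated]) (auto simp: assms(3))
qed

lemma module_hom_sum:
  assumes "\<And>j. j \<in> J \<Longrightarrow> module_hom scale scale (f j)"
  shows "module_hom scale scale (\<lambda>x. \<Sum>j\<in>J. f j x)"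
proof -
  have "f j (x + y) = f j x + f j y" "f j (scale c x) = scale c (f j x)" if "j \<in> J" for j x y c
    using module_hom.add[OF assms[OF that]] module_hom.scale[OF assms[OF that]] by auto
  then show ?thesis
    by (intro module_hom_scaleI; unfold sum.distrib[symmetric] vec.scale_sum_right; intro sum.cong refl)
qed

lemma module_hom_scale:
  assumes "module_hom scale scale f"
  shows "module_hom scale scale (\<lambda>x. scale c (f x))"
  using assms
  by (intro module_hom_scaleI)
     (simp_all add: module_hom.add module_hom.scale vec.scale_right_distrib mult.commute)

text \<open>Commutation only sees the skew part: \<open>twist m u - twist u m\<close> is the Cartan
  integer of the two letters if the position m precedes u in the reduced word, and its negative if u
  precedes m. In rows i and i + 1, the position (i, j) precedes (i + 1, v) exactly if j < v.\<close>

definition twist :: "nat \<times> nat \<Rightarrow> nat \<times> nat \<Rightarrow> int" where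
  "twist = (\<lambda>(i, j) (u, v). if i = u then (if j < v then 2 else 0)
     else if u = i + 1 then (if j < v then - 1 else 1) else 0)"

definition height :: "(nat \<times> nat) multiset \<Rightarrow> nat" where
  "height a = (\<Sum>m\<in>#a. snd m)"

lemma height_simps [simp]: "height {#} = 0" "height (add_mset m a) = snd m + height a" "height (a + b) = height a + height b"
  by (simp_all add: height_def)

text \<open>
  The operators \<open>Y (i, j)\<close> generate a quantum torus, and $E_i \mapsto \sum_{j > i} Y_{ij}$ is the Feigin
  homomorphism for the reduced word $(1, \ldots, n)(1, \ldots, n-1) \cdots (1)$ of the longest element,
  whose $m$-th letter $i$ is labelled \<open>(i, i + m)\<close>.
\<close>

locale quantum_torus =
  fixes q :: "'f::field" and n N :: nat
  assumes N: "N = n + 1" and q_nonzero: "q \<noteq> 0" and q2: "q * q \<noteq> 1"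
begin

text \<open>The left regular representation of a twisted monoid algebra: multisets are the exponents
  of monomials, and \<open>twist\<close>, extended additively, is the bicharacter that deforms their
  product.\<close>

definition Y :: "nat \<times> nat \<Rightarrow> ((nat \<times> nat) multiset \<Rightarrow>\<^sub>0 'f) \<Rightarrow> ((nat \<times> nat) multiset \<Rightarrow>\<^sub>0 'f)" where
  "Y m = lin_ext UNIV (\<lambda>a. scale (q powi (\<Sum>u\<in>#a. twist m u)) (bas (add_mset m a)))"

lemma Y_hom: "module_hom scale scale (Y m)"
  by (simp add: Y_def)

lemma Y_bas: "Y m (bas a) = scale (q powi (\<Sum>u\<in>#a. twist m u)) (bas (add_mset m a))"
  by (simp add: Y_def lin_ext_bas)

lemma Y_commute: "Y m (Y u x) = scale (q powi (twist m u - twist u m)) (Y u (Y m x))"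
proof (rule module_hom_eqI[of "\<lambda>x. Y m (Y u x)" "\<lambda>x. scale _ (Y u (Y m x))"])
  show "Y m (Y u (bas b)) = scale (q powi (twist m u - twist u m)) (Y u (Y m (bas b)))" for b
    using q_nonzero
    by (simp add: Y_bas module_hom.scale[OF Y_hom] add_mset_commute power_int_add power_int_diff mult.commute mult.left_commute)
qed (intro module_hom_scale module_hom_compose[OF Y_hom Y_hom])+

lemma Y_same: "j < v \<Longrightarrow> Y (i, j) (Y (i, v) x) = scale (q * q) (Y (i, v) (Y (i, j) x))"
  by (subst Y_commute) (simp add: twist_def power2_eq_square)

lemma Y_next_less: "j < v \<Longrightarrow> Y (i, j) (Y (Suc i, v) x) = scale (inverse q) (Y (Suc i, v) (Y (i, j) x))"
  by (subst Y_commute) (simp add: twist_def power_int_minus)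

lemma Y_next_ge: "v \<le> j \<Longrightarrow> Y (i, j) (Y (Suc i, v) x) = scale q (Y (Suc i, v) (Y (i, j) x))"
  by (subst Y_commute) (simp add: twist_def)

lemma Y_far: "i + 1 < u \<or> u + 1 < i \<Longrightarrow> Y (i, j) (Y (u, v) x) = Y (u, v) (Y (i, j) x)"
  by (subst Y_commute) (auto simp: twist_def)

lemma Y_next_less': "j < v \<Longrightarrow> Y (Suc i, v) (Y (i, j) x) = scale q (Y (i, j) (Y (Suc i, v) x))"
  using q_nonzero by (simp add: Y_next_less)

lemma Y_next_ge': "v \<le> j \<Longrightarrow> Y (Suc i, v) (Y (i, j) x) = scale (inverse q) (Y (i, j) (Y (Suc i, v) x))"
  using q_nonzero by (simp add: Y_next_ge)

definition X :: "nat \<Rightarrow> ((nat \<times> nat) multiset \<Rightarrow>\<^sub>0 'f) \<Rightarrow> ((nat \<times> nat) multiset \<Rightarrow>\<^sub>0 'f)" where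
  "X i x = (\<Sum>j\<in>{i+1..N}. Y (i, j) x)"

lemma X_hom: "module_hom scale scale (X i)"
  unfolding X_def[abs_def] by (intro module_hom_sum Y_hom)

text \<open>After C is moved to the left, the squares of A and B have the coefficients q^-2 - (q +
  q^-1) q^-1 + 1 and q^2 - (q + q^-1) q + 1, both zero, and the mixed terms (1 - q^-2) A B + (1 -
  q^2) B A cancel by A B = q^2 B A.\<close>

lemma serre_two_parts:
  assumes A: "module_hom scale scale A" and B: "module_hom scale scale B" and C: "module_hom scale scale C"
    and AC: "\<And>x. A (C x) = scale (inverse q) (C (A x))"
    and BC: "\<And>x. B (C x) = scale q (C (B x))"
    and AB: "\<And>x. A (B x) = scale (q * q) (B (A x))"
  defines "D \<equiv> (\<lambda>x. A x + B x)"
  shows "D (D (C x)) - scale (q + inverse q) (D (C (D x))) + C (D (D x)) = 0"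
proof -
  note [simp] = module_hom.add[OF A] module_hom.add[OF B] module_hom.add[OF C]
    module_hom.scale[OF A] module_hom.scale[OF B] module_hom.scale[OF C]
  show ?thesis
    unfolding D_def using q_nonzero
    by (intro poly_mapping_eqI) (simp add: AC BC AB lookup_add lookup_minus lookup_scale field_simps)
qed

lemma X_Y_serre:
  assumes "u = Suc i \<or> i = Suc u"
  shows "X i (X i (Y (u, v) x)) - scale (q + inverse q) (X i (Y (u, v) (X i x))) + Y (u, v) (X i (X i x)) = 0"
proof -
  let ?I = "{i+1..N}"
  \<comment> \<open>\<open>J\<close> collects the positions (i, j) that precede (u, v) in the
    reduced word; the boundary case j = v precedes only for i = Suc u.\<close>
  define J where "J = (if u = Suc i then {j \<in> ?I. j < v} else {j \<in> ?I. j \<le> v})"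
  define A where "A = (\<lambda>x. \<Sum>j\<in>J. Y (i, j) x)"
  define B where "B = (\<lambda>x. \<Sum>j\<in>?I - J. Y (i, j) x)"
  have A: "module_hom scale scale A" and B: "module_hom scale scale B"
    unfolding A_def B_def by (intro module_hom_sum Y_hom)+
  have J: "J \<subseteq> ?I" "finite J" by (auto simp: J_def)
  have X: "X i = (\<lambda>x. A x + B x)"
    using sum.subset_diff[OF J(1), of "\<lambda>j. Y (i, j) _"] by (simp add: X_def A_def B_def fun_eq_iff add.commute)
  have AC: "A (Y (u, v) x) = scale (inverse q) (Y (u, v) (A x))" for x
    unfolding A_def module_hom.sum[OF Y_hom] vec.scale_sum_right
    using assms by (intro sum.cong) (auto simp: J_def Y_next_less Y_next_ge' split: if_splits)
  have BC: "B (Y (u, v) x) = scale q (Y (u, v) (B x))" for x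
    unfolding B_def module_hom.sum[OF Y_hom] vec.scale_sum_right
    using assms by (intro sum.cong) (auto simp: J_def Y_next_less' Y_next_ge split: if_splits)
  have AB: "A (B x) = scale (q * q) (B (A x))" for x
  proof -
    have "A (B x) = (\<Sum>j\<in>J. \<Sum>j'\<in>?I - J. Y (i, j) (Y (i, j') x))"
      by (simp add: A_def B_def module_hom.sum[OF Y_hom])
    also have "\<dots> = (\<Sum>j\<in>J. \<Sum>j'\<in>?I - J. scale (q * q) (Y (i, j') (Y (i, j) x)))"
      using assms by (intro sum.cong refl Y_same) (auto simp: J_def split: if_splits)
    also have "\<dots> = scale (q * q) (B (A x))"
      unfolding A_def B_def module_hom.sum[OF Y_hom] vec.scale_sum_right by (rule sum.swap)
    finally show ?thesis .
  qed
  show ?thesis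
    unfolding X by (rule serre_two_parts[OF A B Y_hom AC BC AB])
qed

text \<open>The relation is linear in the letter u, so it can be checked on each summand
  \<open>Y (u, v)\<close> separately.\<close>

lemma X_serre_near:
  assumes "u = Suc i \<or> i = Suc u"
  shows "X i (X i (X u x)) - scale (q + inverse q) (X i (X u (X i x))) + X u (X i (X i x)) = 0"
proof -
  have "X i (X i (X u x)) - scale (q + inverse q) (X i (X u (X i x))) + X u (X i (X i x)) =
    (\<Sum>v\<in>{u+1..N}. X i (X i (Y (u, v) x)) - scale (q + inverse q) (X i (Y (u, v) (X i x))) + Y (u, v) (X i (X i x)))"
    by (simp add: X_def[of u] module_hom.sum[OF X_hom] vec.scale_sum_right sum.distrib sum_subtractf)
  then show ?thesis by (simp add: X_Y_serre[OF assms])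
qed

lemma X_far:
  assumes "i + 1 < u \<or> u + 1 < i"
  shows "X i (X u x) = X u (X i x)"
  unfolding X_def module_hom.sum[OF Y_hom]
  by (subst sum.swap) (simp add: Y_far[OF assms])

section \<open>The action of the free algebra on the torus module\<close>

fun act_word :: "nat list \<Rightarrow> ((nat \<times> nat) multiset \<Rightarrow>\<^sub>0 'f) \<Rightarrow> ((nat \<times> nat) multiset \<Rightarrow>\<^sub>0 'f)" where
  "act_word [] x = x"
| "act_word (i # w) x = X i (act_word w x)"

definition act :: "(nat list \<Rightarrow>\<^sub>0 'f) \<Rightarrow> ((nat \<times> nat) multiset \<Rightarrow>\<^sub>0 'f) \<Rightarrow> ((nat \<times> nat) multiset \<Rightarrow>\<^sub>0 'f)" where
  "act p x = lin_ext UNIV (\<lambda>w. act_word w x) p"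

lemma act_word_append: "act_word (w @ w') x = act_word w (act_word w' x)"
  by (induction w) auto

lemma act_word_hom: "module_hom scale scale (act_word w)"
proof (induction w)
  case (Cons i w)
  show ?case unfolding act_word.simps[abs_def] by (rule module_hom_compose[OF X_hom Cons.IH])
qed (simp add: module_hom_id)

lemma act_simps:
  "act (p + r) x = act p x + act r x" "act (p - r) x = act p x - act r x" "act 0 x = 0"
  by (simp_all add: act_def lin_ext_add lin_ext_diff lin_ext_zero)

lemma act_single: "act (Poly_Mapping.single w c) x = scale c (act_word w x)"
  using lin_ext_scale[of UNIV "\<lambda>w. act_word w x" c "bas w"]
  by (simp add: act_def lin_ext_bas scale_def map_single)

lemma act_hom: "module_hom scale scale (act p)"
proof (induction p rule: poly_mapping_single_induct)
  case (single w c)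
  then show ?case unfolding act_single[abs_def] by (intro module_hom_scale act_word_hom)
next
  case (add p r)
  then show ?case unfolding act_simps(1)[abs_def] by (rule module_hom_plus)
qed (simp add: act_simps(3)[abs_def] module_hom_zero)

lemma act_mult: "act (p * r) x = act p (act r x)"
proof (induction p rule: poly_mapping_single_induct)
  case (single w c)
  show ?case
  proof (induction r rule: poly_mapping_single_induct)
    case (single w' c')
    then show ?case
      by (simp add: Poly_Mapping.mult_single plus_list_def act_single act_word_append module_hom.scale[OF act_word_hom])
  qed (simp_all add: distrib_left act_simps module_hom.add[OF act_hom] module_hom.zero[OF act_hom])
qed (simp_all add: distrib_right act_simps)

lemma act_one: "act 1 x = x"
  using act_single[of "[]" 1 x] by (simp add: single_Nil_one)

lemma act_relations: "p \<in> serre_relations q n \<Longrightarrow> act p x = 0"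
  using X_far X_serre_near
  by (auto simp: serre_relations_def act_simps act_mult act_single simp del: vec.scale_scale)

text \<open>The polynomials annihilating the whole module form a two-sided ideal, so it is enough
  that the Serre relations annihilate it.\<close>

lemma act_serre_ideal:
  assumes "p \<in> genideal (free_algebra n) (serre_relations q n)"
  shows "act p x = 0"
proof -
  interpret ring "free_algebra n :: (nat list \<Rightarrow>\<^sub>0 'f) ring" by (rule ring_free_algebra)
  let ?I = "{p \<in> carrier (free_algebra n). \<forall>x. act p x = 0}"
  have "ideal ?I (free_algebra n)"
  proof (rule idealI[OF ring_free_algebra])
    show "subgroup ?I (add_monoid (free_algebra n))"
    proof
      show "inv\<^bsub>add_monoid (free_algebra n)\<^esub> p \<in> ?I" if "p \<in> ?I" for p
      proof -
        have "\<ominus>\<^bsub>free_algebra n\<^esub> p \<in> ?I"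
          using that act_simps(2)[of 0 p] a_inv_closed[of p] by (simp add: a_inv_free_algebra act_simps(3))
        then show ?thesis by (simp add: a_inv_def)
      qed
    qed (use a_closed zero_closed in \<open>auto simp: act_simps\<close>)
  qed (use m_closed in \<open>auto simp: act_mult module_hom.zero[OF act_hom]\<close>)
  moreover have "serre_relations q n \<subseteq> ?I"
    using serre_relations_carrier act_relations by auto
  ultimately have "genideal (free_algebra n) (serre_relations q n) \<subseteq> ?I"
    by (rule genideal_minimal)
  then show ?thesis using assms by auto
qed

text \<open>Lifts of the root vectors to the free algebra, where the action is defined.\<close>

fun root_poly :: "nat \<Rightarrow> nat \<Rightarrow> (nat list \<Rightarrow>\<^sub>0 'f)" where
  "root_poly i 0 = 0"
| "root_poly i (Suc 0) = gen i"
| "root_poly i (Suc (Suc d)) = root_poly i (Suc d) * gen (i + Suc d)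
    - scal (inverse q) * (gen (i + Suc d) * root_poly i (Suc d))"

text \<open>
  \<open>G i d v\<close> is the part of the operator of $e_{i,i+d}$ whose last factor is \<open>Y (i + d - 1, v)\<close>; in the
  $q$-commutator with $E_{i+d}$ the products with last indices $v' < v$ cancel.
\<close>

fun G :: "nat \<Rightarrow> nat \<Rightarrow> nat \<Rightarrow> ((nat \<times> nat) multiset \<Rightarrow>\<^sub>0 'f) \<Rightarrow> ((nat \<times> nat) multiset \<Rightarrow>\<^sub>0 'f)" where
  "G i 0 v x = 0"
| "G i (Suc 0) v x = Y (i, v) x"
| "G i (Suc (Suc d)) v x = scale (1 - inverse q * inverse q) (\<Sum>v'\<in>{v..N}. G i (Suc d) v' (Y (i + Suc d, v) x))"

lemma G_hom: "module_hom scale scale (G i d v)"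
proof (induction i d v rule: G.induct[of "\<lambda>i d v _. module_hom scale scale (G i d v)"])
  case (3 i d v x)
  then show ?case
    unfolding G.simps[abs_def] by (intro module_hom_scale module_hom_sum module_hom_compose[OF _ Y_hom]) auto
qed (simp_all add: G.simps[abs_def] module_hom_zero Y_hom)

lemma G_Y_far: "i + d < u \<Longrightarrow> G i d v' (Y (u, v) x) = Y (u, v) (G i d v' x)"
proof (induction i d v' x rule: G.induct)
  case (3 i d v' x)
  have "Y (i + Suc d, v') (Y (u, v) x) = Y (u, v) (Y (i + Suc d, v') x)" using 3 by (intro Y_far) auto
  then show ?case using 3 by (simp add: module_hom.scale[OF Y_hom] module_hom.sum[OF Y_hom])
qed (auto simp: module_hom.zero[OF Y_hom] intro!: Y_far)

text \<open>Among the factors of \<open>G i d v'\<close> only the last, in row i + d - 1, is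
  adjacent to row i + d; the others commute with that row.\<close>

lemma G_Y_next:
  assumes "d > 0"
  shows "G i d v' (Y (i + d, v) x) = scale (if v' < v then inverse q else q) (Y (i + d, v) (G i d v' x))"
proof (cases d)
  case (Suc d')
  show ?thesis
  proof (cases d')
    case 0
    then show ?thesis using Suc Y_next_less[of v' v i x] Y_next_ge[of v v' i x] by auto
  next
    case (Suc d'')
    have "Y (i + Suc d'', v') (Y (i + d, v) x) = scale (if v' < v then inverse q else q) (Y (i + d, v) (Y (i + Suc d'', v') x))"
      using \<open>d = Suc d'\<close> Suc Y_next_less[of v' v "i + Suc d''" x] Y_next_ge[of v v' "i + Suc d''" x] by auto
    moreover have "G i (Suc d'') w (Y (i + d, v) z) = Y (i + d, v) (G i (Suc d'') w z)" for w z
      using \<open>d = Suc d'\<close> Suc by (intro G_Y_far) auto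
    ultimately show ?thesis
      using \<open>d = Suc d'\<close> Suc
      by (simp add: module_hom.scale[OF Y_hom] module_hom.sum[OF Y_hom] module_hom.scale[OF G_hom] mult.commute
          flip: vec.scale_sum_right del: add_Suc_right)
  qed
qed (use assms in simp)

lemma act_root_poly: "d > 0 \<Longrightarrow> act (root_poly i d) x = (\<Sum>v\<in>{i+d..N}. G i d v x)"
proof (induction i d arbitrary: x rule: root_poly.induct)
  case (2 i)
  then show ?case by (simp add: act_single X_def)
next
  case (3 i d)
  have q_cancel: "q * inverse q = 1" "q * (inverse q * inverse q) = inverse q" "inverse q * q = 1" using q_nonzero by simp_all
  let ?j = "i + Suc d" and ?q = "1 - inverse q * inverse q"
  have IH: "act (root_poly i (Suc d)) x = (\<Sum>v'\<in>{?j..N}. G i (Suc d) v' x)" for x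
    using 3 by simp
  have "act (root_poly i (Suc (Suc d))) x =
    (\<Sum>v\<in>{?j+1..N}. \<Sum>v'\<in>{?j..N}. G i (Suc d) v' (Y (?j, v) x))
      - scale (inverse q) (\<Sum>v\<in>{?j+1..N}. \<Sum>v'\<in>{?j..N}. Y (?j, v) (G i (Suc d) v' x))"
    by (simp add: act_simps act_mult act_single IH X_def module_hom.sum[OF act_hom] module_hom.sum[OF Y_hom]
       module_hom.sum[OF G_hom] del: add_Suc_right)
       (subst sum.swap, simp add: vec.scale_sum_right)
  also have "\<dots> = (\<Sum>v\<in>{?j+1..N}. \<Sum>v'\<in>{?j..N}.
      G i (Suc d) v' (Y (?j, v) x) - scale (inverse q) (Y (?j, v) (G i (Suc d) v' x)))"
    by (simp add: vec.scale_sum_right sum_subtractf)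
  \<comment> \<open>For v' < v, \<open>G_Y_next\<close> gives G Y = q^-1 Y G and the difference
    vanishes; for v' \<ge> v it gives Y G = q^-1 G Y, whence the coefficient 1 - q^-2 in
    \<open>G\<close>.\<close>
  also have "\<dots> = (\<Sum>v\<in>{?j+1..N}. \<Sum>v'\<in>{?j..N}.
      if v' < v then 0 else scale ?q (G i (Suc d) v' (Y (?j, v) x)))"
    by (intro sum.cong refl) (auto simp: q_cancel G_Y_next[of "Suc d"] vec.scale_left_diff_distrib algebra_simps simp del: add_Suc_right)
  also have "\<dots> = (\<Sum>v\<in>{?j+1..N}. \<Sum>v'\<in>{v..N}. scale ?q (G i (Suc d) v' (Y (?j, v) x)))"
    by (intro sum.cong refl sum.mono_neutral_cong_right) auto
  also have "\<dots> = (\<Sum>v\<in>{?j+1..N}. G i (Suc (Suc d)) v x)"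
    by (simp add: vec.scale_sum_right)
  finally show ?case by simp
qed simp

text \<open>
  \<open>T\<close> multiplies by the monomial \<open>f\<close> up to a nonzero scalar and terms of larger height.
\<close>

definition leads :: "(((nat \<times> nat) multiset \<Rightarrow>\<^sub>0 'f) \<Rightarrow> ((nat \<times> nat) multiset \<Rightarrow>\<^sub>0 'f)) \<Rightarrow> (nat \<times> nat) multiset \<Rightarrow> bool" where
  "leads T f \<longleftrightarrow> module_hom scale scale T \<and> (\<forall>a. Poly_Mapping.lookup (T (bas a)) (a + f) \<noteq> 0 \<and>
     (\<forall>b. Poly_Mapping.lookup (T (bas a)) b \<noteq> 0 \<longrightarrow> b = a + f \<or> height b > height a + height f))"

lemma leads_Y: "leads (Y m) {#m#}"
  using q_nonzero by (auto simp: leads_def Y_hom Y_bas lookup_scale lookup_single when_def split: if_splits)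

lemma leads_id: "leads (\<lambda>x. x) {#}"
  by (auto simp: leads_def module_hom_id lookup_single when_def split: if_splits)

lemma leads_scale: "leads T f \<Longrightarrow> c \<noteq> 0 \<Longrightarrow> leads (\<lambda>x. scale c (T x)) f"
  by (auto simp: leads_def module_hom_scale lookup_scale)

lemma hom_lookup:
  assumes "module_hom scale scale T"
  shows "Poly_Mapping.lookup (T x) b = (\<Sum>a\<in>Poly_Mapping.keys x. Poly_Mapping.lookup x a * Poly_Mapping.lookup (T (bas a)) b)"
  by (subst (1) poly_mapping_sum_bas[of x, symmetric])
     (simp add: module_hom.sum[OF assms] module_hom.scale[OF assms] lookup_sum lookup_scale)

text \<open>Height is additive, so every contribution except lowest after lowest lands strictly
  higher, and the product of the two leading scalars is nonzero in a field.\<close>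

lemma leads_compose:
  assumes S: "leads S g" and T: "leads T f"
  shows "leads (\<lambda>x. S (T x)) (f + g)"
proof -
  have hom: "module_hom scale scale S" "module_hom scale scale T" using S T by (auto simp: leads_def)
  have Tl: "b = a + f \<or> height b > height a + height f" if "Poly_Mapping.lookup (T (bas a)) b \<noteq> 0" for a b
    using T that by (auto simp: leads_def)
  have Sl: "b = a + g \<or> height b > height a + height g" if "Poly_Mapping.lookup (S (bas a)) b \<noteq> 0" for a b
    using S that by (auto simp: leads_def)
  show ?thesis
    unfolding leads_def
  proof (intro conjI allI impI)
    show "module_hom scale scale (\<lambda>x. S (T x))" using hom by (rule module_hom_compose)
    fix a
    let ?x = "T (bas a)"
    have "Poly_Mapping.lookup (S ?x) (a + (f + g)) =
      (\<Sum>c\<in>Poly_Mapping.keys ?x. if c = a + f then Poly_Mapping.lookup ?x (a + f) * Poly_Mapping.lookup (S (bas (a + f))) (a + (f + g)) else 0)"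
      unfolding hom_lookup[OF hom(1), of ?x]
    proof (intro sum.cong refl)
      fix c assume "c \<in> Poly_Mapping.keys ?x"
      then have "c = a + f \<or> height c > height a + height f" using Tl by (simp add: in_keys_iff)
      then show "Poly_Mapping.lookup ?x c * Poly_Mapping.lookup (S (bas c)) (a + (f + g)) =
        (if c = a + f then Poly_Mapping.lookup ?x (a + f) * Poly_Mapping.lookup (S (bas (a + f))) (a + (f + g)) else 0)"
        using Sl[of c "a + (f + g)"] by (cases "Poly_Mapping.lookup (S (bas c)) (a + (f + g)) = 0") (auto simp: add.assoc)
    qed
    also have "\<dots> \<noteq> 0"
      using S T by (simp add: leads_def in_keys_iff) (metis add.assoc)
    finally show "Poly_Mapping.lookup (S ?x) (a + (f + g)) \<noteq> 0" .
    fix b assume "Poly_Mapping.lookup (S ?x) b \<noteq> 0"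
    then obtain c where "Poly_Mapping.lookup ?x c \<noteq> 0" "Poly_Mapping.lookup (S (bas c)) b \<noteq> 0"
      unfolding hom_lookup[OF hom(1), of ?x] by (metis (no_types, lifting) mult_eq_0_iff sum.not_neutral_contains_not_neutral)
    then show "b = a + (f + g) \<or> height b > height a + height (f + g)"
      using Tl[of a c] Sl[of c b] by (auto simp: add.assoc)
  qed
qed

text \<open>Terms of larger height never meet the lowest term, so they cannot cancel it.\<close>

lemma leads_plus_higher:
  assumes T: "leads T f" and T': "\<And>j. j \<in> J \<Longrightarrow> leads (T' j) (f' j) \<and> height (f' j) > height f"
  shows "leads (\<lambda>x. T x + (\<Sum>j\<in>J. T' j x)) f"
proof -
  have z: "height b > height a + height f" if "j \<in> J" "Poly_Mapping.lookup (T' j (bas a)) b \<noteq> 0" for a b j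
    using T'[OF that(1)] that(2) by (fastforce simp: leads_def)
  have z': "height b > height a + height f" if "(\<Sum>j\<in>J. Poly_Mapping.lookup (T' j (bas a)) b) \<noteq> 0" for a b
    using z that by (metis (no_types, lifting) sum.not_neutral_contains_not_neutral)
  show ?thesis
    unfolding leads_def
  proof (intro conjI allI impI)
    show "module_hom scale scale (\<lambda>x. T x + (\<Sum>j\<in>J. T' j x))"
      using T T' by (intro module_hom_plus module_hom_sum) (auto simp: leads_def)
    fix a
    have "(\<Sum>j\<in>J. Poly_Mapping.lookup (T' j (bas a)) (a + f)) = 0" using z'[of a "a + f"] by auto
    then show "Poly_Mapping.lookup (T (bas a) + (\<Sum>j\<in>J. T' j (bas a))) (a + f) \<noteq> 0"
      using T by (simp add: leads_def lookup_add lookup_sum)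
    fix b assume "Poly_Mapping.lookup (T (bas a) + (\<Sum>j\<in>J. T' j (bas a))) b \<noteq> 0"
    then have "Poly_Mapping.lookup (T (bas a)) b \<noteq> 0 \<or> (\<Sum>j\<in>J. Poly_Mapping.lookup (T' j (bas a)) b) \<noteq> 0"
      by (auto simp: lookup_add lookup_sum)
    then show "b = a + f \<or> height b > height a + height f"
      using T z'[of a b] by (auto simp: leads_def)
  qed
qed

definition column :: "nat \<Rightarrow> nat \<Rightarrow> nat \<Rightarrow> (nat \<times> nat) multiset" where
  "column i d v = mset (map (\<lambda>s. (s, v)) [i..<i+d])"

lemma column_Suc: "column i (Suc d) v = add_mset (i + d, v) (column i d v)"
  by (simp add: column_def)

lemma height_column: "height (column i d v) = d * v"
  by (induction d) (simp_all add: column_Suc, simp add: column_def)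

text \<open>In the recursion the lowest term of the summand v' has height d v' + v, so v' = v is
  lowest; the factor 1 - q^-2 is nonzero by \<open>q2\<close>.\<close>

lemma leads_G:
  assumes "d > 0" "v \<le> N"
  shows "leads (G i d v) (column i d v)"
  using assms
proof (induction d arbitrary: v rule: nat_induct_non_zero)
  case 1
  then show ?case using leads_Y[of "(i, v)"] by (simp add: G.simps[abs_def] column_def)
next
  case (Suc d)
  then obtain d' where d: "d = Suc d'" by (cases d) auto
  have step: "leads (\<lambda>x. G i d v' (Y (i + d, v) x)) (add_mset (i + d, v) (column i d v'))" if "v' \<le> N" for v'
    using leads_compose[OF Suc.IH[OF that] leads_Y[of "(i + d, v)"]] by simp
  have split: "{v..N} = insert v {v<..N}" using Suc.prems by auto
  have "leads (\<lambda>x. G i d v (Y (i + d, v) x) + (\<Sum>v'\<in>{v<..N}. G i d v' (Y (i + d, v) x))) (add_mset (i + d, v) (column i d v))"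
    using step Suc.prems Suc.hyps by (intro leads_plus_higher[where f' = "\<lambda>v'. add_mset (i + d, v) (column i d v')"])
       (auto simp: height_column)
  then have "leads (\<lambda>x. scale (1 - inverse q * inverse q) (\<Sum>v'\<in>{v..N}. G i d v' (Y (i + d, v) x))) (column i (Suc d) v)"
    unfolding split column_Suc using q2 q_nonzero by (intro leads_scale) (auto simp: field_simps)
  then show ?case by (simp add: d G.simps[abs_def])
qed

lemma leads_root_poly:
  assumes "(i, j) \<in> units n"
  shows "leads (act (root_poly i (j - i))) (column i (j - i) j)"
proof -
  have ij: "i < j" "j \<le> N" using assms N by (auto simp: units_def)
  have "{j..N} = insert j {j<..N}" using ij by auto
  then have "act (root_poly i (j - i)) = (\<lambda>x. G i (j - i) j x + (\<Sum>v\<in>{j<..N}. G i (j - i) v x))"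
    using ij by (simp add: act_root_poly fun_eq_iff)
  moreover have "leads (\<lambda>x. G i (j - i) j x + (\<Sum>v\<in>{j<..N}. G i (j - i) v x)) (column i (j - i) j)"
    using ij leads_G by (intro leads_plus_higher[where f' = "column i (j - i)"]) (auto simp: height_column)
  ultimately show ?thesis by simp
qed

definition root_prod :: "(nat \<times> nat) list \<Rightarrow> (nat list \<Rightarrow>\<^sub>0 'f)" where
  "root_prod ys = prod_list (map (\<lambda>(i, j). root_poly i (j - i)) ys)"

definition exponent :: "(nat \<times> nat) list \<Rightarrow> (nat \<times> nat) multiset" where
  "exponent ys = sum_list (map (\<lambda>(i, j). column i (j - i) j) ys)"

lemma leads_root_prod: "set ys \<subseteq> units n \<Longrightarrow> leads (act (root_prod ys)) (exponent ys)"
proof (induction ys)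
  case Nil
  then show ?case using leads_id by (simp add: root_prod_def exponent_def act_one[abs_def])
next
  case (Cons y ys)
  obtain i j where y: "y = (i, j)" by (cases y)
  then show ?case
    using leads_compose[OF leads_root_poly[of i j] Cons.IH] Cons.prems
    by (simp add: root_prod_def exponent_def act_mult[abs_def] add.commute)
qed

end

section \<open>Recovering an ordered monomial from its lowest term\<close>

lemma sorted_wrt_mset_unique:
  assumes "sorted_wrt R xs" "sorted_wrt R ys" "mset xs = mset ys" "\<And>x y. R x y \<Longrightarrow> R y x \<Longrightarrow> x = y"
  shows "xs = ys"
  using assms(1-3)
proof (induction xs arbitrary: ys)
  case (Cons x xs)
  then obtain y ys' where ys: "ys = y # ys'" by (cases ys) auto
  have "x \<in> set ys" "y \<in> set (x # xs)" using Cons.prems(3) ys by (metis list.set_intros(1) set_mset_mset)+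
  then have "x = y" using Cons.prems assms(4) ys by auto
  with Cons ys show ?case by simp
qed simp

context quantum_torus
begin

lemma count_column: "count (column i (j - i) j) (s, v) = (if v = j \<and> i \<le> s \<and> s < j then 1 else 0)"
proof -
  have "count (column i d j) (s, v) = (if v = j \<and> i \<le> s \<and> s < i + d then 1 else 0)" for d
    by (induction d) (auto simp: column_Suc, auto simp: column_def)
  from this[of "j - i"] show ?thesis by auto
qed

text \<open>The column of e_iv covers the rows i to v - 1, so from row s - 1 to row s only the
  columns starting at s are gained, those of e_sv. For s = 1 the last summand is 0, as no column
  reaches row 0.\<close>

lemma count_exponent:
  assumes "set ys \<subseteq> units n" "1 \<le> s" "s < v"
  shows "count (exponent ys) (s, v) = count (mset ys) (s, v) + count (exponent ys) (s - 1, v)"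
  using assms(1)
proof (induction ys)
  case (Cons y ys)
  obtain i j where y: "y = (i, j)" by (cases y)
  have "1 \<le> i" "i < j" using Cons.prems by (auto simp: y units_def)
  then have "count (column i (j - i) j) (s, v) = (if (i, j) = (s, v) then 1 else 0) + count (column i (j - i) j) (s - 1, v)"
    unfolding count_column using assms(2,3) by auto
  then show ?case using Cons by (auto simp: y exponent_def)
qed (simp add: exponent_def)

text \<open>Differences of exponents give the multiplicities, and a sorted list is determined by its
  multiset.\<close>

lemma exponent_inj: "inj_on exponent (nondecreasing n)"
proof (rule inj_onI)
  fix xs ys assume xy: "xs \<in> nondecreasing n" "ys \<in> nondecreasing n" "exponent xs = exponent ys"
  then have u: "set xs \<subseteq> units n" "set ys \<subseteq> units n" by (auto simp: nondecreasing_def)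
  have "mset xs = mset ys"
  proof (rule multiset_eqI)
    fix y :: "nat \<times> nat"
    obtain s v where y: "y = (s, v)" by (cases y)
    show "count (mset xs) y = count (mset ys) y"
    proof (cases "1 \<le> s \<and> s < v")
      case True
      then show ?thesis using count_exponent[OF u(1), of s v] count_exponent[OF u(2), of s v] xy(3) by (simp add: y)
    next
      case False
      then have "y \<notin> set xs" "y \<notin> set ys" using u by (auto simp: y units_def)
      then show ?thesis by (metis count_eq_zero_iff set_mset_mset)
    qed
  qed
  then show "xs = ys"
    using xy by (intro sorted_wrt_mset_unique[of "\<lambda>x y. unit_less x y \<or> x = y"])
      (auto simp: nondecreasing_def dest: unit_less_asym)
qed

text \<open>Applied to the empty monomial, the sum is read off at the lowest term of a summand of
  least height. Injectivity of \<open>exponent\<close> keeps the other summands of that height away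
  from it, and the remaining ones start above it.\<close>

theorem root_prod_independent:
  assumes "finite S" "S \<subseteq> nondecreasing n"
    and zero: "(\<Sum>ys\<in>S. scal (c ys) * root_prod ys) \<in> genideal (free_algebra n) (serre_relations q n)"
    and "ys \<in> S"
  shows "c ys = 0"
proof (rule ccontr)
  assume "c ys \<noteq> 0"
  let ?S = "{ys \<in> S. c ys \<noteq> 0}" and ?h = "\<lambda>ys. height (exponent ys)"
  have fin: "finite ?S" "?S \<noteq> {}" using assms \<open>c ys \<noteq> 0\<close> by auto
  obtain zs where zs: "zs \<in> ?S" "\<And>ws. ws \<in> ?S \<Longrightarrow> ?h zs \<le> ?h ws"
    using arg_min_if_finite[OF fin, of ?h] that[of "arg_min_on ?h ?S"] not_le by blast
  have l: "leads (act (root_prod ws)) (exponent ws)" if "ws \<in> S" for ws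
    using leads_root_prod[of ws] that assms(2) by (auto simp: nondecreasing_def)
  have act_scal: "act (scal a * p) x = scale a (act p x)" for a p x
    by (simp add: act_mult act_single)
  let ?l = "\<lambda>ws. Poly_Mapping.lookup (act (root_prod ws) (bas {#})) (exponent zs)"
  have act_sum: "act (\<Sum>ws\<in>T. p ws) x = (\<Sum>ws\<in>T. act (p ws) x)" for T p x
    by (induction T rule: infinite_finite_induct) (simp_all add: act_simps)
  have "0 = (\<Sum>ws\<in>S. c ws * ?l ws)"
    using arg_cong[OF act_serre_ideal[OF zero, of "bas {#}"], of "\<lambda>p. Poly_Mapping.lookup p (exponent zs)"]
    by (simp add: act_sum act_scal lookup_sum lookup_scale)
  also have "\<dots> = (\<Sum>ws\<in>S. if ws = zs then c zs * ?l zs else 0)"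
  proof (intro sum.cong refl)
    fix ws assume ws: "ws \<in> S"
    show "c ws * ?l ws = (if ws = zs then c zs * ?l zs else 0)"
    proof (cases "ws = zs \<or> c ws = 0")
      case False
      then have "exponent ws \<noteq> exponent zs"
        using inj_onD[OF exponent_inj, of ws zs] ws zs(1) assms(2) by auto
      moreover have "\<not> ?h zs > ?h ws" using zs(2)[of ws] ws False by simp
      ultimately have "?l ws = 0"
        using l[OF ws] unfolding leads_def by (metis add_0 add_cancel_right_left height_simps(1))
      then show ?thesis using False by simp
    qed auto
  qed
  also have "\<dots> = c zs * ?l zs" using zs assms(1) by simp
  finally have "?l zs = 0" using zs(1) by simp
  moreover have "?l zs \<noteq> 0" using l[of zs] zs(1) unfolding leads_def by (metis (no_types, lifting) add_0 mem_Collect_eq)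
  ultimately show False by blast
qed

end

section \<open>The Poincare-Birkhoff-Witt basis\<close>

text \<open>Coefficients are wanted on indices rather than on vectors, and g may identify indices;
  one chosen preimage per vector resolves this.\<close>

lemma (in Modules.module) span_image_explicit:
  fixes g :: "'i \<Rightarrow> 'b"
  assumes "t \<in> span (g ` A)"
  shows "\<exists>c :: 'i \<Rightarrow>\<^sub>0 'a. Poly_Mapping.keys c \<subseteq> A \<and>
    t = (\<Sum>i\<in>Poly_Mapping.keys c. scale (Poly_Mapping.lookup c i) (g i))"
proof -
  obtain S r where S: "finite S" "S \<subseteq> g ` A" and t: "t = (\<Sum>a\<in>S. scale (r a) a)"
    using assms unfolding span_explicit by blast
  obtain T where T: "T \<subseteq> A" "inj_on g T" "S = g ` T"
    using S(2) unfolding subset_image_inj by blast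
  have fin: "finite T" using S(1) T finite_imageD by blast
  define c where "c = (\<Sum>i\<in>T. Poly_Mapping.single i (r (g i)))"
  have c: "Poly_Mapping.lookup c i = (if i \<in> T then r (g i) else 0)" for i
    using fin by (simp add: c_def lookup_sum lookup_single when_def)
  have keys: "Poly_Mapping.keys c \<subseteq> T" by (auto simp: in_keys_iff c split: if_splits)
  have "t = (\<Sum>i\<in>T. scale (r (g i)) (g i))"
    unfolding t T(3) by (rule sum.reindex_cong[OF T(2)]) auto
  also have "\<dots> = (\<Sum>i\<in>Poly_Mapping.keys c. scale (Poly_Mapping.lookup c i) (g i))"
    using fin keys by (intro sum.mono_neutral_cong_right) (auto simp: c in_keys_iff)
  finally show ?thesis using keys T(1) by blast
qed

text \<open>The coefficient of t in exp(2t) is 2, nonzero in characteristic 0.\<close>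

lemma qpow_2_neq_1: "(qpow 2 :: 'a::field_char_0 klaurent) \<noteq> 1"
proof transfer
  have "fps_exp 1 powi 2 = fps_exp (2 :: 'a)"
    using fps_exp_powi[of 2] by (simp only: of_int_numeral)
  then have "fps_nth (fps_exp 1 powi 2 :: 'a fps) 1 \<noteq> fps_nth 1 1"
    by simp
  then show "fps_exp 1 powi 2 \<noteq> (1 :: 'a fps)" by metis
qed

lemma quantum_torus_qpow: "quantum_torus (to_Kq (qpow 1 :: 'a::field_char_0 klaurent)) n (n + 1)"
proof
  have "to_Kq (qpow 1 :: 'a klaurent) * to_Kq (qpow (- 1)) = 1"
    by (simp add: qpow_mult qpow_0 flip: to_Kq_simps(4))
  then show "to_Kq (qpow 1 :: 'a klaurent) \<noteq> 0" by auto
  show "to_Kq (qpow 1 :: 'a klaurent) * to_Kq (qpow 1) \<noteq> 1"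
    using qpow_2_neq_1[where 'a = 'a] to_Kq_inj[of "qpow 2 :: 'a klaurent" 1]
    by (simp add: qpow_mult flip: to_Kq_simps(4))
qed simp

global_interpretation torus: quantum_torus "to_Kq (qpow 1 :: 'a::field_char_0 klaurent)" n "n + 1" for n
  by (rule quantum_torus_qpow)

text \<open>
  The parameter \<open>type\<close> only serves to keep all polymorphic constants at the same field \<open>'a\<close>.
\<close>

context
  fixes n :: nat and type :: "'a::field_char_0 itself"
begin

abbreviation (input) "R \<equiv> free_algebra n :: (nat list \<Rightarrow>\<^sub>0 'a klaurent fract) ring"
abbreviation (input) "U \<equiv> U_Kq n :: (nat list \<Rightarrow>\<^sub>0 'a klaurent fract) set ring"
abbreviation (input) "M \<equiv> U_q_plus n :: ('a klaurent, (nat list \<Rightarrow>\<^sub>0 'a klaurent fract) set) module"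
abbreviation (input) "cl \<equiv> U_class n :: (nat list \<Rightarrow>\<^sub>0 'a klaurent fract) \<Rightarrow> _"
abbreviation (input) "root_poly \<equiv> torus.root_poly :: nat \<Rightarrow> nat \<Rightarrow> (nat list \<Rightarrow>\<^sub>0 'a klaurent fract)"
abbreviation (input) "root_prod \<equiv> torus.root_prod :: (nat \<times> nat) list \<Rightarrow> (nat list \<Rightarrow>\<^sub>0 'a klaurent fract)"

text \<open>The lifts link the root vectors in \<open>serre_quot\<close>, where spanning is known,
  with the operators on the torus module, which separate them.\<close>

lemma abs_root_poly: "abs_serre_quot (root_poly i d) = serre.rvec i d"
proof (induction i d rule: torus.root_poly.induct)
  case (3 i d)
  then have IH: "serre.rvec i (Suc d) = abs_serre_quot (root_poly i (Suc d))" by metis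
  have "serre.rvec i (Suc (Suc d)) = serre.rvec i (Suc d) * serre_gen (i + Suc d)
      - serre_scale (qpow (- 1)) (serre_gen (i + Suc d) * serre.rvec i (Suc d))"
    by (simp add: serre.qbr_def)
  also have "\<dots> = abs_serre_quot (root_poly i (Suc (Suc d)))"
    unfolding IH
    by (simp add: serre_gen.abs_eq minus_serre_quot.abs_eq times_serre_quot.abs_eq serre_scale.abs_eq
        to_Kq_qpow_minus)
  finally show ?case by simp
qed (simp_all add: zero_serre_quot_def flip: serre_gen.abs_eq)

lemma abs_root_prod: "abs_serre_quot (root_prod ys) = serre.eprod ys"
  by (induction ys) (auto simp: torus.root_prod_def serre.e_def one_serre_quot_def abs_root_poly
     simp flip: times_serre_quot.abs_eq)

lemma abs_sum: "abs_serre_quot (\<Sum>i\<in>S. f i) = (\<Sum>i\<in>S. abs_serre_quot (f i))"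
  by (induction S rule: infinite_finite_induct) (simp_all add: zero_serre_quot_def flip: plus_serre_quot.abs_eq)

definition combination :: "((nat \<times> nat) list \<Rightarrow>\<^sub>0 'a klaurent) \<Rightarrow> (nat list \<Rightarrow>\<^sub>0 'a klaurent fract)" where
  "combination c = (\<Sum>ys\<in>Poly_Mapping.keys c. scal (to_Kq (Poly_Mapping.lookup c ys)) * root_prod ys)"

lemma abs_combination:
  "abs_serre_quot (combination c) = (\<Sum>ys\<in>Poly_Mapping.keys c. serre_scale (Poly_Mapping.lookup c ys) (serre.eprod ys))"
  by (simp add: combination_def abs_sum abs_root_prod[symmetric] serre_scale.abs_eq)

section \<open>Arithmetic of cosets and of the k-form\<close>

lemma scal_carrier: "scal c \<in> carrier (R)"
  by (simp add: carrier_iff in_range_single)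

lemma gen_carrier: "i \<in> {1..n} \<Longrightarrow> gen i \<in> carrier (R)"
  by (simp add: carrier_iff in_range_single)

lemma mult_carrier: "p \<in> carrier (R) \<Longrightarrow> r \<in> carrier (R) \<Longrightarrow> p * r \<in> carrier (R)"
  by (simp add: carrier_iff in_range_mult)

lemma add_carrier: "p \<in> carrier (R) \<Longrightarrow> r \<in> carrier (R) \<Longrightarrow> p + r \<in> carrier (R)"
  by (simp add: carrier_iff in_range_add)

lemma diff_carrier: "p \<in> carrier (R) \<Longrightarrow> r \<in> carrier (R) \<Longrightarrow> p - r \<in> carrier (R)"
  by (simp add: carrier_iff in_range_diff)

lemma uminus_carrier: "p \<in> carrier (R) \<Longrightarrow> - p \<in> carrier (R)"
  using diff_carrier[of 0 p] by (simp add: carrier_iff)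

lemma root_poly_carrier: "1 \<le> i \<Longrightarrow> i + d \<le> n + 1 \<Longrightarrow> root_poly i d \<in> carrier (R)"
  by (induction i d rule: torus.root_poly.induct)
     (auto intro!: diff_carrier mult_carrier scal_carrier gen_carrier simp: carrier_iff[of 0])

lemma root_prod_carrier: "set ys \<subseteq> units n \<Longrightarrow> root_prod ys \<in> carrier (R)"
proof (induction ys)
  case (Cons y ys)
  then show ?case
    by (auto simp: torus.root_prod_def units_def intro!: mult_carrier root_poly_carrier)
qed (simp add: torus.root_prod_def carrier_iff)

lemma combination_carrier:
  assumes "Poly_Mapping.keys c \<subseteq> nondecreasing n"
  shows "combination c \<in> carrier (R)"
proof -
  have "(\<Sum>ys\<in>S. scal (to_Kq (Poly_Mapping.lookup c ys)) * root_prod ys) \<in> carrier (R)"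
    if "finite S" "S \<subseteq> nondecreasing n" for S
    using that
  proof (induction S)
    case (insert ys S)
    then show ?case by (auto intro!: add_carrier mult_carrier scal_carrier root_prod_carrier simp: nondecreasing_def)
  qed (simp add: carrier_iff)
  then show ?thesis using assms by (simp add: combination_def)
qed

lemma U_class_eq_iff:
  assumes "p \<in> carrier (R)" "r \<in> carrier (R)"
  shows "cl p = cl r \<longleftrightarrow> p - r \<in> serre_ideal n"
  using ring.quotient_eq_iff_same_a_r_cos[OF ring_free_algebra ideal_serre_ideal assms] a_inv_free_algebra[OF assms(2)]
  by (simp add: U_class_def a_minus_def)

lemma U_class_hom: "ring_hom_ring (R) (U) (cl)"
  unfolding U_Kq_def U_class_def[abs_def] by (rule ideal.rcos_ring_hom_ring[OF ideal_serre_ideal])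

lemma U_class_one: "\<one>\<^bsub>U\<^esub> = cl 1" and U_class_zero: "\<zero>\<^bsub>U\<^esub> = cl 0"
proof -
  interpret ring_hom_ring R U cl by (rule U_class_hom)
  show "\<one>\<^bsub>U\<^esub> = cl 1" "\<zero>\<^bsub>U\<^esub> = cl 0" using hom_one hom_zero by simp_all
qed

lemma U_class_mult: "p \<in> carrier R \<Longrightarrow> r \<in> carrier R \<Longrightarrow> cl p \<otimes>\<^bsub>U\<^esub> cl r = cl (p * r)"
  and U_class_add: "p \<in> carrier R \<Longrightarrow> r \<in> carrier R \<Longrightarrow> cl p \<oplus>\<^bsub>U\<^esub> cl r = cl (p + r)"
  and U_class_uminus: "p \<in> carrier R \<Longrightarrow> \<ominus>\<^bsub>U\<^esub> cl p = cl (- p)"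
  and U_class_closed: "p \<in> carrier R \<Longrightarrow> cl p \<in> carrier U"
proof -
  interpret ring_hom_ring R U cl by (rule U_class_hom)
  show "p \<in> carrier R \<Longrightarrow> r \<in> carrier R \<Longrightarrow> cl p \<otimes>\<^bsub>U\<^esub> cl r = cl (p * r)"
    "p \<in> carrier R \<Longrightarrow> r \<in> carrier R \<Longrightarrow> cl p \<oplus>\<^bsub>U\<^esub> cl r = cl (p + r)"
    "p \<in> carrier R \<Longrightarrow> cl p \<in> carrier U"
    using hom_mult[of p r] hom_add[of p r] by simp_all
  show "p \<in> carrier R \<Longrightarrow> \<ominus>\<^bsub>U\<^esub> cl p = cl (- p)"
    using hom_a_inv[of p] by (simp add: a_inv_free_algebra)
qed

lemma M_simps [simp]:
  "x \<otimes>\<^bsub>M\<^esub> y = x \<otimes>\<^bsub>U\<^esub> y" "x \<oplus>\<^bsub>M\<^esub> y = x \<oplus>\<^bsub>U\<^esub> y"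
  "\<one>\<^bsub>M\<^esub> = \<one>\<^bsub>U\<^esub>" "\<zero>\<^bsub>M\<^esub> = \<zero>\<^bsub>U\<^esub>"
  "c \<odot>\<^bsub>M\<^esub> x = cl (scal (to_Kq c)) \<otimes>\<^bsub>U\<^esub> x"
  by (simp_all add: U_q_plus_def)

lemma ring_U: "ring (U)"
  unfolding U_Kq_def by (rule ideal.quotient_is_ring[OF ideal_serre_ideal])

lemma generators_carrier:
  "range (\<lambda>c. cl (scal (to_Kq c))) \<union> (\<lambda>i. cl (gen i)) ` {1..n} \<subseteq> carrier (U)"
  using U_class_closed[OF scal_carrier] U_class_closed[OF gen_carrier] by blast

lemma subring_M: "subring (carrier (M)) (U)"
  unfolding U_q_plus_def using ring.generate_ring_is_subring[OF ring_U generators_carrier] by simp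

lemma M_closed:
  "x \<in> carrier (M) \<Longrightarrow> y \<in> carrier (M) \<Longrightarrow> x \<otimes>\<^bsub>U\<^esub> y \<in> carrier (M)"
  "x \<in> carrier (M) \<Longrightarrow> y \<in> carrier (M) \<Longrightarrow> x \<oplus>\<^bsub>U\<^esub> y \<in> carrier (M)"
  "x \<in> carrier (M) \<Longrightarrow> \<ominus>\<^bsub>U\<^esub> x \<in> carrier (M)"
  "\<one>\<^bsub>U\<^esub> \<in> carrier (M)" "\<zero>\<^bsub>U\<^esub> \<in> carrier (M)"
  "cl (scal (to_Kq c)) \<in> carrier (M)" "i \<in> {1..n} \<Longrightarrow> cl (gen i) \<in> carrier (M)"
proof -
  show "x \<in> carrier (M) \<Longrightarrow> y \<in> carrier (M) \<Longrightarrow> x \<otimes>\<^bsub>U\<^esub> y \<in> carrier (M)"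
    "x \<in> carrier (M) \<Longrightarrow> y \<in> carrier (M) \<Longrightarrow> x \<oplus>\<^bsub>U\<^esub> y \<in> carrier (M)"
    "x \<in> carrier (M) \<Longrightarrow> \<ominus>\<^bsub>U\<^esub> x \<in> carrier (M)"
    "\<one>\<^bsub>U\<^esub> \<in> carrier (M)" "\<zero>\<^bsub>U\<^esub> \<in> carrier (M)"
    by (rule subringE[OF subring_M]; assumption)+
  show "cl (scal (to_Kq c)) \<in> carrier (M)" "i \<in> {1..n} \<Longrightarrow> cl (gen i) \<in> carrier (M)"
    by (auto simp: U_q_plus_def intro!: generate_ring.incl)
qed

lemma abelian_group_M: "abelian_group (M)"
proof -
  interpret ring "U" by (rule ring_U)
  have sub: "x \<in> carrier (M) \<Longrightarrow> x \<in> carrier (U)" for x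
    using subringE(1)[OF subring_M] by blast
  show ?thesis
  proof (rule abelian_groupI)
    fix x assume "x \<in> carrier (M)"
    then show "\<exists>y\<in>carrier (M). y \<oplus>\<^bsub>M\<^esub> x = \<zero>\<^bsub>M\<^esub>"
      using l_neg[OF sub] by (intro bexI[of _ "\<ominus>\<^bsub>U\<^esub> x"]) (auto simp: M_closed)
  qed (simp_all add: M_closed sub a_assoc a_comm a_lcomm)
qed

text \<open>\<open>a_inv\<close> is a definite description over the carrier, so passing to the
  smaller carrier of the k-form requires an argument.\<close>

lemma a_inv_M:
  assumes "x \<in> carrier (M)"
  shows "\<ominus>\<^bsub>M\<^esub> x = \<ominus>\<^bsub>U\<^esub> x"
proof -
  interpret M_group: abelian_group "M" by (rule abelian_group_M)
  interpret ring "U" by (rule ring_U)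
  have "x \<in> carrier (U)" using subringE(1)[OF subring_M] assms by blast
  then show ?thesis using assms by (intro M_group.minus_equality) (auto simp: M_closed l_neg)
qed

text \<open>Membership and value go through one induction: the subtraction in
  \<open>root_vec\<close> is that of \<open>U_q_plus n\<close>, which \<open>a_inv_M\<close>
  identifies with that of \<open>U_Kq n\<close> only on the k-form.\<close>

lemma root_vec_eq:
  "1 \<le> i \<Longrightarrow> i + d \<le> n + 1 \<Longrightarrow> d > 0 \<Longrightarrow>
    root_vec n i d \<in> carrier (M) \<inter> {cl (root_poly i d)}"
proof (induction i d rule: torus.root_poly.induct)
  case (2 i)
  then show ?case using M_closed(7)[of i] by simp
next
  case (3 i d)
  let ?p = "root_poly i (Suc d)" and ?g = "gen (i + Suc d)"
  have IH: "root_vec n i (Suc d) = cl ?p" "cl ?p \<in> carrier (M)"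
    using 3 by auto
  have p: "?p \<in> carrier (R)" and g: "?g \<in> carrier (R)"
    using 3 by (auto intro!: root_poly_carrier gen_carrier)
  have G: "cl ?g \<in> carrier (M)" using 3 by (intro M_closed(7)) auto
  have m: "cl (scal (to_Kq (qpow (- 1)))) \<otimes>\<^bsub>U\<^esub> (cl ?g \<otimes>\<^bsub>U\<^esub> cl ?p) \<in> carrier (M)"
    by (intro M_closed(1,6) G IH(2))
  let ?v = "cl ?p \<otimes>\<^bsub>U\<^esub> cl ?g \<oplus>\<^bsub>U\<^esub>
     \<ominus>\<^bsub>U\<^esub> (cl (scal (to_Kq (qpow (- 1)))) \<otimes>\<^bsub>U\<^esub> (cl ?g \<otimes>\<^bsub>U\<^esub> cl ?p))"
  have eq: "root_vec n i (Suc (Suc d)) = ?v"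
    using a_inv_M[OF m] by (simp add: IH(1) a_minus_def del: add_Suc_right)
  have "?v \<in> carrier M"
    by (intro M_closed m G IH(2))
  moreover have "?v = cl (?p * ?g + - (scal (to_Kq (qpow (- 1))) * (?g * ?p)))"
    by (simp add: U_class_mult U_class_add U_class_uminus p g mult_carrier scal_carrier uminus_carrier add_carrier del: add_Suc_right)
  ultimately show ?case
    unfolding eq by (simp add: to_Kq_qpow_minus)
qed auto

lemma monomial_eq:
  "set ys \<subseteq> units n \<Longrightarrow> monomial n ys \<in> carrier (M) \<inter> {cl (root_prod ys)}"
proof (induction ys)
  case Nil
  then show ?case using U_class_one
    by (simp add: monomial_def torus.root_prod_def M_closed(4)[unfolded U_class_one])
next
  case (Cons y ys)
  obtain i j where y: "y = (i, j)" by (cases y)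
  have ij: "1 \<le> i" "i < j" "j \<le> n + 1" using Cons.prems by (auto simp: y units_def)
  then have r: "root_vec n i (j - i) = cl (root_poly i (j - i))" "root_vec n i (j - i) \<in> carrier (M)"
    using root_vec_eq[of i "j - i"] by auto
  have p: "root_poly i (j - i) \<in> carrier (R)" "root_prod ys \<in> carrier (R)"
    using ij Cons.prems by (auto intro!: root_poly_carrier root_prod_carrier)
  have mon: "monomial n ys \<in> carrier M" using Cons by auto
  have "monomial n (y # ys) = root_vec n i (j - i) \<otimes>\<^bsub>U\<^esub> monomial n ys"
    by (simp add: monomial_def y)
  moreover have "root_prod (y # ys) = root_poly i (j - i) * root_prod ys"
    by (simp add: torus.root_prod_def y)
  ultimately show ?case
    using Cons r p M_closed(1)[OF r(2) mon] by (simp add: U_class_mult U_class_add U_class_uminus)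
qed

lemma finsum_eq:
  assumes "Poly_Mapping.keys c \<subseteq> nondecreasing n"
  shows "(\<Oplus>\<^bsub>M\<^esub>ys\<in>Poly_Mapping.keys c. Poly_Mapping.lookup c ys \<odot>\<^bsub>M\<^esub> monomial n ys)
    = cl (combination c)"
proof -
  interpret M_group: abelian_group "M" by (rule abelian_group_M)
  let ?f = "\<lambda>ys. Poly_Mapping.lookup c ys \<odot>\<^bsub>M\<^esub> monomial n ys"
  let ?g = "\<lambda>ys. scal (to_Kq (Poly_Mapping.lookup c ys)) * root_prod ys"
  have f: "?f ys = cl (?g ys)" "?f ys \<in> carrier (M)" "?g ys \<in> carrier (R)"
    if "ys \<in> nondecreasing n" for ys
  proof -
    have ys: "set ys \<subseteq> units n" using that by (simp add: nondecreasing_def)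
    have mon: "monomial n ys \<in> carrier M" using monomial_eq[OF ys] by blast
    show "?f ys = cl (?g ys)"
      using monomial_eq[OF ys] by (simp add: U_class_mult U_class_add U_class_uminus scal_carrier root_prod_carrier[OF ys])
    show "?f ys \<in> carrier (M)"
      using M_closed(1)[OF M_closed(6) mon] by simp
    show "?g ys \<in> carrier (R)"
      by (intro mult_carrier scal_carrier root_prod_carrier[OF ys])
  qed
  have "finsum (M) ?f S = cl (\<Sum>ys\<in>S. ?g ys) \<and> (\<Sum>ys\<in>S. ?g ys) \<in> carrier (R)"
    if "finite S" "S \<subseteq> nondecreasing n" for S
    using that
  proof (induction S)
    case empty
    then show ?case using U_class_zero by (simp add: carrier_iff)
  next
    case (insert ys S)
    have "finsum (M) ?f (insert ys S) = ?f ys \<oplus>\<^bsub>M\<^esub> finsum (M) ?f S"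
      using insert f(2) by (intro M_group.finsum_insert) auto
    also have "\<dots> = cl (?g ys) \<oplus>\<^bsub>U\<^esub> cl (\<Sum>ys\<in>S. ?g ys)"
      using insert f(1)[of ys] by simp
    also have "\<dots> = cl (?g ys + (\<Sum>ys\<in>S. ?g ys))"
      using insert f(3)[of ys] by (intro U_class_add) auto
    finally show ?case using insert f(3)[of ys] by (simp add: add_carrier)
  qed
  then show ?thesis using assms by (simp add: combination_def)
qed

text \<open>Two ordered words concatenate to a word in root vectors, which
  \<open>eprod_in_span\<close> straightens; thus the k-span of ordered monomials is closed under
  products.\<close>

lemma span_eprod_mult:
  assumes "x \<in> serre.span (serre.eprod ` nondecreasing n)" "y \<in> serre.span (serre.eprod ` nondecreasing n)"
  shows "x * y \<in> serre.span (serre.eprod ` nondecreasing n)"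
proof -
  let ?S = "serre.span (serre.eprod ` nondecreasing n)"
  have 1: "serre.eprod xs * y \<in> ?S" if xs: "xs \<in> nondecreasing n" for xs
  proof -
    have "(\<lambda>m. serre.eprod xs * m * 1) ` serre.eprod ` nondecreasing n \<subseteq> ?S"
    proof clarify
      fix ys assume ys: "ys \<in> nondecreasing n"
      have "serre.eprod (xs @ ys) \<in> ?S"
        using xs ys by (intro serre.eprod_in_span) (auto simp: nondecreasing_def)
      then show "serre.eprod xs * serre.eprod ys * 1 \<in> ?S" by simp
    qed
    then have "serre.eprod xs * y * 1 \<in> ?S"
      using serre.span_mult[OF assms(2), of "serre.eprod xs" 1] serre.span_minimal[OF _ serre.subspace_span] by blast
    then show ?thesis by simp
  qed
  have "(\<lambda>m. 1 * m * y) ` serre.eprod ` nondecreasing n \<subseteq> ?S" using 1 by auto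
  then have "1 * x * y \<in> ?S"
    using serre.span_mult[OF assms(1), of 1 y] serre.span_minimal[OF _ serre.subspace_span] by blast
  then show ?thesis by simp
qed

text \<open>That k-span is a subring containing the scalars and each E_i = e_{i,i+1}, hence the
  whole generated ring. A representative p is carried along because x is a coset of
  \<open>serre_ideal n\<close>, whereas the span lives in \<open>serre_quot\<close>.\<close>

lemma carrier_M_spanned:
  assumes "x \<in> carrier (M)"
  shows "\<exists>p\<in>carrier (R). x = cl p \<and> abs_serre_quot p \<in> serre.span (serre.eprod ` nondecreasing n)"
proof -
  let ?S = "serre.span (serre.eprod ` nondecreasing n) :: 'a serre_quot set"
  have one: "1 \<in> ?S" using serre.eprod_in_span[of "[]" n] by simp
  have "x \<in> generate_ring (U) (range (\<lambda>c. cl (scal (to_Kq c))) \<union> (\<lambda>i. cl (gen i)) ` {1..n})"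
    using assms by (simp add: U_q_plus_def)
  then show ?thesis
  proof (induction rule: generate_ring.induct)
    case one
    have "abs_serre_quot 1 = (1 :: 'a serre_quot)" by (simp add: one_serre_quot_def)
    then show ?case
      using \<open>1 \<in> ?S\<close> U_class_one by (intro bexI[of _ 1]) (simp_all add: carrier_iff)
  next
    case (incl h)
    then consider c where "h = cl (scal (to_Kq c))" | i where "i \<in> {1..n}" "h = cl (gen i)" by blast
    then show ?case
    proof cases
      case (1 c)
      have "abs_serre_quot (scal (to_Kq c)) = serre_scale c 1"
        by (simp add: one_serre_quot_def serre_scale.abs_eq)
      then show ?thesis using 1 serre.span_scale[OF \<open>1 \<in> ?S\<close>] by (intro bexI[OF _ scal_carrier]) auto
    next
      case (2 i)
      have "abs_serre_quot (gen i) = (serre.eprod [(i, Suc i)] :: 'a serre_quot)"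
        by (simp add: serre.e_Suc serre_gen.abs_eq)
      moreover have "(serre.eprod [(i, Suc i)] :: 'a serre_quot) \<in> ?S"
        using 2 by (intro serre.eprod_in_span) (auto simp: units_def)
      ultimately show ?thesis using 2 by (intro bexI[OF _ gen_carrier]) auto
    qed
  next
    case (a_inv h)
    then obtain p where p: "p \<in> carrier (R)" "h = cl p" "abs_serre_quot p \<in> ?S" by blast
    have "abs_serre_quot (- p) \<in> ?S" using serre.span_neg[OF p(3)] by (simp add: uminus_serre_quot.abs_eq)
    then show ?case using p U_class_uminus[OF p(1)] by (intro bexI[OF _ uminus_carrier[OF p(1)]]) auto
  next
    case (eng_add h1 h2)
    then obtain p r where p: "p \<in> carrier (R)" "h1 = cl p" "abs_serre_quot p \<in> ?S"
      and r: "r \<in> carrier (R)" "h2 = cl r" "abs_serre_quot r \<in> ?S" by blast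
    have "abs_serre_quot (p + r) \<in> ?S" using serre.span_add[OF p(3) r(3)] by (simp add: plus_serre_quot.abs_eq)
    then show ?case using p r U_class_add[OF p(1) r(1)] by (intro bexI[OF _ add_carrier[OF p(1) r(1)]]) auto
  next
    case (eng_mult h1 h2)
    then obtain p r where p: "p \<in> carrier (R)" "h1 = cl p" "abs_serre_quot p \<in> ?S"
      and r: "r \<in> carrier (R)" "h2 = cl r" "abs_serre_quot r \<in> ?S" by blast
    have "abs_serre_quot (p * r) \<in> ?S" using span_eprod_mult[OF p(3) r(3)] by (simp add: times_serre_quot.abs_eq)
    then show ?case using p r U_class_mult[OF p(1) r(1)] by (intro bexI[OF _ mult_carrier[OF p(1) r(1)]]) auto
  qed
qed

text \<open>Uniqueness is inherited from K(q): the difference of two representations lies in the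
  Serre ideal, so its coefficients vanish in K(q), into which k embeds.\<close>

theorem pbw_basis:
  "free_module_basis M (nondecreasing n) (monomial n)"
  unfolding free_module_basis_def
proof (intro conjI ballI)
  show "monomial n ` nondecreasing n \<subseteq> carrier M"
    using monomial_eq unfolding nondecreasing_def by blast
  fix x assume "x \<in> carrier M"
  then obtain p where p: "p \<in> carrier (R)" "x = cl p"
    "abs_serre_quot p \<in> serre.span (serre.eprod ` nondecreasing n)"
    using carrier_M_spanned by blast
  obtain c where c: "Poly_Mapping.keys c \<subseteq> nondecreasing n" "abs_serre_quot p = abs_serre_quot (combination c)"
    using serre.span_image_explicit[OF p(3)] by (auto simp: abs_combination)
  \<comment> \<open>Equality in \<open>serre_quot\<close>, with its unbounded letters, descends to
    cosets of \<open>serre_ideal n\<close> since both representatives use only the letters 1 to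
    n.\<close>
  have x: "x = cl (combination c)"
    using abs_eq_imp_serre_ideal[OF c(2) p(1) combination_carrier[OF c(1)]] p(2)
      U_class_eq_iff[OF p(1) combination_carrier[OF c(1)]] by simp
  show "\<exists>!c. Poly_Mapping.keys c \<subseteq> nondecreasing n \<and>
    x = (\<Oplus>\<^bsub>M\<^esub>i \<in> Poly_Mapping.keys c. Poly_Mapping.lookup c i \<odot>\<^bsub>M\<^esub> monomial n i)"
  proof (intro ex1I[of _ c] conjI)
    show "Poly_Mapping.keys c \<subseteq> nondecreasing n" by fact
    show "x = (\<Oplus>\<^bsub>M\<^esub>i \<in> Poly_Mapping.keys c. Poly_Mapping.lookup c i \<odot>\<^bsub>M\<^esub> monomial n i)"
      using x finsum_eq[OF c(1)] by simp
    fix d assume d: "Poly_Mapping.keys d \<subseteq> nondecreasing n \<and>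
      x = (\<Oplus>\<^bsub>M\<^esub>i \<in> Poly_Mapping.keys d. Poly_Mapping.lookup d i \<odot>\<^bsub>M\<^esub> monomial n i)"
    then have "cl (combination d) = cl (combination c)"
      using x finsum_eq[of d] by simp
    then have "combination d - combination c \<in> serre_ideal n"
      using U_class_eq_iff[OF combination_carrier combination_carrier] d c(1) by blast
    moreover define S where "S = Poly_Mapping.keys c \<union> Poly_Mapping.keys d"
    have S: "finite S" "S \<subseteq> nondecreasing n" using c(1) d by (auto simp: S_def)
    have comb: "combination e = (\<Sum>ys\<in>S. scal (to_Kq (Poly_Mapping.lookup e ys)) * root_prod ys)"
      if "Poly_Mapping.keys e \<subseteq> S" for e :: "(nat \<times> nat) list \<Rightarrow>\<^sub>0 'a klaurent"
      unfolding combination_def using S(1) that by (intro sum.mono_neutral_left) (auto simp: in_keys_iff)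
    have "combination d - combination c =
      (\<Sum>ys\<in>S. scal (to_Kq (Poly_Mapping.lookup d ys - Poly_Mapping.lookup c ys)) * root_prod ys)"
      using comb[of d] comb[of c] by (simp add: S_def sum_subtractf left_diff_distrib single_diff)
    ultimately have "(\<Sum>ys\<in>S. scal (to_Kq (Poly_Mapping.lookup d ys - Poly_Mapping.lookup c ys)) * root_prod ys)
        \<in> genideal (R) (serre_relations (to_Kq (qpow 1)) n)"
      by (simp add: serre_ideal_def)
    from torus.root_prod_independent[OF S this]
    have eq: "Poly_Mapping.lookup d ys = Poly_Mapping.lookup c ys" if "ys \<in> S" for ys
      using that to_Kq_inj[of "Poly_Mapping.lookup d ys - Poly_Mapping.lookup c ys" 0] by simp
    show "d = c"
    proof (rule poly_mapping_eqI)
      fix ys show "Poly_Mapping.lookup d ys = Poly_Mapping.lookup c ys"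
        using eq[of ys] by (cases "ys \<in> S") (auto simp: S_def in_keys_iff)
    qed
  qed
qed

end

theorem corollary10p1:
  fixes n :: nat
  assumes "n \<ge> 1"
  shows "free_module_basis (U_q_plus n :: ('a::field_char_0 klaurent, _) module) (nondecreasing n) (monomial n) \<and>
         base_change eval_t0 (sl_plus_q n :: (nat \<times> nat, 'a klaurent) t_lie) = sl_plus n \<and>
         t_lie_deformation eval_t0 (sl_plus_q n :: (nat \<times> nat, 'a klaurent) t_lie) (sl_plus n)"
  by (intro conjI pbw_basis base_change_sl_plus_q t_lie_deformation_sl_plus_q)

end
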